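(* Let $\kappa,\lambda$ be infinite cardinals with $\mathbf{c}\le\kappa\le\lambda\le 2^\kappa$. Then there exist $2^\lambda$ mutually non-homeomorphic connected, totally pathwise disconnected, nowhere locally connected, almost metrizable spaces of size $\kappa$ and weight $\lambda$.
   Context: $\mathbf{c}=2^{\aleph_0}$. The size of a space is its cardinality; the weight is the least size of a basis. A space is totally pathwise disconnected if every continuous map from $[0,1]$ into it is constant. A space is nowhere locally connected if it is not locally connected at any of its points. A space is perfectly normal if it is normal (including Hausdorff) and every closed set is a $G_\delta$-set. A space $X$ is almost metrizable if $X$ is perfectly normal and $X\setminus\{x\}$ is metrizable for some $x\in X$. *)

theory Defs
  imports "HOL-Analysis.Analysis"
begin

unbundle cardinal_syntax

abbreviation continuum :: "(nat \<Rightarrow> bool) rel"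
  where "continuum \<equiv> ctwo ^c natLeq"

definition base_of :: "'a set set \<Rightarrow> 'a topology \<Rightarrow> bool"
  where "base_of B X \<longleftrightarrow> openin X = arbitrary union_of (\<lambda>U. U \<in> B)"

(* The weight is specified only up to =o. Since card_of B is a well-order, a base of least
   cardinality always exists. *)
definition has_weight :: "'a topology \<Rightarrow> 'b rel \<Rightarrow> bool"
  where "has_weight X r \<longleftrightarrow>
    (\<exists>B. base_of B X \<and> |B| =o r) \<and> (\<forall>B. base_of B X \<longrightarrow> r \<le>o |B| )"

definition totally_pathwise_disconnected_space :: "'a topology \<Rightarrow> bool"
  where "totally_pathwise_disconnected_space X \<longleftrightarrow>
    (\<forall>g. pathin X g \<longrightarrow> (\<exists>c. \<forall>t\<in>{0..1}. g t = c))"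

(* Local connectedness at a point, as in the library, asks for a neighbourhood base of
   open connected sets; weakly_locally_connected_at is the variant without openness. *)
definition nowhere_locally_connected_space :: "'a topology \<Rightarrow> bool"
  where "nowhere_locally_connected_space X \<longleftrightarrow>
    (\<forall>x\<in>topspace X. \<not> locally_connected_at x X)"

definition perfectly_normal_space :: "'a topology \<Rightarrow> bool"
  where "perfectly_normal_space X \<longleftrightarrow>
    normal_space X \<and> Hausdorff_space X \<and> (\<forall>C. closedin X C \<longrightarrow> gdelta_in X C)"

definition almost_metrizable_space :: "'a topology \<Rightarrow> bool"
  where "almost_metrizable_space X \<longleftrightarrow>
    perfectly_normal_space X \<and>
    (\<exists>x\<in>topspace X. metrizable_space (subtopology X (topspace X - {x})))"

end

theory Submission
  imports Defs
begin

text \<open>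
  Start from a variant of Erdos space: sequences of nonnegative rationals with finite sum,
  topologised by the coordinates together with the sum. It is totally disconnected and second
  countable, but the sum is unbounded on each nonempty clopen set, so a point at infinity makes it
  connected.

  For each \<open>a < \<kappa>\<close> take the product of this space with a scattered metrizable tree of rank
  \<open>a\<close> and with a discrete line of sheets, and add one point to it. This gives a connected
  metrizable piece \<open>Z\<^sub>a\<close>, and \<open>a\<close> is a topological invariant of \<open>Z\<^sub>a\<close> because the rank of a
  point can be recovered by repeatedly removing the points at which the space is locally second
  countable.

  Finally adjoin a point \<open>\<infinity>\<close> to the sum of countably many copies of each \<open>Z\<^sub>a\<close>. Every
  neighbourhood of \<open>\<infinity>\<close> meets every piece, which gives connectedness; whether it contains
  whole copies of \<open>Z\<^sub>a\<close> is governed by the filter generated by \<open>\<mu>\<close> members of an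
  independent family on \<open>\<kappa>\<close>. Independence makes the character at \<open>\<infinity>\<close> equal to
  \<open>\<mu>\<close>. A homeomorphism fixes \<open>\<infinity>\<close>, the only point of uncountable character, and
  permutes the pieces (the components of the complement) without changing their index, so it
  determines the chosen members. As \<open>\<mu>\<close> members can be chosen in \<open>2\<^sup>\<mu>\<close> ways, the
  theorem follows.
\<close>

subsection \<open>Erdos space\<close>

text \<open>A metrizable space of infinite size \<kappa> has a base of at most \<kappa> sets, so a
  weight \<mu> above \<kappa> must come from a point where metrizability fails; the character of
  \<infinity> alone supplies it. Such a point can record a choice among \<mu> objects only through a
  filter, and the filter can be read off topologically only if the places it speaks about can be
  told apart. Hence the need for \<kappa> pairwise non-homeomorphic connected pieces, which ranks
  provide. The copies of each piece serve perfect normality: \<infinity> has to be a countable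
  intersection of open sets, so its neighbourhoods also have to leave every initial segment of the
  copies, whatever the chosen sets have in common. That \<kappa> is at least the continuum pays for
  Erdos space, the real labels in the lists and the sheets. Each adjoined point restores
  connectedness but might become a point of local connectedness; the balls of radius 2 in the sheets
  prevent this. In \<open>erdos\<close> a sequence is stored together with its sum, so that the
  topology of the product type already makes the sum continuous.\<close>

definition erdos :: "((nat \<Rightarrow> real) \<times> real) set"
  where "erdos = {(x, t). (\<forall>i. x i \<in> \<rat> \<and> 0 \<le> x i) \<and> x sums t}"

lemma erdos_snd_nonneg: "p \<in> erdos \<Longrightarrow> 0 \<le> snd p"
  by (auto simp: erdos_def intro: sums_le[OF _ sums_zero])

lemma zero_in_erdos: "((\<lambda>i. 0), 0) \<in> erdos"
  by (auto simp: erdos_def)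

lemma tendsto_fun_iff:
  fixes f :: "'b \<Rightarrow> 'i \<Rightarrow> 'a::topological_space"
  shows "(f \<longlongrightarrow> l) F \<longleftrightarrow> (\<forall>i. ((\<lambda>c. f c i) \<longlongrightarrow> l i) F)"
proof -
  have "(f \<longlongrightarrow> l) F \<longleftrightarrow> limitin (product_topology (\<lambda>i. euclidean) UNIV) f l F"
    by (simp add: euclidean_product_topology)
  also have "\<dots> \<longleftrightarrow> (\<forall>i. ((\<lambda>c. f c i) \<longlongrightarrow> l i) F)"
    by (simp add: limitin_componentwise)
  finally show ?thesis .
qed

definition erdos_shift :: "nat \<Rightarrow> nat \<Rightarrow> (nat \<Rightarrow> real) \<times> real \<Rightarrow> (nat \<Rightarrow> real) \<times> real"
  where "erdos_shift k j p = ((fst p)(k := fst p k + real j / real (Suc k)), snd p + real j / real (Suc k))"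

lemma erdos_shift_in: "p \<in> erdos \<Longrightarrow> erdos_shift k j p \<in> erdos"
proof -
  assume p: "p \<in> erdos"
  have "(\<lambda>i. fst p i + (if i = k then real j / real (Suc k) else 0)) sums (snd p + real j / real (Suc k))"
    using p by (intro sums_add sums_single) (auto simp: erdos_def)
  moreover have "(\<lambda>i. fst p i + (if i = k then real j / real (Suc k) else 0)) =
      (fst p)(k := fst p k + real j / real (Suc k))"
    by auto
  ultimately show ?thesis
    using p by (auto simp: erdos_def erdos_shift_def)
qed

text \<open>Every step raises the sum by the same amount \<open>1 / (k + 1)\<close>, so a walk in
  one coordinate cannot remain in a set on which the sums are bounded.\<close>

lemma erdos_shift_exit:
  assumes "p \<in> A" "\<And>q. q \<in> A \<Longrightarrow> snd q \<le> M"
  shows "\<exists>j. erdos_shift k j p \<in> A \<and> erdos_shift k (Suc j) p \<notin> A"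
proof (rule ccontr)
  assume "\<not> ?thesis"
  then have step: "erdos_shift k j p \<in> A \<Longrightarrow> erdos_shift k (Suc j) p \<in> A" for j
    by blast
  have all: "erdos_shift k j p \<in> A" for j
  proof (induction j)
    case 0
    then show ?case using assms(1) by (simp add: erdos_shift_def)
  qed (rule step)
  obtain j :: nat where "(M - snd p) * real (Suc k) < real j"
    using reals_Archimedean2 by blast
  then have "M < snd (erdos_shift k j p)"
    by (simp add: erdos_shift_def field_simps)
  then show False
    using assms(2)[OF all[of j]] by linarith
qed

text \<open>Erdos' argument: walk through the coordinates, in the \<open>k\<close>-th one increasing by steps of
  \<open>1/(k+1)\<close> as long as one stays inside the set. If the norms stay bounded, the positions converge
  in norm to a boundary point of the set.\<close>

lemma erdos_clopen_unbounded:
  assumes op: "openin (top_of_set erdos) A" and cl: "closedin (top_of_set erdos) A" and "A \<noteq> {}"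
  shows "\<exists>p\<in>A. M < snd p"
proof (rule ccontr)
  assume "\<not> ?thesis"
  then have M: "\<And>q. q \<in> A \<Longrightarrow> snd q \<le> M" by force
  have AE: "A \<subseteq> erdos" using op openin_imp_subset by blast
  obtain p0 where p0: "p0 \<in> A" using \<open>A \<noteq> {}\<close> by blast
  have "\<exists>f. \<forall>n. (f n \<in> A \<and> (n = 0 \<longrightarrow> f n = p0)) \<and>
     (\<exists>j. f (Suc n) = erdos_shift n j (f n) \<and> erdos_shift n (Suc j) (f n) \<notin> A)"
  proof (rule dependent_nat_choice)
    show "\<exists>x. x \<in> A \<and> (0 = (0::nat) \<longrightarrow> x = p0)" using p0 by blast
  next
    fix x and n :: nat
    assume "x \<in> A \<and> (n = 0 \<longrightarrow> x = p0)"
    then show "\<exists>y. (y \<in> A \<and> (Suc n = 0 \<longrightarrow> y = p0)) \<and>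
       (\<exists>j. y = erdos_shift n j x \<and> erdos_shift n (Suc j) x \<notin> A)"
      using erdos_shift_exit[of x A M n] M by (metis nat.distinct(1))
  qed
  then obtain f j where fA: "\<And>n. f n \<in> A" and f0: "f 0 = p0"
    and fS: "\<And>n. f (Suc n) = erdos_shift n (j n) (f n)"
    and out: "\<And>n. erdos_shift n (Suc (j n)) (f n) \<notin> A"
    by metis
  \<comment> \<open>Step \<open>n\<close> changes only coordinate \<open>n\<close>, so coordinate
    \<open>i\<close> has its final value after step \<open>i\<close>.\<close>
  define y where "y i = fst (f (Suc i)) i" for i
  have S1: "fst (f (Suc n)) i = fst (f n) i" if "i \<noteq> n" for n i
    using that by (simp add: fS erdos_shift_def)
  have low: "fst (f n) i = fst p0 i" if "n \<le> i" for n i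
    using that by (induction n) (auto simp: f0 S1)
  have high: "fst (f n) i = y i" if "i < n" for n i
    using that
  proof (induction n)
    case (Suc n)
    then show ?case by (cases "i = n") (auto simp: y_def S1)
  qed simp
  have E: "f n \<in> erdos" for n using fA AE by blast
  have snd_f: "snd (f (Suc n)) = snd (f n) + (fst (f (Suc n)) n - fst (f n) n)" for n
    by (simp add: fS erdos_shift_def)
  have snd_eq: "snd (f n) = snd p0 + (\<Sum>i<n. y i) - (\<Sum>i<n. fst p0 i)" for n
    by (induction n) (auto simp: f0 snd_f low y_def)
  have inc: "incseq (\<lambda>n. snd (f n))"
    by (rule incseq_SucI) (simp add: fS erdos_shift_def)
  obtain T where T: "(\<lambda>n. snd (f n)) \<longlonglongrightarrow> T"
    using incseq_convergent[OF inc] fA M by meson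
  \<comment> \<open>The coordinates of \<open>f n\<close> from \<open>n\<close> on still agree with
    \<open>p0\<close>, and their sum tends to 0. Hence the limit \<open>T\<close> of the sums is the
    sum of the limit sequence \<open>y\<close>, which puts \<open>(y, T)\<close> into
    \<open>erdos\<close>.\<close>
  have "(\<lambda>n. \<Sum>i<n. fst p0 i) \<longlonglongrightarrow> snd p0"
    using E[of 0] by (auto simp: f0 erdos_def sums_def)
  then have "(\<lambda>n. snd (f n) - snd p0 + (\<Sum>i<n. fst p0 i)) \<longlonglongrightarrow> T - snd p0 + snd p0"
    by (intro tendsto_intros T)
  then have "y sums T"
    by (simp add: sums_def snd_eq)
  moreover have "y i \<in> \<rat> \<and> 0 \<le> y i" for i
    using E[of "Suc i"] by (auto simp: y_def erdos_def)
  ultimately have yE: "(y, T) \<in> erdos"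
    by (simp add: erdos_def)
  have ev: "\<forall>\<^sub>F n in sequentially. fst (f n) i = y i" for i
    using eventually_gt_at_top[of i] by eventually_elim (rule high)
  have "(\<lambda>n. fst (f n)) \<longlonglongrightarrow> y"
    unfolding tendsto_fun_iff using tendsto_eventually[OF ev] by blast
  then have "(\<lambda>n. (fst (f n), snd (f n))) \<longlonglongrightarrow> (y, T)"
    by (intro tendsto_Pair T)
  then have lim1: "f \<longlonglongrightarrow> (y, T)" by simp
  \<comment> \<open>\<open>g n\<close> is the rejected next position: \<open>f (Suc n)\<close> moved
    once more by \<open>1 / (n + 1)\<close> in coordinate \<open>n\<close>. The step size tends to
    0, so \<open>g\<close> has the same limit as \<open>f\<close> although it stays outside
    \<open>A\<close>.\<close>
  define g where "g n = erdos_shift n (Suc (j n)) (f n)" for n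
  have g: "g n = ((fst (f (Suc n)))(n := y n + 1 / real (Suc n)), snd (f (Suc n)) + 1 / real (Suc n))" for n
    by (auto simp: g_def fS erdos_shift_def y_def add_divide_distrib)
  have gE: "g n \<in> erdos" for n
    unfolding g_def by (rule erdos_shift_in[OF E])
  have "(\<lambda>n. snd (f (Suc n)) + 1 / real (Suc n)) \<longlonglongrightarrow> T + 0"
    by (intro tendsto_add LIMSEQ_Suc[OF T] LIMSEQ_Suc[OF lim_1_over_n])
  then have "(\<lambda>n. snd (g n)) \<longlonglongrightarrow> T" by (simp add: g)
  moreover have "(\<lambda>n. fst (g n)) \<longlonglongrightarrow> y"
    unfolding tendsto_fun_iff
  proof
    fix i
    have "\<forall>\<^sub>F n in sequentially. fst (g n) i = y i"
      using eventually_gt_at_top[of i] by eventually_elim (simp add: g high)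
    then show "(\<lambda>n. fst (g n) i) \<longlonglongrightarrow> y i"
      by (rule tendsto_eventually)
  qed
  ultimately have "(\<lambda>n. (fst (g n), snd (g n))) \<longlonglongrightarrow> (y, T)"
    by (intro tendsto_Pair)
  then have lim2: "g \<longlonglongrightarrow> (y, T)" by simp
  obtain C where C: "closed C" "A = erdos \<inter> C"
    using cl unfolding closedin_closed by blast
  have "(y, T) \<in> C"
    using closed_sequentially[OF C(1) _ lim1] fA C(2) by blast
  then have yA: "(y, T) \<in> A" using yE C by blast
  obtain U where U: "open U" "A = erdos \<inter> U"
    using op unfolding openin_open by blast
  have "(y, T) \<in> - U"
    using closed_sequentially[of "- U" g, OF _ _ lim2] U gE out unfolding g_def by blast
  then show False using yA U by blast
qed

text \<open>Each coordinate maps a connected set to a connected set of rationals, hence to a single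
  point, and the coordinates determine the sum.\<close>

lemma erdos_connected_subsingleton:
  assumes "connectedin (top_of_set erdos) C" "p \<in> C" "q \<in> C"
  shows "p = q"
proof -
  have C: "connected C" "C \<subseteq> erdos"
    using assms by (auto simp: connectedin_subtopology)
  have "fst p i = fst q i" for i
  proof -
    have "continuous_on C (\<lambda>r. fst r i)"
      using continuous_on_product_then_coordinatewise[OF continuous_on_fst[OF continuous_on_id]] by fast
    then have conn: "connected ((\<lambda>r. fst r i) ` C)"
      using C(1) by (rule connected_continuous_image)
    have "(\<lambda>r. fst r i) ` C \<subseteq> \<rat>"
      using C(2) by (auto simp: erdos_def)
    then have "countable ((\<lambda>r. fst r i) ` C)"
      using countable_rat countable_subset by blast
    then obtain a where "(\<lambda>r. fst r i) ` C \<subseteq> {a}"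
      using connected_card_eq_iff_nontrivial[OF conn] by blast
    then show ?thesis using assms(2,3) by blast
  qed
  then have "fst p = fst q" by blast
  moreover have "snd p = snd q"
  proof -
    have "fst p sums snd p" "fst q sums snd q"
      using assms(2,3) C(2) by (auto simp: erdos_def)
    then show ?thesis
      using \<open>fst p = fst q\<close> sums_unique2 by metis
  qed
  ultimately show ?thesis by (simp add: prod_eq_iff)
qed

subsection \<open>Adjoining a point\<close>

definition list_cut :: "('k \<times> real) list \<Rightarrow> nat \<Rightarrow> ('k \<times> real) list"
  where "list_cut s N = takeWhile (\<lambda>e. snd e \<le> real N) s"

text \<open>A list is close to \<open>s\<close> if it extends \<open>s\<close> and the next entry, if any, has a large
  second component. Hence \<open>s @ [(c, t)]\<close> tends to \<open>s\<close> as \<open>t \<rightarrow> \<infinity>\<close>.\<close>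

definition list_topology :: "('k \<times> real) list topology"
  where "list_topology =
    pullback_topology UNIV list_cut (product_topology (\<lambda>N. discrete_topology UNIV) UNIV)"

lemma topspace_list_topology [simp]: "topspace list_topology = UNIV"
  by (simp add: list_topology_def topspace_pullback_topology)

lemma list_cut_eventually_id: "\<exists>N. \<forall>n\<ge>N. list_cut s n = s"
proof -
  obtain N :: nat where N: "Max (insert 0 (snd ` set s)) < real N"
    using reals_Archimedean2 by blast
  have "list_cut s n = s" if "n \<ge> N" for n
  proof -
    have "snd e \<le> real n" if "e \<in> set s" for e
    proof -
      have "snd e \<le> Max (insert 0 (snd ` set s))" using that by simp
      then show ?thesis using N \<open>n \<ge> N\<close> by linarith
    qed
    then show ?thesis by (simp add: list_cut_def takeWhile_eq_all_conv)
  qed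
  then show ?thesis by blast
qed

lemma inj_list_cut: "inj list_cut"
proof (rule injI)
  fix s t :: "('k \<times> real) list"
  assume eq: "list_cut s = list_cut t"
  obtain N M where "\<forall>n\<ge>N. list_cut s n = s" "\<forall>n\<ge>M. list_cut t n = t"
    using list_cut_eventually_id by metis
  then have "list_cut s (max N M) = s" "list_cut t (max N M) = t" by auto
  then show "s = t" using eq by metis
qed

lemma continuous_map_list_cut:
  "continuous_map list_topology (product_topology (\<lambda>N. discrete_topology UNIV) UNIV) list_cut"
  unfolding list_topology_def
  using continuous_map_pullback[OF continuous_map_id, of UNIV list_cut] by (simp add: o_def)

lemma continuous_map_list_cut_component:
  "continuous_map list_topology (discrete_topology UNIV) (\<lambda>s. list_cut s N)"
  using continuous_map_list_cut by (auto simp: continuous_map_componentwise_UNIV)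

text \<open>Besides identifying the lists with a subspace of a product, this transports the finished
  spaces to the field of the given cardinal.\<close>

lemma homeomorphic_map_pullback:
  assumes "bij_betw f A (topspace X)"
  shows "homeomorphic_map (pullback_topology A f X) X f"
proof -
  have "continuous_map (pullback_topology A f X) X f"
    using continuous_map_pullback[OF continuous_map_id, of A f] by (simp add: o_def)
  moreover have "open_map (pullback_topology A f X) X f"
    unfolding open_map_def openin_pullback_topology
  proof safe
    fix U assume U: "openin X U"
    have "f ` (f -` U \<inter> A) = U \<inter> f ` A" by auto
    also have "\<dots> = U"
      using openin_subset[OF U] assms by (auto simp: bij_betw_def)
    finally show "openin X (f ` (f -` U \<inter> A))" using U by simp
  qed
  moreover have "topspace (pullback_topology A f X) = A"
    using assms by (auto simp: topspace_pullback_topology bij_betw_def)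
  ultimately show ?thesis
    using assms by (intro bijective_open_imp_homeomorphic_map) (auto simp: bij_betw_def)
qed

lemma pullback_topology_subtopology_image:
  "pullback_topology A f X = pullback_topology A f (subtopology X (f ` A))"
proof -
  have "f -` (U \<inter> f ` A) \<inter> A = f -` U \<inter> A" for U
    by auto
  then show ?thesis
    unfolding topology_eq openin_pullback_topology openin_subtopology by metis
qed

text \<open>The sequence of all truncations embeds the lists into a countable product of discrete
  spaces.\<close>

lemma metrizable_list_topology: "metrizable_space list_topology"
proof -
  let ?X = "product_topology (\<lambda>N::nat. discrete_topology UNIV) UNIV :: (nat \<Rightarrow> ('k \<times> real) list) topology"
  have "homeomorphic_map list_topology (subtopology ?X (range list_cut)) list_cut"
    unfolding list_topology_def pullback_topology_subtopology_image[of UNIV list_cut ?X]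
    by (intro homeomorphic_map_pullback) (simp add: bij_betw_def inj_list_cut)
  moreover have "metrizable_space ?X"
    by (simp add: metrizable_space_product_topology)
  ultimately show ?thesis
    using metrizable_space_subtopology homeomorphic_metrizable_space homeomorphic_map_imp_homeomorphic_space
    by blast
qed

lemma openin_cylinder: "openin list_topology {s @ u |u. True}"
proof (subst openin_subopen, safe)
  fix u
  \<comment> \<open>For \<open>N\<close> beyond all labels in \<open>s @ u\<close>, truncation at
    \<open>N\<close> keeps the whole list, so every list with that truncation extends it.\<close>
  obtain N where N: "list_cut (s @ u) N = s @ u"
    using list_cut_eventually_id by blast
  let ?T = "{t \<in> topspace list_topology. list_cut t N \<in> {s @ u}}"
  have "openin list_topology ?T"
    by (rule openin_continuous_map_preimage[OF continuous_map_list_cut_component]) simp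
  moreover have "s @ u \<in> ?T" using N by simp
  moreover have "?T \<subseteq> {s @ u |u. True}"
  proof
    fix t assume "t \<in> ?T"
    then have "list_cut t N = s @ u" by simp
    then have "t = s @ (u @ dropWhile (\<lambda>e. snd e \<le> real N) t)"
      by (metis append.assoc list_cut_def takeWhile_dropWhile_id)
    then show "t \<in> {s @ u |u. True}" by blast
  qed
  ultimately show "\<exists>T. openin list_topology T \<and> s @ u \<in> T \<and> T \<subseteq> {s @ u |u. True}"
    by blast
qed

text \<open>Truncation at \<open>N\<close> does not see a last entry whose label exceeds
  \<open>N\<close>. So uncountably many children of \<open>s\<close> with the prescribed first
  component \<open>c\<close> lie in every neighbourhood of \<open>s\<close>.\<close>

lemma list_topology_nbhd_children:
  assumes "openin list_topology U" "s \<in> U"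
  shows "\<exists>N. \<forall>r>N. s @ [(c, r)] \<in> U"
proof -
  let ?X = "product_topology (\<lambda>N::nat. discrete_topology UNIV) UNIV :: (nat \<Rightarrow> ('k \<times> real) list) topology"
  have ev: "\<forall>\<^sub>F r in at_top. list_cut (s @ [(c, r)]) N = list_cut s N" for N
    using eventually_gt_at_top[of "real N"]
    by eventually_elim (auto simp: list_cut_def takeWhile_append takeWhile_eq_all_conv[THEN iffD2])
  have "\<forall>\<^sub>F r in at_top. list_cut (s @ [(c, r)]) N \<in> U" if "list_cut s N \<in> U" for N U
    using ev[of N] by eventually_elim (use that in simp)
  then have lim: "limitin ?X (\<lambda>r. list_cut (s @ [(c, r)])) (list_cut s) at_top"
    unfolding limitin_componentwise by (auto simp: limitin_def)
  obtain V where V: "openin ?X V" "U = list_cut -` V"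
    using assms(1) by (auto simp: list_topology_def openin_pullback_topology)
  then have "\<forall>\<^sub>F r in at_top. list_cut (s @ [(c, r)]) \<in> V"
    using lim assms(2) by (auto simp: limitin_def)
  then have "\<forall>\<^sub>F r in at_top. s @ [(c, r)] \<in> U"
    using V(2) by simp
  then show ?thesis
    by (simp add: eventually_at_top_dense)
qed

lemma list_topology_connected_subsingleton:
  assumes "connectedin list_topology C" "s \<in> C" "t \<in> C"
  shows "s = t"
proof -
  have "list_cut s N = list_cut t N" for N
  proof -
    have "connectedin (discrete_topology UNIV) ((\<lambda>s. list_cut s N) ` C)"
      using assms(1) continuous_map_list_cut_component connectedin_continuous_map_image by blast
    then obtain a where "(\<lambda>s. list_cut s N) ` C \<subseteq> {a}"
      by (auto simp: connectedin_discrete_topology)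
    then show ?thesis using assms(2,3) by blast
  qed
  then show ?thesis using inj_list_cut by (metis ext injD)
qed

section \<open>One-point extensions by a base of open sets\<close>

definition adjoin_point :: "'a topology \<Rightarrow> 'a set set \<Rightarrow> 'a option topology"
  where "adjoin_point P \<U> =
    topology (\<lambda>U. openin P {p. Some p \<in> U} \<and> (None \<in> U \<longrightarrow> (\<exists>V\<in>\<U>. Some ` V \<subseteq> U)))"

text \<open>The empty set may be a member, and then the new point is isolated; this keeps the notion
  stable under passing to subspaces.\<close>

definition open_filter_base :: "'a topology \<Rightarrow> 'a set set \<Rightarrow> bool"
  where "open_filter_base P \<U> \<longleftrightarrow>
    \<U> \<noteq> {} \<and> (\<forall>V\<in>\<U>. openin P V) \<and> (\<forall>V\<in>\<U>. \<forall>W\<in>\<U>. \<exists>T\<in>\<U>. T \<subseteq> V \<inter> W)"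

lemma openin_adjoin_point:
  assumes "open_filter_base P \<U>"
  shows "openin (adjoin_point P \<U>) U \<longleftrightarrow>
    openin P {p. Some p \<in> U} \<and> (None \<in> U \<longrightarrow> (\<exists>V\<in>\<U>. Some ` V \<subseteq> U))"
proof -
  have "istopology (\<lambda>U. openin P {p. Some p \<in> U} \<and> (None \<in> U \<longrightarrow> (\<exists>V\<in>\<U>. Some ` V \<subseteq> U)))"
    unfolding istopology_def
  proof (intro conjI allI impI)
    fix S T :: "'a option set"
    assume S: "openin P {p. Some p \<in> S} \<and> (None \<in> S \<longrightarrow> (\<exists>V\<in>\<U>. Some ` V \<subseteq> S))"
      and T: "openin P {p. Some p \<in> T} \<and> (None \<in> T \<longrightarrow> (\<exists>V\<in>\<U>. Some ` V \<subseteq> T))"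
    have "{p. Some p \<in> S \<inter> T} = {p. Some p \<in> S} \<inter> {p. Some p \<in> T}" by auto
    then show "openin P {p. Some p \<in> S \<inter> T}" using S T by auto
    assume N: "None \<in> S \<inter> T"
    then obtain V W where "V \<in> \<U>" "W \<in> \<U>" "Some ` V \<subseteq> S" "Some ` W \<subseteq> T"
      using S T by blast
    moreover from this obtain X where "X \<in> \<U>" "X \<subseteq> V \<inter> W"
      using assms unfolding open_filter_base_def by blast
    ultimately show "\<exists>V\<in>\<U>. Some ` V \<subseteq> S \<inter> T" by (intro bexI[of _ X]) blast+
  next
    fix \<K> :: "'a option set set"
    assume K: "\<forall>S\<in>\<K>. openin P {p. Some p \<in> S} \<and> (None \<in> S \<longrightarrow> (\<exists>V\<in>\<U>. Some ` V \<subseteq> S))"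
    have "{p. Some p \<in> \<Union>\<K>} = (\<Union>S\<in>\<K>. {p. Some p \<in> S})" by auto
    then show "openin P {p. Some p \<in> \<Union>\<K>}" using K by auto
    assume "None \<in> \<Union>\<K>"
    then obtain S where "S \<in> \<K>" "None \<in> S" by blast
    moreover from this obtain V where "V \<in> \<U>" "Some ` V \<subseteq> S" using K by meson
    ultimately show "\<exists>V\<in>\<U>. Some ` V \<subseteq> \<Union>\<K>" by (intro bexI[of _ V]) blast+
  qed
  then show ?thesis
    unfolding adjoin_point_def by (simp add: topology_inverse')
qed

context
  fixes P :: "'a topology" and \<U> :: "'a set set"
  assumes base: "open_filter_base P \<U>"
begin

lemma openin_adjoin_point_Some:
  "openin (adjoin_point P \<U>) (Some ` V) \<longleftrightarrow> openin P V"
proof -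
  have "{p. Some p \<in> Some ` V} = V" by auto
  then show ?thesis by (auto simp: openin_adjoin_point[OF base])
qed

lemma openin_adjoin_point_insert_None:
  assumes "openin P W" "V \<in> \<U>" "V \<subseteq> W"
  shows "openin (adjoin_point P \<U>) (insert None (Some ` W))"
proof -
  have "{p. Some p \<in> insert None (Some ` W)} = W" by auto
  moreover have "Some ` V \<subseteq> insert None (Some ` W)" using assms(3) by blast
  ultimately show ?thesis using assms(1,2) openin_adjoin_point[OF base] by metis
qed

lemma openin_adjoin_point_vimage: "openin (adjoin_point P \<U>) U \<Longrightarrow> openin P {p. Some p \<in> U}"
  using openin_adjoin_point[OF base] by simp

lemma openin_adjoin_point_None:
  "openin (adjoin_point P \<U>) U \<Longrightarrow> None \<in> U \<Longrightarrow> \<exists>V\<in>\<U>. Some ` V \<subseteq> U"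
  using openin_adjoin_point[OF base] by simp

lemma topspace_adjoin_point [simp]: "topspace (adjoin_point P \<U>) = insert None (Some ` topspace P)"
proof
  obtain V where V: "V \<in> \<U>" using base by (auto simp: open_filter_base_def)
  then have "V \<subseteq> topspace P" using base by (auto simp: open_filter_base_def openin_subset)
  then show "insert None (Some ` topspace P) \<subseteq> topspace (adjoin_point P \<U>)"
    using openin_subset[OF openin_adjoin_point_insert_None[OF openin_topspace V]] by blast
  have "openin P {p. Some p \<in> topspace (adjoin_point P \<U>)}"
    by (rule openin_adjoin_point_vimage[OF openin_topspace])
  then have "{p. Some p \<in> topspace (adjoin_point P \<U>)} \<subseteq> topspace P"
    by (rule openin_subset)
  then have sub: "Some p \<in> topspace (adjoin_point P \<U>) \<Longrightarrow> p \<in> topspace P" for p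
    by blast
  show "topspace (adjoin_point P \<U>) \<subseteq> insert None (Some ` topspace P)"
  proof
    fix z assume "z \<in> topspace (adjoin_point P \<U>)"
    then show "z \<in> insert None (Some ` topspace P)" using sub by (cases z) auto
  qed
qed

lemma open_map_Some: "open_map P (adjoin_point P \<U>) Some"
  by (simp add: open_map_def openin_adjoin_point_Some)

lemma continuous_map_Some: "continuous_map P (adjoin_point P \<U>) Some"
proof -
  have "openin P {x \<in> topspace P. Some x \<in> U}" if "openin (adjoin_point P \<U>) U" for U
  proof -
    have "openin P {x. Some x \<in> U}" using that by (rule openin_adjoin_point_vimage)
    moreover have "{x \<in> topspace P. Some x \<in> U} = {x. Some x \<in> U}"
      using openin_subset[OF calculation] by auto
    ultimately show ?thesis by simp
  qed
  then show ?thesis by (auto simp: continuous_map_def)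
qed

lemma embedding_map_Some: "embedding_map P (adjoin_point P \<U>) Some"
  by (rule injective_open_imp_embedding_map[OF continuous_map_Some open_map_Some]) simp

lemma homeomorphic_space_adjoin_point_minus:
  "subtopology (adjoin_point P \<U>) (topspace (adjoin_point P \<U>) - {None}) homeomorphic_space P"
proof -
  have "topspace (adjoin_point P \<U>) - {None} = Some ` topspace P" by auto
  then show ?thesis
    using embedding_map_imp_homeomorphic_space[OF embedding_map_Some] homeomorphic_space_sym by auto
qed

text \<open>Of a clopen set and its complement, one misses the new point. If nonempty, it is a
  clopen subset of \<open>P\<close> disjoint from some member of the base, which the assumption
  forbids.\<close>

lemma connected_adjoin_point:
  assumes "\<And>C V. \<lbrakk>openin P C; closedin P C; C \<noteq> {}; V \<in> \<U>\<rbrakk> \<Longrightarrow> C \<inter> V \<noteq> {}"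
  shows "connected_space (adjoin_point P \<U>)"
proof -
  have no: False if C: "openin (adjoin_point P \<U>) C" "closedin (adjoin_point P \<U>) C"
      "C \<noteq> {}" "None \<notin> C" for C
  proof -
    have op: "openin P {p. Some p \<in> C}" using C(1) by (rule openin_adjoin_point_vimage)
    let ?D = "topspace (adjoin_point P \<U>) - C"
    have D: "openin (adjoin_point P \<U>) ?D" using C(2) by blast
    then have "openin P {p. Some p \<in> ?D}" by (rule openin_adjoin_point_vimage)
    moreover have "{p. Some p \<in> ?D} = topspace P - {p. Some p \<in> C}" by auto
    ultimately have cl: "closedin P {p. Some p \<in> C}"
      using openin_subset[OF op] by (auto simp: closedin_def)
    have ne: "{p. Some p \<in> C} \<noteq> {}" using C(3,4) by (metis empty_Collect_eq equals0I not_Some_eq)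
    obtain V where "V \<in> \<U>" "Some ` V \<subseteq> ?D"
      using openin_adjoin_point_None[OF D] C(4) by auto
    then show False using assms[OF op cl ne, of V] by auto
  qed
  show ?thesis
    unfolding connected_space_clopen_in
  proof (intro allI impI)
    fix T assume T: "openin (adjoin_point P \<U>) T \<and> closedin (adjoin_point P \<U>) T"
    show "T = {} \<or> T = topspace (adjoin_point P \<U>)"
    proof (cases "None \<in> T")
      case True
      have "openin (adjoin_point P \<U>) (topspace (adjoin_point P \<U>) - T)"
           "closedin (adjoin_point P \<U>) (topspace (adjoin_point P \<U>) - T)"
        using T openin_diff closedin_diff openin_topspace closedin_topspace by metis+
      then have "topspace (adjoin_point P \<U>) - T = {}"
        using no[of "topspace (adjoin_point P \<U>) - T"] True by blast
      then show ?thesis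
        using T openin_subset by blast
    qed (use no T in blast)
  qed
qed

end

lemma open_filter_base_subtopology:
  assumes "open_filter_base P \<U>"
  shows "open_filter_base (subtopology P S) ((\<inter>) S ` \<U>)"
  unfolding open_filter_base_def
proof (intro conjI ballI)
  show "(\<inter>) S ` \<U> \<noteq> {}" using assms by (simp add: open_filter_base_def)
next
  fix V assume "V \<in> (\<inter>) S ` \<U>"
  then show "openin (subtopology P S) V"
    using assms by (auto simp: open_filter_base_def openin_subtopology_Int2)
next
  fix V W assume "V \<in> (\<inter>) S ` \<U>" "W \<in> (\<inter>) S ` \<U>"
  then obtain V' W' where VW: "V = S \<inter> V'" "W = S \<inter> W'" "V' \<in> \<U>" "W' \<in> \<U>" by blast
  then obtain T where "T \<in> \<U>" "T \<subseteq> V' \<inter> W'"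
    using assms unfolding open_filter_base_def by meson
  then show "\<exists>T\<in>(\<inter>) S ` \<U>. T \<subseteq> V \<inter> W"
    using VW by (intro bexI[of _ "S \<inter> T"]) blast+
qed

text \<open>Subspaces containing the new point are again one-point extensions, so the criterion for
  connectedness applies to the pieces of a cone.\<close>

lemma subtopology_adjoin_point:
  assumes base: "open_filter_base P \<U>"
  shows "subtopology (adjoin_point P \<U>) (insert None (Some ` S)) =
    adjoin_point (subtopology P S) ((\<inter>) S ` \<U>)"
  unfolding topology_eq
proof
  fix U
  note base' = open_filter_base_subtopology[OF base, of S]
  let ?L = "subtopology (adjoin_point P \<U>) (insert None (Some ` S))"
  show "openin ?L U \<longleftrightarrow> openin (adjoin_point (subtopology P S) ((\<inter>) S ` \<U>)) U"
  proof
    assume "openin ?L U"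
    then obtain T where T: "openin (adjoin_point P \<U>) T" "U = T \<inter> insert None (Some ` S)"
      unfolding openin_subtopology by blast
    have "{p. Some p \<in> U} = {p. Some p \<in> T} \<inter> S" using T(2) by blast
    then have "openin (subtopology P S) {p. Some p \<in> U}"
      using openin_adjoin_point_vimage[OF base T(1)] unfolding openin_subtopology by blast
    moreover have "\<exists>V\<in>(\<inter>) S ` \<U>. Some ` V \<subseteq> U" if N: "None \<in> U"
    proof -
      have "None \<in> T" using N T(2) by blast
      then obtain V where "V \<in> \<U>" "Some ` V \<subseteq> T"
        using openin_adjoin_point_None[OF base T(1)] by blast
      then show ?thesis using T(2) by (intro bexI[of _ "S \<inter> V"]) blast+
    qed
    ultimately show "openin (adjoin_point (subtopology P S) ((\<inter>) S ` \<U>)) U"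
      unfolding openin_adjoin_point[OF base'] by simp
  next
    assume U: "openin (adjoin_point (subtopology P S) ((\<inter>) S ` \<U>)) U"
    obtain T where T: "openin P T" "{p. Some p \<in> U} = T \<inter> S"
      using openin_adjoin_point_vimage[OF base' U] unfolding openin_subtopology by blast
    show "openin ?L U"
    proof (cases "None \<in> U")
      case False
      have "U = Some ` T \<inter> insert None (Some ` S)"
      proof (rule set_eqI)
        fix z show "z \<in> U \<longleftrightarrow> z \<in> Some ` T \<inter> insert None (Some ` S)"
          using False T(2) by (cases z) auto
      qed
      then show ?thesis
        using openin_adjoin_point_Some[OF base] T(1) unfolding openin_subtopology by blast
    next
      case True
      then obtain V where V: "V \<in> \<U>" "Some ` (S \<inter> V) \<subseteq> U"
        using openin_adjoin_point_None[OF base' U] by blast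
      \<comment> \<open>\<open>T\<close> alone need not contain a member of the base. Adding
        \<open>V\<close> repairs this and leaves the trace on \<open>S\<close> unchanged, because
        the points of \<open>S \<inter> V\<close> already belong to \<open>U\<close>.\<close>
      have op: "openin P (T \<union> V)"
        using V(1) T(1) base unfolding open_filter_base_def by blast
      have "U = insert None (Some ` (T \<union> V)) \<inter> insert None (Some ` S)"
      proof (rule set_eqI)
        fix z show "z \<in> U \<longleftrightarrow> z \<in> insert None (Some ` (T \<union> V)) \<inter> insert None (Some ` S)"
          using True T(2) V(2) by (cases z) auto
      qed
      then show ?thesis
        using openin_adjoin_point_insert_None[OF base op V(1)] unfolding openin_subtopology by blast
    qed
  qed
qed

section \<open>Metrizable and perfectly normal extensions\<close>

definition level_base :: "'a topology \<Rightarrow> ('a \<Rightarrow> real) \<Rightarrow> 'a set set"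
  where "level_base P h = range (\<lambda>n::nat. {p \<in> topspace P. real n < h p})"

lemma openin_superlevel:
  assumes "continuous_map P euclideanreal h"
  shows "openin P {p \<in> topspace P. a < h p}"
  using openin_continuous_map_preimage[OF assms, of "{a<..}"] by simp

lemma open_filter_base_level_base:
  assumes "continuous_map P euclideanreal h"
  shows "open_filter_base P (level_base P h)"
  unfolding open_filter_base_def
proof (intro conjI ballI)
  fix V W assume "V \<in> level_base P h" "W \<in> level_base P h"
  then obtain n m where "V = {p \<in> topspace P. real n < h p}" "W = {p \<in> topspace P. real m < h p}"
    by (auto simp: level_base_def)
  then show "\<exists>T\<in>level_base P h. T \<subseteq> V \<inter> W"
    by (intro bexI[of _ "{p \<in> topspace P. real (max n m) < h p}"]) (auto simp: level_base_def)
qed (auto simp: level_base_def intro: openin_superlevel[OF assms])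

text \<open>With \<open>\<phi> = 1/h\<close> as the distance to the new point, the new metric is the minimum of the
  old one (corrected by \<open>\<bar>\<phi> p - \<phi> q\<bar>\<close> to make \<open>\<phi>\<close> short) and of the length
  \<open>\<phi> p + \<phi> q\<close> of the detour through the new point.\<close>

lemma metrizable_adjoin_point:
  assumes P: "metrizable_space P" and h: "continuous_map P euclideanreal h"
    and pos: "\<And>p. p \<in> topspace P \<Longrightarrow> 0 < h p"
  shows "metrizable_space (adjoin_point P (level_base P h))"
proof -
  note base = open_filter_base_level_base[OF h]
  obtain M d where M: "Metric_space M d" and PM: "P = Metric_space.mtopology M d"
    using P unfolding metrizable_space_def by blast
  interpret Metric_space M d by (rule M)
  have top: "topspace P = M" using PM by simp
  define \<phi> where "\<phi> z = (case z of None \<Rightarrow> 0 | Some p \<Rightarrow> 1 / \<bar>h p\<bar>)" for z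
  have phi_None: "\<phi> None = 0" and phi_Some: "\<phi> (Some p) = 1 / \<bar>h p\<bar>" for p
    by (simp_all add: \<phi>_def)
  have phi_pos: "p \<in> M \<Longrightarrow> 0 < \<phi> (Some p)" for p
    using pos[of p] top by (simp add: phi_Some)
  define D where "D z w = (if z = w then 0 else case (z, w) of
      (Some p, Some q) \<Rightarrow> min (d p q + \<bar>\<phi> z - \<phi> w\<bar>) (\<phi> z + \<phi> w) | _ \<Rightarrow> \<phi> z + \<phi> w)" for z w
  let ?M = "insert None (Some ` M)"
  have phi_nn: "0 \<le> \<phi> z" for z
    by (cases z) (simp_all add: phi_Some phi_None)
  have D_None: "D None z = \<phi> z" "D z None = \<phi> z" for z
    by (cases z; simp add: D_def phi_None)+
  have D_Some: "D (Some p) (Some q) = min (d p q + \<bar>\<phi> (Some p) - \<phi> (Some q)\<bar>) (\<phi> (Some p) + \<phi> (Some q))"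
    if "p \<in> M" "q \<in> M" for p q
    using that phi_pos[OF that(1)] by (cases "p = q") (simp_all add: D_def)
  have D_ge: "\<bar>\<phi> z - \<phi> w\<bar> \<le> D z w" if "z \<in> ?M" "w \<in> ?M" for z w
    using that phi_nn[of z] phi_nn[of w]
    by (cases z; cases w) (auto simp: D_None phi_None D_Some min_def)
  have D_le: "D z w \<le> \<phi> z + \<phi> w" if "z \<in> ?M" "w \<in> ?M" for z w
    using that phi_nn[of z] phi_nn[of w]
    by (cases z; cases w) (auto simp: D_None phi_None D_Some min_def)
  interpret N: Metric_space ?M D
  proof
    fix z w
    show "0 \<le> D z w"
      using phi_nn by (auto simp: D_def split: option.split)
    show "D z w = D w z"
      by (auto simp: D_def commute abs_minus_commute add.commute split: option.split)
  next
    fix z w assume zw: "z \<in> ?M" "w \<in> ?M"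
    show "D z w = 0 \<longleftrightarrow> z = w"
    proof (cases "z = None \<or> w = None")
      case True
      then show ?thesis
        using zw phi_pos by (auto simp: D_None phi_None) (use phi_pos less_irrefl in metis)+
    next
      case False
      then obtain p q where pq: "z = Some p" "w = Some q" "p \<in> M" "q \<in> M"
        using zw by auto
      have "D z w \<noteq> 0" if "p \<noteq> q"
      proof -
        have "0 < d p q" using that pq(3,4) nonneg[of p q] zero[of p q] by linarith
        then show ?thesis
          using phi_pos[OF pq(3)] phi_pos[OF pq(4)] unfolding pq(1,2) D_Some[OF pq(3,4)] by linarith
      qed
      then show ?thesis using pq(1,2) by (auto simp: D_def)
    qed
  next
    fix x y z assume xyz: "x \<in> ?M" "y \<in> ?M" "z \<in> ?M"
    show "D x z \<le> D x y + D y z"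
    proof (cases "x = None \<or> y = None \<or> z = None")
      case True
      then show ?thesis
        using D_ge[OF xyz(1,2)] D_ge[OF xyz(2,3)] D_le[OF xyz(1,3)] by (auto simp: D_None phi_None)
    next
      case False
      then obtain p q r where pqr: "x = Some p" "y = Some q" "z = Some r" "p \<in> M" "q \<in> M" "r \<in> M"
        using xyz by auto
      show ?thesis
        using triangle[OF pqr(4-6)] nonneg[of p q] nonneg[of q r] nonneg[of p r] phi_pos[OF pqr(4)] phi_pos[OF pqr(5)] phi_pos[OF pqr(6)]
        unfolding pqr(1-3) D_Some[OF pqr(4,5)] D_Some[OF pqr(5,6)] D_Some[OF pqr(4,6)]
        by linarith
    qed
  qed
  have "N.mtopology = adjoin_point P (level_base P h)"
    unfolding topology_eq
  proof
    fix U
    show "openin N.mtopology U \<longleftrightarrow> openin (adjoin_point P (level_base P h)) U"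
    proof
      assume U: "openin N.mtopology U"
      have "openin P {p. Some p \<in> U}"
      proof (subst openin_subopen, safe)
        fix p assume p: "Some p \<in> U"
        then obtain r where r: "r > 0" "N.mball (Some p) r \<subseteq> U"
          using U unfolding N.openin_mtopology by blast
        have pM: "p \<in> M" using p U unfolding N.openin_mtopology by blast
        \<comment> \<open>One half of \<open>r\<close> bounds the old distance, the other the
          difference of the values of \<open>\<phi>\<close>: the two summands of the direct
          route.\<close>
        let ?T = "mball p (r/2) \<inter> {q \<in> topspace P. 1 / \<bar>h q\<bar> \<in> {\<phi> (Some p) - r/2 <..< \<phi> (Some p) + r/2}}"
        have "continuous_map P euclideanreal (\<lambda>q. 1 / \<bar>h q\<bar>)"
          using pos by (intro continuous_intros h) force+
        then have "openin P {q \<in> topspace P. 1 / \<bar>h q\<bar> \<in> {\<phi> (Some p) - r/2 <..< \<phi> (Some p) + r/2}}"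
          by (rule openin_continuous_map_preimage) simp
        moreover have "openin P (mball p (r/2))" using PM by simp
        ultimately have "openin P ?T" by blast
        moreover have "p \<in> ?T" using pM r(1) top by (auto simp: phi_Some)
        moreover have "?T \<subseteq> {p. Some p \<in> U}"
        proof safe
          fix q assume q: "q \<in> mball p (r/2)" "1 / \<bar>h q\<bar> \<in> {\<phi> (Some p) - r/2 <..< \<phi> (Some p) + r/2}"
          then have "D (Some p) (Some q) < r"
            using pM by (auto simp: D_Some phi_Some abs_if)
          then show "Some q \<in> U" using r(2) q(1) pM by auto
        qed
        ultimately show "\<exists>T. openin P T \<and> p \<in> T \<and> T \<subseteq> {p. Some p \<in> U}" by blast
      qed
      moreover have "\<exists>V\<in>level_base P h. Some ` V \<subseteq> U" if N0: "None \<in> U"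
      proof -
        obtain r where r: "r > 0" "N.mball None r \<subseteq> U"
          using U N0 unfolding N.openin_mtopology by blast
        obtain n :: nat where n: "1 / r < real n" using reals_Archimedean2 by blast
        have "Some q \<in> U" if "q \<in> M" "real n < h q" for q
        proof -
          have "1 / r < h q" using n that by linarith
          moreover have "0 < h q" using that by linarith
          ultimately have "D None (Some q) < r"
            using r(1) by (simp add: D_None phi_Some field_simps)
          then show ?thesis using r(2) that(1) by auto
        qed
        then show ?thesis using top by (auto simp: level_base_def)
      qed
      ultimately show "openin (adjoin_point P (level_base P h)) U"
        unfolding openin_adjoin_point[OF base] by blast
    next
      assume U: "openin (adjoin_point P (level_base P h)) U"
      have "U \<subseteq> ?M" using openin_subset[OF U] topspace_adjoin_point[OF base] top by simp
      moreover have "\<exists>r>0. N.mball z r \<subseteq> U" if z: "z \<in> U" for z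
      proof (cases z)
        case None
        then obtain n where n: "Some ` {p \<in> topspace P. real n < h p} \<subseteq> U"
          using openin_adjoin_point_None[OF base U] z by (auto simp: level_base_def)
        have "N.mball z (1 / real (Suc n)) \<subseteq> U"
        proof
          fix w assume w: "w \<in> N.mball z (1 / real (Suc n))"
          show "w \<in> U"
          proof (cases w)
            case (Some q)
            then have q: "q \<in> M" "1 / h q < 1 / real (Suc n)" "0 < h q"
              using w None pos[of q] top by (auto simp: D_None phi_Some)
            then have "real (Suc n) < h q" by (simp add: field_simps)
            then have "real n < h q" by simp
            then show ?thesis using n q(1) Some top by auto
          qed (use None z in simp)
        qed
        then show ?thesis by (intro exI[of _ "1 / real (Suc n)"]) simp
      next
        case (Some p)
        have "openin P {p. Some p \<in> U}" by (rule openin_adjoin_point_vimage[OF base U])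
        then obtain e where e: "e > 0" "mball p e \<subseteq> {p. Some p \<in> U}" and pM: "p \<in> M"
          using z Some unfolding PM openin_mtopology by blast
        \<comment> \<open>A radius of at most \<open>\<phi> z\<close> excludes the new point and
          also the detour, whose length is at least \<open>\<phi> z\<close>. So the minimum in
          \<open>D\<close> is the direct route, which dominates \<open>d\<close>.\<close>
        have "N.mball z (min e (\<phi> z)) \<subseteq> U"
        proof
          fix w assume w: "w \<in> N.mball z (min e (\<phi> z))"
          show "w \<in> U"
          proof (cases w)
            case None
            then show ?thesis using w Some by (simp add: D_None)
          next
            case (Some q)
            then have "q \<in> M" "D (Some p) (Some q) < min e (\<phi> (Some p))"
              using w \<open>z = Some p\<close> by auto
            then have "d p q < e"
              using phi_nn[of "Some q"] pM by (auto simp: D_Some min_def split: if_splits)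
            then show ?thesis using e(2) pM \<open>q \<in> M\<close> Some by auto
          qed
        qed
        then show ?thesis
          using e(1) phi_pos[OF pM] Some by (intro exI[of _ "min e (\<phi> z)"]) auto
      qed
      ultimately show "openin N.mtopology U" unfolding N.openin_mtopology by blast
    qed
  qed
  then show ?thesis
    using N.metrizable_space_mtopology by simp
qed

text \<open>Regularity of the base separates closed sets from the new point, and the sequence
  \<open>W\<close> makes the new point a countable intersection of open sets. Everything else is
  inherited from the metrizable space \<open>P\<close>.\<close>

lemma perfectly_normal_adjoin_point:
  assumes P: "metrizable_space P" and base: "open_filter_base P \<U>"
    and reg: "\<And>V. V \<in> \<U> \<Longrightarrow> \<exists>W\<in>\<U>. P closure_of W \<subseteq> V"
    and W: "\<And>n::nat. W n \<in> \<U>" "(\<Inter>n. W n) = {}"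
  shows "perfectly_normal_space (adjoin_point P \<U>)"
proof -
  let ?X = "adjoin_point P \<U>"
  have opP: "V \<in> \<U> \<Longrightarrow> openin P V" for V
    using base by (simp add: open_filter_base_def)
  have None_nbhd: "V \<in> \<U> \<Longrightarrow> openin P V' \<Longrightarrow> openin ?X (insert None (Some ` (V \<union> V')))" for V V'
    using openin_adjoin_point_insert_None[OF base] opP by (meson openin_Un sup_ge1)
  have Some_open: "openin P V \<Longrightarrow> openin ?X (Some ` V)" for V
    using openin_adjoin_point_Some[OF base] by blast
  have cl_trace: "closedin P {p. Some p \<in> A}" if "closedin ?X A" for A
  proof -
    have "openin P {p. Some p \<in> topspace ?X - A}"
      using openin_adjoin_point_vimage[OF base] that by blast
    moreover have "{p. Some p \<in> topspace ?X - A} = topspace P - {p. Some p \<in> A}"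
      using topspace_adjoin_point[OF base] by auto
    moreover have "{p. Some p \<in> A} \<subseteq> topspace P"
      using closedin_subset[OF that] topspace_adjoin_point[OF base] by auto
    ultimately show ?thesis by (simp add: closedin_def)
  qed
  have "Hausdorff_space ?X"
  proof -
    have None_Some: "\<exists>U V. openin ?X U \<and> openin ?X V \<and> None \<in> U \<and> Some p \<in> V \<and> disjnt U V"
      if p: "p \<in> topspace P" for p
    proof -
      obtain n where "p \<notin> W n" using W(2) by blast
      moreover obtain V where V: "V \<in> \<U>" "P closure_of V \<subseteq> W n" using reg W(1) by blast
      ultimately have "p \<in> topspace P - P closure_of V" using p by blast
      moreover have "openin P (topspace P - P closure_of V)"
        by (rule openin_diff[OF openin_topspace closedin_closure_of])
      moreover have "V \<subseteq> P closure_of V" using opP[OF V(1)] by (simp add: closure_of_subset openin_subset)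
      then have "disjnt (insert None (Some ` (V \<union> {}))) (Some ` (topspace P - P closure_of V))"
        by (auto simp: disjnt_def)
      ultimately show ?thesis
        using None_nbhd[OF V(1) openin_empty] Some_open by (metis image_eqI insertI1)
    qed
    have Some_Some: "\<exists>U V. openin ?X U \<and> openin ?X V \<and> Some p \<in> U \<and> Some q \<in> V \<and> disjnt U V"
      if pq: "p \<in> topspace P" "q \<in> topspace P" "p \<noteq> q" for p q
    proof -
      obtain U V where "openin P U" "openin P V" "p \<in> U" "q \<in> V" "disjnt U V"
        using metrizable_imp_Hausdorff_space[OF P] pq unfolding Hausdorff_space_def by meson
      then show ?thesis
        by (intro exI[of _ "Some ` U"] exI[of _ "Some ` V"]) (auto simp: Some_open disjnt_def)
    qed
    show ?thesis
      unfolding Hausdorff_space_def topspace_adjoin_point[OF base]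
    proof (intro allI impI)
      fix x y assume xy: "x \<in> insert None (Some ` topspace P) \<and> y \<in> insert None (Some ` topspace P) \<and> x \<noteq> y"
      show "\<exists>U V. openin ?X U \<and> openin ?X V \<and> x \<in> U \<and> y \<in> V \<and> disjnt U V"
      proof (cases x)
        case None
        then obtain q where "y = Some q" "q \<in> topspace P" using xy by auto
        then show ?thesis using None_Some None by metis
      next
        case (Some p)
        show ?thesis
        proof (cases y)
          case None
          then show ?thesis using None_Some[of p] Some xy disjnt_sym by (metis image_iff insertE option.inject)
        next
          case (Some q)
          then show ?thesis using Some_Some[of p q] \<open>x = Some p\<close> xy by auto
        qed
      qed
    qed
  qed
  moreover have "normal_space ?X"
  proof -
    have sep: "\<exists>U V. openin ?X U \<and> openin ?X V \<and> A \<subseteq> U \<and> B \<subseteq> V \<and> disjnt U V"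
      if A: "closedin ?X A" and B: "closedin ?X B" and dis: "disjnt A B" and N: "None \<notin> B" for A B
    proof -
      have op: "openin ?X (topspace ?X - B)" using B by (rule openin_diff[OF openin_topspace])
      moreover have "None \<in> topspace ?X - B" using N topspace_adjoin_point[OF base] by blast
      ultimately obtain V where V: "V \<in> \<U>" "Some ` V \<subseteq> topspace ?X - B"
        using openin_adjoin_point_None[OF base op] by blast
      obtain V' where V': "V' \<in> \<U>" "P closure_of V' \<subseteq> V" using reg V(1) by blast
      have "disjnt {p. Some p \<in> A} {p. Some p \<in> B}" using dis by (auto simp: disjnt_def)
      then obtain OA OB where O: "openin P OA" "openin P OB" "{p. Some p \<in> A} \<subseteq> OA" "{p. Some p \<in> B} \<subseteq> OB" "disjnt OA OB"
        using metrizable_imp_normal_space[OF P] cl_trace[OF A] cl_trace[OF B] unfolding normal_space_def by meson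
      \<comment> \<open>Separation in \<open>P\<close> is corrected near the new point:
        \<open>V'\<close> is given to the side of \<open>A\<close>, and its closure, which misses
        \<open>B\<close>, is taken from the side of \<open>B\<close>.\<close>
      let ?U = "insert None (Some ` (V' \<union> OA))" and ?V = "Some ` (OB - P closure_of V')"
      have "openin ?X ?U" by (rule None_nbhd[OF V'(1) O(1)])
      moreover have "openin ?X ?V" by (intro Some_open openin_diff O(2) closedin_closure_of)
      moreover have "A \<subseteq> ?U"
      proof
        fix z assume "z \<in> A" then show "z \<in> ?U" using O(3) by (cases z) auto
      qed
      moreover have "B \<subseteq> ?V"
      proof
        fix z assume z: "z \<in> B"
        then obtain p where p: "z = Some p" using N by (cases z) auto
        have "p \<notin> P closure_of V'" using V(2) V'(2) z p by blast
        then show "z \<in> ?V" using O(4) z p by blast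
      qed
      moreover have "disjnt ?U ?V"
        using O(5) closure_of_subset[OF openin_subset[OF opP[OF V'(1)]]] by (auto simp: disjnt_def)
      ultimately show ?thesis by meson
    qed
    show ?thesis
      unfolding normal_space_def
    proof (intro allI impI)
      fix A B assume AB: "closedin ?X A \<and> closedin ?X B \<and> disjnt A B"
      show "\<exists>U V. openin ?X U \<and> openin ?X V \<and> A \<subseteq> U \<and> B \<subseteq> V \<and> disjnt U V"
      proof (cases "None \<in> B")
        case False
        then show ?thesis using sep[of A B] AB by blast
      next
        case True
        then have "None \<notin> A" using AB by (auto simp: disjnt_def)
        then show ?thesis using sep[of B A] AB by (meson disjnt_sym)
      qed
    qed
  qed
  moreover have "gdelta_in ?X C" if C: "closedin ?X C" for C
  proof -
    have "gdelta_in P {p. Some p \<in> C}"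
      using closed_imp_gdelta_in[OF P cl_trace[OF C]] .
    then obtain D :: "nat \<Rightarrow> 'a set" where D: "\<And>n. openin P (D n)" "\<Inter> (range D) = {p. Some p \<in> C}"
      unfolding gdelta_in_descending by meson
    show ?thesis
    proof (cases "None \<in> C")
      case False
      have "C = \<Inter> (range (\<lambda>n. Some ` D n))"
      proof (rule set_eqI)
        fix z show "z \<in> C \<longleftrightarrow> z \<in> \<Inter> (range (\<lambda>n. Some ` D n))"
          using False D(2) by (cases z) auto
      qed
      moreover have "gdelta_in ?X (\<Inter> (range (\<lambda>n. Some ` D n)))"
        by (rule gdelta_in_Inter) (auto intro: open_imp_gdelta_in Some_open D(1))
      ultimately show ?thesis by simp
    next
      case True
      \<comment> \<open>The sets \<open>W m\<close> make these neighbourhoods of the new point. A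
        given point of \<open>P\<close> is outside some \<open>W m\<close>, and with this
        \<open>m\<close> it must lie in every \<open>D n\<close>.\<close>
      let ?f = "\<lambda>(n, m). insert None (Some ` (W m \<union> D n))"
      have "C = \<Inter> (range ?f)"
      proof (rule set_eqI)
        fix z show "z \<in> C \<longleftrightarrow> z \<in> \<Inter> (range ?f)"
        proof (cases z)
          case (Some p)
          obtain m where "p \<notin> W m" using W(2) by blast
          then show ?thesis using Some D(2) by fastforce
        qed (use True in auto)
      qed
      moreover have "gdelta_in ?X (\<Inter> (range ?f))"
        by (rule gdelta_in_Inter) (auto intro: open_imp_gdelta_in None_nbhd W(1) D(1))
      ultimately show ?thesis by simp
    qed
  qed
  ultimately show ?thesis unfolding perfectly_normal_space_def by blast
qed

section \<open>Cells and the connected cone over them\<close>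

type_synonym 'k cell = "((nat \<Rightarrow> real) \<times> real) \<times> ('k \<times> real) list \<times> real"

text \<open>The last factor is the line of sheets. Reals with the discrete topology are used so that
  sheet numbers can enter the height and the depth, and so that there are uncountably many sheets,
  which makes the apex differ from all ranked points.\<close>

definition cell_topology :: "'k cell topology"
  where "cell_topology =
    prod_topology (top_of_set erdos) (prod_topology list_topology (discrete_topology UNIV))"

text \<open>The height goes to infinity at the apex of the cone. It does so with the norm, and also over
  the balls of radius less than 2 in the sheets \<open>k \<rightarrow> \<infinity>\<close>. As it is 3 on the sphere of
  radius 2, these balls are cut off from the apex in small neighbourhoods, which destroys local
  connectedness there. The depth uses the sheets \<open>k \<rightarrow> -\<infinity>\<close> in the same way for the
  point adjoined to the sum of the pieces.\<close>

definition cell_height :: "'k cell \<Rightarrow> real"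
  where "cell_height c = 1 + max (snd (fst c)) (max 0 (snd (snd c)) * (2 - snd (fst c)))"

definition cell_depth :: "'k cell \<Rightarrow> real"
  where "cell_depth c = max 0 (- snd (snd c)) * max 0 (2 - snd (fst c))"

definition cone_topology :: "'k cell option topology"
  where "cone_topology = adjoin_point cell_topology (level_base cell_topology cell_height)"

lemma topspace_cell_topology [simp]: "topspace cell_topology = erdos \<times> UNIV"
  by (auto simp: cell_topology_def)

lemma metrizable_cell_topology: "metrizable_space cell_topology"
  unfolding cell_topology_def
  by (auto simp: metrizable_space_prod_topology metrizable_list_topology
      intro: metrizable_space_subtopology metrizable_space_euclidean)

lemma continuous_map_cell_norm: "continuous_map cell_topology euclideanreal (\<lambda>c. snd (fst c))"
proof -
  have "continuous_map (top_of_set erdos) euclideanreal snd"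
    by (simp add: continuous_on_snd continuous_on_id)
  then show ?thesis
    using continuous_map_compose[OF continuous_map_fst] unfolding cell_topology_def o_def by blast
qed

lemma continuous_map_cell_sheet: "continuous_map cell_topology (discrete_topology UNIV) (\<lambda>c. snd (snd c))"
  unfolding cell_topology_def
  using continuous_map_compose[OF continuous_map_snd continuous_map_snd] unfolding o_def by blast

lemma continuous_map_cell_list: "continuous_map cell_topology list_topology (\<lambda>c. fst (snd c))"
  unfolding cell_topology_def
  using continuous_map_compose[OF continuous_map_snd continuous_map_fst] unfolding o_def by blast

lemma continuous_map_cell_sheet_real:
  "continuous_map cell_topology euclideanreal (\<lambda>c. g (snd (snd c)))"
proof -
  have "continuous_map (discrete_topology UNIV) euclideanreal g" by simp
  then show ?thesis
    using continuous_map_compose[OF continuous_map_cell_sheet] unfolding o_def by blast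
qed

lemma continuous_map_cell_height: "continuous_map cell_topology euclideanreal cell_height"
  unfolding cell_height_def
  by (intro continuous_map_add continuous_map_real_max continuous_map_real_mult continuous_map_diff
      continuous_map_cell_norm continuous_map_cell_sheet_real continuous_map_const[THEN iffD2] disjI2 UNIV_I topspace_euclidean[THEN equalityD2, THEN subsetD])

lemma continuous_map_cell_depth: "continuous_map cell_topology euclideanreal cell_depth"
  unfolding cell_depth_def
  by (intro continuous_map_real_max continuous_map_real_mult continuous_map_diff
      continuous_map_cell_norm continuous_map_cell_sheet_real continuous_map_const[THEN iffD2] disjI2 UNIV_I topspace_euclidean[THEN equalityD2, THEN subsetD])

lemma cell_height_pos: "c \<in> topspace cell_topology \<Longrightarrow> 0 < cell_height c"
  using erdos_snd_nonneg[of "fst c"] by (auto simp: cell_height_def mem_Times_iff)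

lemma cone_base: "open_filter_base cell_topology (level_base cell_topology cell_height)"
  by (rule open_filter_base_level_base[OF continuous_map_cell_height])

lemma topspace_cone_topology [simp]: "topspace cone_topology = insert None (Some ` (erdos \<times> UNIV))"
  unfolding cone_topology_def topspace_adjoin_point[OF cone_base] by simp

lemma metrizable_cone_topology: "metrizable_space cone_topology"
  unfolding cone_topology_def
  by (rule metrizable_adjoin_point[OF metrizable_cell_topology continuous_map_cell_height cell_height_pos])

lemma cell_connected_subsingleton:
  assumes C: "connectedin cell_topology C" "c \<in> C" "c' \<in> C"
  shows "c = c'"
proof -
  have "connectedin (top_of_set erdos) (fst ` C)"
    using connectedin_continuous_map_image[OF _ C(1)] continuous_map_fst unfolding cell_topology_def by blast
  then have "fst c = fst c'"
    using C(2,3) erdos_connected_subsingleton by blast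
  moreover have "fst (snd c) = fst (snd c')"
    using connectedin_continuous_map_image[OF continuous_map_cell_list C(1)] C(2,3)
      list_topology_connected_subsingleton by blast
  moreover have "snd (snd c) = snd (snd c')"
    using connectedin_continuous_map_image[OF continuous_map_cell_sheet C(1)] C(2,3)
    unfolding connectedin_discrete_topology by auto
  ultimately show ?thesis by (simp add: prod_eq_iff)
qed

text \<open>A set that is relatively clopen in a union of fibres \<open>erdos \<times> {(s, k)}\<close> cuts each
  of them in a clopen set.\<close>

lemma cell_clopen_unbounded:
  assumes op: "openin (subtopology cell_topology (erdos \<times> T)) C"
    and cl: "closedin (subtopology cell_topology (erdos \<times> T)) C"
    and c: "(x, y) \<in> C"
  shows "\<exists>x'. (x', y) \<in> C \<and> M < snd x'"
proof -
  let ?S = "subtopology cell_topology (erdos \<times> T)"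
  have y: "y \<in> T" using openin_subset[OF op] c by auto
  have "continuous_map (top_of_set erdos) cell_topology (\<lambda>x. (x, y))"
    unfolding cell_topology_def by (auto simp: continuous_map_pairwise o_def)
  then have cont: "continuous_map (top_of_set erdos) ?S (\<lambda>x. (x, y))"
    using y by (auto simp: continuous_map_in_subtopology)
  have "openin (top_of_set erdos) {x \<in> topspace (top_of_set erdos). (x, y) \<in> C}"
    by (rule openin_continuous_map_preimage[OF cont op])
  moreover have "closedin (top_of_set erdos) {x \<in> topspace (top_of_set erdos). (x, y) \<in> C}"
    by (rule closedin_continuous_map_preimage[OF cont cl])
  moreover have "x \<in> {x \<in> topspace (top_of_set erdos). (x, y) \<in> C}"
    using c openin_subset[OF op] by auto
  ultimately show ?thesis
    using erdos_clopen_unbounded[of "{x \<in> topspace (top_of_set erdos). (x, y) \<in> C}" M] by blast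
qed

text \<open>A nonempty clopen set contains points of arbitrarily large norm in the fibre of any of
  its points. Since the height exceeds the norm, it meets every neighbourhood of the apex.\<close>

lemma connected_cone_subspace:
  "connectedin cone_topology (insert None (Some ` (erdos \<times> T)))"
proof -
  let ?P = "subtopology cell_topology (erdos \<times> T)" and ?U = "(\<inter>) (erdos \<times> T) ` level_base cell_topology cell_height"
  have "connected_space (adjoin_point ?P ?U)"
  proof (rule connected_adjoin_point[OF open_filter_base_subtopology[OF cone_base]])
    fix C V assume C: "openin ?P C" "closedin ?P C" "C \<noteq> {}" and "V \<in> ?U"
    then obtain n where V: "V = (erdos \<times> T) \<inter> {p \<in> topspace cell_topology. real n < cell_height p}"
      by (auto simp: level_base_def)
    obtain x y where "(x, y) \<in> C" using C(3) by auto
    then obtain x' where x': "(x', y) \<in> C" "real n < snd x'"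
      using cell_clopen_unbounded[OF C(1,2)] by blast
    have "(x', y) \<in> erdos \<times> T" using x'(1) openin_subset[OF C(1)] by auto
    moreover have "real n < cell_height (x', y)"
      using x'(2) by (auto simp: cell_height_def)
    ultimately have "(x', y) \<in> V" unfolding V by auto
    then show "C \<inter> V \<noteq> {}" using x'(1) by blast
  qed
  then have "connected_space (subtopology cone_topology (insert None (Some ` (erdos \<times> T))))"
    unfolding cone_topology_def subtopology_adjoin_point[OF cone_base] .
  then show ?thesis by (auto simp: connectedin_def)
qed

subsection \<open>Ranks of the pieces\<close>

text \<open>The nodes of the tree of strictly descending sequences starting at \<open>a\<close>. The
  real label of each entry gives continuum many children for every smaller index and makes them
  accumulate at their parent.\<close>

definition branch :: "'k rel \<Rightarrow> 'k \<Rightarrow> ('k \<times> real) list set"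
  where "branch r a =
    {s. s \<noteq> [] \<and> fst (hd s) = a \<and> sorted_wrt (\<lambda>e e'. (fst e', fst e) \<in> r - Id) s}"

definition piece :: "'k rel \<Rightarrow> 'k \<Rightarrow> 'k cell option set"
  where "piece r a = insert None (Some ` (erdos \<times> (branch r a \<times> UNIV)))"

abbreviation piece_topology :: "'k rel \<Rightarrow> 'k \<Rightarrow> 'k cell option topology"
  where "piece_topology r a \<equiv> subtopology cone_topology (piece r a)"

definition has_rank :: "'k cell option \<Rightarrow> 'k \<Rightarrow> bool"
  where "has_rank z c \<longleftrightarrow> (\<exists>x s k. z = Some (x, s, k) \<and> fst (last s) = c)"

text \<open>Stated negatively so as to contain the apex \<open>None\<close>, which has no rank: it
  is what remains after the points of rank below \<open>c\<close> have been removed.\<close>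

definition rank_ge :: "'k rel \<Rightarrow> 'k \<Rightarrow> 'k cell option set"
  where "rank_ge r c = {z. \<forall>c'. (c', c) \<in> r - Id \<longrightarrow> \<not> has_rank z c'}"

text \<open>The remainder \<open>L\<close> is a parameter, so that all stages of the removal are
  expressed in one ambient space.\<close>

definition locally_second_countable_at :: "'a topology \<Rightarrow> 'a set \<Rightarrow> 'a \<Rightarrow> bool"
  where "locally_second_countable_at X L z \<longleftrightarrow>
    (\<exists>U. openin X U \<and> z \<in> U \<and> second_countable (subtopology X (U \<inter> L)))"

lemma locally_second_countable_at_homeomorphic_imp:
  assumes h: "homeomorphic_map X Y h" and L: "L \<subseteq> topspace X"
    and z: "locally_second_countable_at X L z"
  shows "locally_second_countable_at Y (h ` L) (h z)"
proof -
  obtain U where U: "openin X U" "z \<in> U" "second_countable (subtopology X (U \<inter> L))"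
    using z unfolding locally_second_countable_at_def by blast
  have UX: "U \<subseteq> topspace X" using U(1) by (rule openin_subset)
  have "openin Y (h ` U)"
    using homeomorphic_map_openness_eq[OF h] U(1) by blast
  moreover have eq: "h ` U \<inter> h ` L = h ` (U \<inter> L)"
    using homeomorphic_imp_injective_map[OF h] UX L by (metis inj_on_image_Int)
  have "homeomorphic_map (subtopology X (U \<inter> L)) (subtopology Y (h ` (U \<inter> L))) h"
    using UX L homeomorphic_imp_surjective_map[OF h] homeomorphic_imp_injective_map[OF h]
    by (intro homeomorphic_map_subtopologies[OF h]) (auto simp: inj_on_def)
  then have "second_countable (subtopology Y (h ` U \<inter> h ` L))"
    using U(3) homeomorphic_space_second_countability homeomorphic_map_imp_homeomorphic_space
    unfolding eq by blast
  ultimately show ?thesis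
    using U(2) unfolding locally_second_countable_at_def by blast
qed

lemma locally_second_countable_at_homeomorphic:
  assumes h: "homeomorphic_map X Y h" and L: "L \<subseteq> topspace X" and z: "z \<in> topspace X"
  shows "locally_second_countable_at Y (h ` L) (h z) \<longleftrightarrow> locally_second_countable_at X L z"
proof
  assume Y: "locally_second_countable_at Y (h ` L) (h z)"
  obtain g where g: "homeomorphic_maps X Y h g"
    using h homeomorphic_map_maps by blast
  then have "homeomorphic_map Y X g"
    using homeomorphic_maps_map by blast
  moreover have "h ` L \<subseteq> topspace Y"
    using L homeomorphic_imp_surjective_map[OF h] by blast
  ultimately have "locally_second_countable_at X (g ` h ` L) (g (h z))"
    using Y by (rule locally_second_countable_at_homeomorphic_imp)
  moreover have gh: "x \<in> topspace X \<Longrightarrow> g (h x) = x" for x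
    using g by (simp add: homeomorphic_maps_def)
  moreover have "g ` h ` L = L"
  proof -
    have "(\<lambda>x. g (h x)) ` L = id ` L"
      by (rule image_cong) (use L gh in auto)
    then show ?thesis by (simp add: image_image)
  qed
  ultimately show "locally_second_countable_at X L z"
    using z by simp
qed (rule locally_second_countable_at_homeomorphic_imp[OF h L])

text \<open>Sets of a countable base chosen inside the separating neighbourhoods are different for
  different indices.\<close>

lemma second_countable_discrete_family:
  assumes X: "second_countable X"
    and f: "\<And>i. i \<in> I \<Longrightarrow> \<exists>W. openin X W \<and> f i \<in> W \<and> (\<forall>j\<in>I. f j \<in> W \<longrightarrow> j = i)"
  shows "countable I"
proof -
  obtain \<B> where B: "countable \<B>" "\<And>U x. openin X U \<Longrightarrow> x \<in> U \<Longrightarrow> \<exists>V\<in>\<B>. x \<in> V \<and> V \<subseteq> U"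
    using X unfolding second_countable_def by metis
  have "\<exists>V\<in>\<B>. f i \<in> V \<and> (\<forall>j\<in>I. f j \<in> V \<longrightarrow> j = i)" if "i \<in> I" for i
    using f[OF that] B(2) by (meson subsetD)
  then obtain V where V: "\<And>i. i \<in> I \<Longrightarrow> V i \<in> \<B> \<and> f i \<in> V i \<and> (\<forall>j\<in>I. f j \<in> V i \<longrightarrow> j = i)"
    by metis
  have "inj_on V I"
    by (rule inj_onI) (use V in metis)
  moreover have "V ` I \<subseteq> \<B>" using V by blast
  ultimately show ?thesis
    using B(1) countable_image_inj_on countable_subset by blast
qed

lemma continuous_map_into_cell:
  "x \<in> erdos \<Longrightarrow> continuous_map list_topology cell_topology (\<lambda>s. (x, s, k))"
  unfolding cell_topology_def by (auto simp: continuous_map_pairwise o_def)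

lemma openin_cone_Some: "openin cell_topology W \<Longrightarrow> openin cone_topology (Some ` W)"
  unfolding cone_topology_def using openin_adjoin_point_Some[OF cone_base] by blast

lemma openin_cone_None:
  assumes "openin cone_topology U" "None \<in> U"
  shows "\<exists>n. \<forall>p\<in>erdos \<times> UNIV. real n < cell_height p \<longrightarrow> Some p \<in> U"
proof -
  obtain n where "Some ` {p \<in> topspace cell_topology. real n < cell_height p} \<subseteq> U"
    using openin_adjoin_point_None[OF cone_base assms[unfolded cone_topology_def]]
    by (auto simp: level_base_def)
  then show ?thesis by (intro exI[of _ n]) auto
qed

lemma openin_cell_cylinder: "openin cell_topology {c \<in> topspace cell_topology. fst (snd c) \<in> {s @ u |u. True}}"
  by (rule openin_continuous_map_preimage[OF continuous_map_cell_list openin_cylinder])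

lemma openin_cell_sheet: "openin cell_topology {c \<in> topspace cell_topology. snd (snd c) \<in> K}"
  by (rule openin_continuous_map_preimage[OF continuous_map_cell_sheet]) simp

lemma erdos_unbounded: "\<exists>x\<in>erdos. M < snd x"
  using erdos_clopen_unbounded[of erdos M] zero_in_erdos by auto

lemma branch_rank:
  assumes r: "Well_order r" and a: "a \<in> Field r" and s: "s \<in> branch r a"
  shows "(fst (last s), a) \<in> r" and "e \<in> set s \<Longrightarrow> (fst (last s), fst e) \<in> r"
    and "set s \<subseteq> Field r \<times> UNIV"
proof -
  have refl: "(c, c) \<in> r" if "c \<in> Field r" for c
    using r that by (auto simp: order_on_defs refl_on_def)
  have s': "s \<noteq> []" "fst (hd s) = a" "sorted_wrt (\<lambda>e e'. (fst e', fst e) \<in> r - Id) s"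
    using s by (auto simp: branch_def)
  have hd: "e = hd s \<or> (fst e, a) \<in> r" if "e \<in> set s" for e
    using s' that by (cases s) auto
  then have F: "fst e \<in> Field r" if "e \<in> set s" for e
    using that a s'(2) by (metis FieldI1)
  then show "set s \<subseteq> Field r \<times> UNIV" by (auto simp: mem_Times_iff)
  show last: "(fst (last s), fst e) \<in> r" if "e \<in> set s" for e
  proof -
    have "s = butlast s @ [last s]" using s'(1) by simp
    then obtain t where t: "s = t @ [last s]" by blast
    have "sorted_wrt (\<lambda>e e'. (fst e', fst e) \<in> r - Id) (t @ [last s])"
      using s'(3) t by simp
    then have "\<forall>e\<in>set t. (fst (last s), fst e) \<in> r"
      unfolding sorted_wrt_append by simp
    moreover have "set s = insert (last s) (set t)"
      by (subst t) simp
    ultimately have "e = last s \<or> (fst (last s), fst e) \<in> r" using that by blast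
    then show ?thesis using refl F[OF that] by metis
  qed
  show "(fst (last s), a) \<in> r"
    using last[OF hd_in_set[OF s'(1)]] s'(2) by simp
qed

lemma branch_append:
  assumes r: "Well_order r" and a: "a \<in> Field r" and s: "s \<in> branch r a" and c: "(c, fst (last s)) \<in> r - Id"
  shows "s @ [(c, t)] \<in> branch r a"
proof -
  have "(c, fst e) \<in> r - Id" if "e \<in> set s" for e
  proof -
    have "(fst (last s), fst e) \<in> r" using branch_rank(2)[OF r a s that] .
    then show ?thesis
      using c r unfolding order_on_defs trans_def antisym_def by blast
  qed
  then show ?thesis
    using s by (auto simp: branch_def sorted_wrt_append)
qed

lemma branch_extension:
  assumes "s @ u \<in> branch r a" "s \<noteq> []" "u \<noteq> []"
  shows "(fst (last u), fst (last s)) \<in> r - Id"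
  using assms by (auto simp: branch_def sorted_wrt_append)

text \<open>A proper extension of \<open>s\<close> within the branch ends in an index below
  \<open>c\<close> and has been removed. In the cylinder over \<open>s\<close> and a single sheet
  only points of one copy of \<open>erdos\<close> remain, and this copy is second countable.\<close>

lemma has_rank_imp_locally_second_countable:
  assumes r: "Well_order r" and a: "a \<in> Field r" and z: "z \<in> piece r a" "has_rank z c"
  shows "z \<in> rank_ge r c \<and> locally_second_countable_at (piece_topology r a) (piece r a \<inter> rank_ge r c) z"
proof -
  obtain x s k where z': "z = Some (x, s, k)" "x \<in> erdos" "s \<in> branch r a" "fst (last s) = c"
    using z by (auto simp: piece_def has_rank_def)
  let ?W = "{c \<in> topspace cell_topology. fst (snd c) \<in> {s @ u |u. True}} \<inter>
            {c \<in> topspace cell_topology. snd (snd c) \<in> {k}}"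
  let ?U = "piece r a \<inter> Some ` ?W"
  have "openin (piece_topology r a) ?U"
    by (intro openin_subtopology_Int2 openin_cone_Some openin_Int openin_cell_cylinder openin_cell_sheet)
  moreover have "z \<in> ?U" using z z' by force
  moreover have "second_countable (subtopology (piece_topology r a) (?U \<inter> (piece r a \<inter> rank_ge r c)))"
  proof -
    have sub: "?U \<inter> (piece r a \<inter> rank_ge r c) \<subseteq> Some ` (erdos \<times> {(s, k)})"
    proof
      fix w assume w: "w \<in> ?U \<inter> (piece r a \<inter> rank_ge r c)"
      then obtain x' u where w': "w = Some (x', s @ u, k)" "x' \<in> erdos" "s @ u \<in> branch r a"
        by (auto simp: piece_def)
      have "u = []"
      proof (rule ccontr)
        assume u: "u \<noteq> []"
        have "s \<noteq> []" using z'(3) by (simp add: branch_def)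
        then have "(fst (last u), c) \<in> r - Id" using branch_extension[OF w'(3) _ u] z'(4) by simp
        moreover have "has_rank w (fst (last u))" using w'(1) u by (auto simp: has_rank_def)
        ultimately show False using w by (auto simp: rank_ge_def)
      qed
      then show "w \<in> Some ` (erdos \<times> {(s, k)})" using w' by auto
    qed
    have "homeomorphic_map cell_topology (subtopology cone_topology (Some ` topspace cell_topology)) Some"
      using embedding_map_Some[OF cone_base] unfolding cone_topology_def embedding_map_def .
    then have "homeomorphic_map (subtopology cell_topology (erdos \<times> {(s, k)}))
      (subtopology (subtopology cone_topology (Some ` topspace cell_topology)) (Some ` (erdos \<times> {(s, k)}))) Some"
      by (rule homeomorphic_map_subtopologies) auto
    moreover have "Some ` topspace cell_topology \<inter> Some ` (erdos \<times> {(s, k)}) = Some ` (erdos \<times> {(s, k)})"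
      by auto
    ultimately have "subtopology cell_topology (erdos \<times> {(s, k)}) homeomorphic_space
        subtopology cone_topology (Some ` (erdos \<times> {(s, k)}))"
      unfolding subtopology_subtopology using homeomorphic_map_imp_homeomorphic_space by metis
    moreover have "top_of_set erdos homeomorphic_space subtopology cell_topology (erdos \<times> {(s, k)})"
    proof -
      have "subtopology cell_topology (erdos \<times> {(s, k)}) = prod_topology (top_of_set erdos)
          (subtopology (prod_topology list_topology (discrete_topology UNIV)) {(s, k)})"
        using prod_topology_subtopology(2)[of "top_of_set erdos"
            "prod_topology list_topology (discrete_topology UNIV)" "{(s, k)}"]
        by (simp add: cell_topology_def del: prod_topology_subtopology_eu)
      then show ?thesis
        by (simp add: homeomorphic_space_prod_topology_sing1)
    qed
    moreover have "second_countable (top_of_set erdos)"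
    proof (rule second_countable_subtopology)
      show "second_countable (euclidean :: ((nat \<Rightarrow> real) \<times> real) topology)"
      proof -
        obtain \<B> :: "((nat \<Rightarrow> real) \<times> real) set set" where B: "countable \<B>"
          "\<And>C. C \<in> \<B> \<Longrightarrow> open C" "\<And>S. open S \<Longrightarrow> \<exists>U. U \<subseteq> \<B> \<and> S = \<Union>U"
          using univ_second_countable by blast
        have "\<exists>V\<in>\<B>. x \<in> V \<and> V \<subseteq> U" if "open U" "x \<in> U" for U x
        proof -
          obtain \<V> where "\<V> \<subseteq> \<B>" "U = \<Union>\<V>" using B(3) \<open>open U\<close> by blast
          then show ?thesis using \<open>x \<in> U\<close> by blast
        qed
        then show ?thesis
          unfolding second_countable_def using B(1,2) by (intro exI[of _ \<B>]) simp
      qed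
    qed
    ultimately have "second_countable (subtopology cone_topology (Some ` (erdos \<times> {(s, k)})))"
      using homeomorphic_space_second_countability by metis
    then have "second_countable (subtopology (subtopology cone_topology (Some ` (erdos \<times> {(s, k)})))
        (?U \<inter> (piece r a \<inter> rank_ge r c)))"
      by (rule second_countable_subtopology)
    moreover have "Some ` (erdos \<times> {(s, k)}) \<inter> (?U \<inter> (piece r a \<inter> rank_ge r c)) = ?U \<inter> (piece r a \<inter> rank_ge r c)"
      using sub by blast
    moreover have "piece r a \<inter> (?U \<inter> (piece r a \<inter> rank_ge r c)) = ?U \<inter> (piece r a \<inter> rank_ge r c)"
      by blast
    ultimately show ?thesis unfolding subtopology_subtopology by simp
  qed
  moreover have "z \<in> rank_ge r c"
    using z'(1,4) by (auto simp: rank_ge_def has_rank_def)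
  ultimately show ?thesis unfolding locally_second_countable_at_def by blast
qed

text \<open>A remaining point not of rank \<open>c\<close> is the apex or has a larger rank. In both
  cases each neighbourhood contains uncountably many mutually separated remaining points: for the
  apex, one cell of large norm in every sheet; otherwise the children \<open>s @ [(c, t)]\<close>
  for all large \<open>t\<close>.\<close>

lemma locally_second_countable_imp_has_rank:
  assumes r: "Well_order r" and a: "a \<in> Field r" and c: "(c, a) \<in> r"
    and z: "z \<in> piece r a" "z \<in> rank_ge r c"
    and lsc: "locally_second_countable_at (piece_topology r a) (piece r a \<inter> rank_ge r c) z"
  shows "has_rank z c"
proof (rule ccontr)
  assume no: "\<not> has_rank z c"
  obtain U where U: "openin (piece_topology r a) U" "z \<in> U"
    and sc: "second_countable (subtopology (piece_topology r a) (U \<inter> (piece r a \<inter> rank_ge r c)))"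
    using lsc unfolding locally_second_countable_at_def by blast
  obtain U' where U': "openin cone_topology U'" "U = U' \<inter> piece r a"
    using U(1) unfolding openin_subtopology by blast
  have contra: False
    if f: "\<And>i. i \<in> I \<Longrightarrow> Some (f i) \<in> U' \<inter> piece r a \<inter> rank_ge r c" and I: "uncountable I"
      and W: "\<And>i. i \<in> I \<Longrightarrow> \<exists>W. openin cell_topology W \<and> f i \<in> W \<and> (\<forall>j\<in>I. f j \<in> W \<longrightarrow> j = i)"
    for f and I :: "real set"
  proof -
    let ?Q = "U \<inter> (piece r a \<inter> rank_ge r c)"
    have "\<exists>W. openin (subtopology (piece_topology r a) ?Q) W \<and> Some (f i) \<in> W \<and> (\<forall>j\<in>I. Some (f j) \<in> W \<longrightarrow> j = i)"
      if i: "i \<in> I" for i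
    proof -
      obtain W where W': "openin cell_topology W" "f i \<in> W" "\<forall>j\<in>I. f j \<in> W \<longrightarrow> j = i"
        using W[OF i] by blast
      have "openin (subtopology (piece_topology r a) ?Q) (?Q \<inter> (piece r a \<inter> Some ` W))"
        by (intro openin_subtopology_Int2 openin_cone_Some W'(1))
      then show ?thesis
        using f[OF i] U'(2) W' by (intro exI[of _ "?Q \<inter> (piece r a \<inter> Some ` W)"]) auto
    qed
    then show False
      using second_countable_discrete_family[OF sc, of I "\<lambda>i. Some (f i)"] I by blast
  qed
  show False
  proof (cases z)
    case None
    then have "None \<in> U'" using U(2) U'(2) by blast
    then obtain n where n: "\<And>p. p \<in> erdos \<times> UNIV \<Longrightarrow> real n < cell_height p \<Longrightarrow> Some p \<in> U'"
      using openin_cone_None[OF U'(1)] by blast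
    obtain x where x: "x \<in> erdos" "real n < snd x" using erdos_unbounded by blast
    have ht: "real n < cell_height (x, s, k)" for s k
      using x(2) by (auto simp: cell_height_def)
    have inU: "Some (x, [(a, 0)], k) \<in> U'" for k
      by (rule n) (simp_all add: x(1) ht)
    have "Some (x, [(a, 0)], k) \<in> piece r a" for k
      using x(1) by (auto simp: piece_def branch_def)
    moreover have "Some (x, [(a, 0)], k) \<in> rank_ge r c" for k
    proof -
      have "(a, c) \<notin> r - Id" using c r unfolding order_on_defs antisym_def by blast
      then show ?thesis by (auto simp: rank_ge_def has_rank_def)
    qed
    ultimately show False
    proof (intro contra[of UNIV "\<lambda>k. (x, [(a, 0)], k)"])
      fix k :: real
      show "\<exists>W. openin cell_topology W \<and> (x, [(a, 0)], k) \<in> W \<and> (\<forall>j\<in>UNIV. (x, [(a, 0)], j) \<in> W \<longrightarrow> j = k)"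
        using x(1) by (intro exI[of _ "{c \<in> topspace cell_topology. snd (snd c) \<in> {k}}"] conjI openin_cell_sheet) auto
    qed (use inU uncountable_UNIV_real in auto)
  next
    case (Some p)
    then obtain x s k where p: "z = Some (x, s, k)" "x \<in> erdos" "s \<in> branch r a"
      using z(1) by (auto simp: piece_def)
    have "fst (last s) \<noteq> c" "(fst (last s), c) \<notin> r - Id"
      using no z(2) p(1) by (auto simp: has_rank_def rank_ge_def)
    moreover have "fst (last s) \<in> Field r" "c \<in> Field r"
      using branch_rank(1)[OF r a p(3)] c by (auto intro: FieldI1)
    ultimately have lt: "(c, fst (last s)) \<in> r - Id"
      using r unfolding order_on_defs total_on_def by blast
    have "openin list_topology {t \<in> topspace list_topology. (x, t, k) \<in> {p. Some p \<in> U'}}"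
      using openin_adjoin_point_vimage[OF cone_base U'(1)[unfolded cone_topology_def]]
      by (rule openin_continuous_map_preimage[OF continuous_map_into_cell[OF p(2)]])
    moreover have "s \<in> {t \<in> topspace list_topology. (x, t, k) \<in> {p. Some p \<in> U'}}"
      using U(2) U'(2) p(1) by simp
    ultimately obtain N where N: "\<And>t. t > N \<Longrightarrow> Some (x, s @ [(c, t)], k) \<in> U'"
      using list_topology_nbhd_children[of _ s c] by blast
    have "uncountable {N<..}"
    proof
      assume "countable {N<..}"
      then have "countable {N<..<N + 1}" by (rule countable_subset[rotated]) auto
      then show False using uncountable_open_interval[of N "N + 1"] by simp
    qed
    moreover have "Some (x, s @ [(c, t)], k) \<in> piece r a" for t
      using p(2) branch_append[OF r a p(3) lt] by (auto simp: piece_def)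
    moreover have "Some (x, s @ [(c, t)], k) \<in> rank_ge r c" for t
      by (auto simp: rank_ge_def has_rank_def)
    ultimately show False
    proof (intro contra[of "{N<..}" "\<lambda>t. (x, s @ [(c, t)], k)"])
      fix t
      show "\<exists>W. openin cell_topology W \<and> (x, s @ [(c, t)], k) \<in> W \<and>
          (\<forall>j\<in>{N<..}. (x, s @ [(c, j)], k) \<in> W \<longrightarrow> j = t)"
        using p(2) by (intro exI[of _ "{q \<in> topspace cell_topology. fst (snd q) \<in> {(s @ [(c, t)]) @ u |u. True}}"]
            conjI openin_cell_cylinder) auto
    qed (use N in auto)
  qed
qed

lemma topspace_piece: "topspace (piece_topology r a) = piece r a"
  by (auto simp: piece_def)

text \<open>By induction on \<open>c\<close> up to \<open>a\<close>, the homeomorphism preserves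
  rank \<open>c\<close>, since this rank is described by local second countability in what remains
  below. As all points of the smaller piece except the apex have a rank up to \<open>a\<close>, only
  the apex could be mapped to a point of rank \<open>b\<close>.\<close>

lemma piece_homeomorphic_imp_not_less:
  assumes r: "Well_order r" and ab: "(a, b) \<in> r - Id"
    and hom: "piece_topology r a homeomorphic_space piece_topology r b"
  shows False
proof -
  obtain h where h: "homeomorphic_map (piece_topology r a) (piece_topology r b) h"
    using hom homeomorphic_space by blast
  have aF: "a \<in> Field r" and bF: "b \<in> Field r" using ab by (auto intro: FieldI1 FieldI2)
  have surj: "h ` piece r a = piece r b"
    using homeomorphic_imp_surjective_map[OF h] by (simp only: topspace_piece)
  have inj: "inj_on h (piece r a)"
    using homeomorphic_imp_injective_map[OF h] by (simp only: topspace_piece)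
  have wf: "wf (r - Id)" using r by (simp add: well_order_on_def)
  have rank: "(c, a) \<in> r \<longrightarrow> (\<forall>z\<in>piece r a. has_rank z c \<longleftrightarrow> has_rank (h z) c)" for c
    using wf
  proof (induction c rule: wf_induct_rule)
    case (less c)
    show ?case
    proof (intro impI ballI)
      fix z assume c: "(c, a) \<in> r" and z: "z \<in> piece r a"
      have cb: "(c, b) \<in> r" using c ab r unfolding order_on_defs trans_def by blast
      have "(c', a) \<in> r" if "(c', c) \<in> r - Id" for c'
        using that c r unfolding order_on_defs trans_def by blast
      then have ge: "w \<in> rank_ge r c \<longleftrightarrow> h w \<in> rank_ge r c" if "w \<in> piece r a" for w
        using less that unfolding rank_ge_def by blast
      have img: "h ` (piece r a \<inter> rank_ge r c) = piece r b \<inter> rank_ge r c"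
      proof -
        have "h ` (piece r a \<inter> rank_ge r c) = h ` piece r a \<inter> rank_ge r c" using ge by blast
        then show ?thesis using surj by simp
      qed
      have hz: "h z \<in> piece r b" using z surj by blast
      have "has_rank z c \<longleftrightarrow> z \<in> rank_ge r c \<and>
          locally_second_countable_at (piece_topology r a) (piece r a \<inter> rank_ge r c) z"
        using has_rank_imp_locally_second_countable[OF r aF z]
          locally_second_countable_imp_has_rank[OF r aF c z] by blast
      also have "\<dots> \<longleftrightarrow> h z \<in> rank_ge r c \<and>
          locally_second_countable_at (piece_topology r b) (piece r b \<inter> rank_ge r c) (h z)"
        using locally_second_countable_at_homeomorphic[OF h, of "piece r a \<inter> rank_ge r c" z] z ge[OF z]
        unfolding img topspace_piece by blast
      also have "\<dots> \<longleftrightarrow> has_rank (h z) c"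
        using has_rank_imp_locally_second_countable[OF r bF hz]
          locally_second_countable_imp_has_rank[OF r bF cb hz] by blast
      finally show "has_rank z c \<longleftrightarrow> has_rank (h z) c" .
    qed
  qed
  have None: "z = None" if z: "z \<in> piece r a" "has_rank (h z) b" for z
  proof (rule ccontr)
    assume "z \<noteq> None"
    then obtain x s k where s: "z = Some (x, s, k)" "s \<in> branch r a"
      using z(1) by (auto simp: piece_def)
    have le: "(fst (last s), a) \<in> r" using branch_rank(1)[OF r aF s(2)] .
    have "has_rank z (fst (last s))" using s(1) by (auto simp: has_rank_def)
    then have "has_rank (h z) (fst (last s))" using rank le z(1) by blast
    then have "fst (last s) = b" using z(2) by (auto simp: has_rank_def)
    then show False using le ab r unfolding order_on_defs antisym_def by blast
  qed
  \<comment> \<open>Two different points of rank \<open>b\<close>, in sheets 0 and 1, cannot both be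
    the image of the apex.\<close>
  let ?p = "\<lambda>k. Some (((\<lambda>i. 0), 0), [(b, 0)], k) :: 'a cell option"
  have mem: "?p k \<in> piece r b" for k
    using zero_in_erdos by (auto simp: piece_def branch_def)
  have "\<exists>z\<in>piece r a. h z = ?p k" for k
    using mem[of k] unfolding surj[symmetric] by force
  then obtain z0 z1 where z: "z0 \<in> piece r a" "h z0 = ?p 0" "z1 \<in> piece r a" "h z1 = ?p 1"
    by metis
  then have "z0 = None" "z1 = None"
    using None by (auto simp: has_rank_def)
  then show False using z by simp
qed

lemma piece_homeomorphic_imp_eq:
  assumes r: "Well_order r" and "a \<in> Field r" "b \<in> Field r"
    and hom: "piece_topology r a homeomorphic_space piece_topology r b"
  shows "a = b"
proof (rule ccontr)
  assume "a \<noteq> b"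
  then have "(a, b) \<in> r - Id \<or> (b, a) \<in> r - Id"
    using assms(2,3) r unfolding order_on_defs total_on_def by blast
  then show False
    using piece_homeomorphic_imp_not_less[OF r] hom homeomorphic_space_sym by metis
qed

subsection \<open>The sum of the pieces\<close>

text \<open>If a path takes a value outside \<open>C\<close>, the set of times with that value is
  closed. It is also open, since near such a time the path stays off \<open>C\<close>, where
  connected sets are points. Hence it is the whole interval. This allows connected spaces, which may
  fall apart on removing \<open>C\<close>.\<close>

lemma totally_pathwise_disconnected_spaceI:
  assumes H: "Hausdorff_space X" and C: "closedin X C"
    and in_C: "\<And>S x y. connectedin X S \<Longrightarrow> S \<subseteq> C \<Longrightarrow> x \<in> S \<Longrightarrow> y \<in> S \<Longrightarrow> x = y"
    and off_C: "\<And>S x y. connectedin X S \<Longrightarrow> S \<inter> C = {} \<Longrightarrow> x \<in> S \<Longrightarrow> y \<in> S \<Longrightarrow> x = y"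
  shows "totally_pathwise_disconnected_space X"
  unfolding totally_pathwise_disconnected_space_def
proof (intro allI impI)
  fix g assume g: "pathin X g"
  let ?I = "top_of_set {0..1::real}"
  have cont: "continuous_map ?I X g" using g by (simp add: pathin_def)
  have conn: "connectedin X (g ` S)" if "connected S" "S \<subseteq> {0..1}" for S
    using connectedin_continuous_map_image[OF cont] that by (simp add: connectedin_subtopology)
  show "\<exists>c. \<forall>t\<in>{0..1}. g t = c"
  proof (cases "g ` {0..1} \<subseteq> C")
    case True
    then have "g t = g 0" if "t \<in> {0..1}" for t
      using in_C[OF conn[of "{0..1}"] True, of "g t" "g 0"] that by auto
    then show ?thesis by blast
  next
    case False
    then obtain t where t: "t \<in> {0..1}" "g t \<notin> C" by blast
    let ?Q = "{s \<in> topspace ?I. g s \<in> {g t}}"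
    have gt: "g t \<in> topspace X" using t cont by (auto simp: continuous_map_def)
    have "closedin X {g t}" using Hausdorff_imp_t1_space[OF H] gt by (simp add: t1_space_closedin_singleton)
    then have cl: "closedin ?I ?Q" by (rule closedin_continuous_map_preimage[OF cont])
    have O: "openin ?I {s \<in> topspace ?I. g s \<in> topspace X - C}"
      by (rule openin_continuous_map_preimage[OF cont openin_diff[OF openin_topspace C]])
    have "openin ?I ?Q"
    proof (subst openin_subopen, intro ballI)
      fix s assume s: "s \<in> ?Q"
      then have "s \<in> {s \<in> topspace ?I. g s \<in> topspace X - C}" using gt t by auto
      \<comment> \<open>A short interval around \<open>s\<close> is mapped to a connected set that
        misses \<open>C\<close>.\<close>
      then obtain e where e: "e > 0" "ball s e \<inter> {0..1} \<subseteq> {s \<in> topspace ?I. g s \<in> topspace X - C}"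
        using O unfolding openin_contains_ball by blast
      have dis: "g ` (ball s e \<inter> {0..1}) \<inter> C = {}" using e(2) by auto
      have sI: "s \<in> ball s e \<inter> {0..1}" using s e(1) by auto
      have "g u = g s" if "u \<in> ball s e \<inter> {0..1}" for u
      proof (rule off_C[OF conn])
        show "connected (ball s e \<inter> {0..1})" by (simp add: convex_Int convex_connected)
        show "g s \<in> g ` (ball s e \<inter> {0..1})" using sI by (rule imageI)
        show "g u \<in> g ` (ball s e \<inter> {0..1})" using that by (rule imageI)
      qed (use dis in auto)
      then have "ball s e \<inter> {0..1} \<subseteq> ?Q" using s by auto
      moreover have "openin ?I (ball s e \<inter> {0..1})" using openin_open_Int[OF open_ball, of "{0..1}" s e] by (simp only: Int_commute)
      moreover note sI
      ultimately show "\<exists>T. openin ?I T \<and> s \<in> T \<and> T \<subseteq> ?Q" by blast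
    qed
    moreover have "connected_space ?I"
      using connected_Icc[of "0::real" 1] by (simp add: connectedin_def flip: connectedin_iff_connected)
    ultimately have "?Q = {} \<or> ?Q = topspace ?I"
      using cl unfolding connected_space_clopen_in by blast
    then have "?Q = {0..1}" using t(1) by auto
    then show ?thesis by blast
  qed
qed

lemma continuous_map_adjoin_point:
  assumes base: "open_filter_base P \<U>" and f: "continuous_map P Y (\<lambda>p. f (Some p))"
    and V: "V \<in> \<U>" "\<And>p. p \<in> V \<Longrightarrow> f (Some p) = f None" and N: "f None \<in> topspace Y"
  shows "continuous_map (adjoin_point P \<U>) Y f"
  unfolding continuous_map
proof (intro conjI allI impI)
  show "f ` topspace (adjoin_point P \<U>) \<subseteq> topspace Y"
    using N f unfolding topspace_adjoin_point[OF base] continuous_map by auto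
  fix U assume U: "openin Y U"
  let ?W = "{z \<in> topspace (adjoin_point P \<U>). f z \<in> U}"
  have "{p. Some p \<in> ?W} = {p \<in> topspace P. f (Some p) \<in> U}"
    unfolding topspace_adjoin_point[OF base] by auto
  then have "openin P {p. Some p \<in> ?W}"
    using openin_continuous_map_preimage[OF f U] by simp
  moreover have "\<exists>V\<in>\<U>. Some ` V \<subseteq> ?W" if "None \<in> ?W"
  proof
    have "V \<subseteq> topspace P" using V(1) base unfolding open_filter_base_def by (meson openin_subset)
    then show "Some ` V \<subseteq> ?W" using that V(2) unfolding topspace_adjoin_point[OF base] by auto
  qed (rule V(1))
  ultimately show "openin (adjoin_point P \<U>) ?W"
    unfolding openin_adjoin_point[OF base] by blast
qed

definition cone_depth :: "'k cell option \<Rightarrow> real"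
  where "cone_depth z = (case z of None \<Rightarrow> 0 | Some c \<Rightarrow> cell_depth c)"

lemma cone_depth_simps [simp]: "cone_depth None = 0" "cone_depth (Some c) = cell_depth c"
  by (simp_all add: cone_depth_def)

text \<open>A nonzero depth needs a negative sheet and a norm below 2, where the height is below 3.
  So the depth vanishes near the apex and extends continuously by 0.\<close>

lemma cell_depth_eq_0: "3 < cell_height c \<Longrightarrow> cell_depth c = 0"
  by (auto simp: cell_height_def cell_depth_def max_def split: if_splits)

lemma continuous_map_cone_depth: "continuous_map cone_topology euclideanreal cone_depth"
  unfolding cone_topology_def
proof (rule continuous_map_adjoin_point[OF cone_base])
  show "{p \<in> topspace cell_topology. real 3 < cell_height p} \<in> level_base cell_topology cell_height"
    unfolding level_base_def by blast
qed (auto simp: continuous_map_cell_depth cell_depth_eq_0)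

definition pieces :: "'k rel \<Rightarrow> (('k \<times> nat) \<times> 'k cell option) set"
  where "pieces r = (SIGMA j:Field r \<times> UNIV. piece r (fst j))"

text \<open>The disjoint sum, realised inside a product with a discrete index space so that
  metrizability is inherited.\<close>

definition pieces_topology :: "'k rel \<Rightarrow> (('k \<times> nat) \<times> 'k cell option) topology"
  where "pieces_topology r = subtopology (prod_topology (discrete_topology UNIV) cone_topology) (pieces r)"

lemma piece_subset: "piece r a \<subseteq> topspace cone_topology"
  by (auto simp: piece_def)

lemma topspace_pieces_topology [simp]: "topspace (pieces_topology r) = pieces r"
proof -
  have "pieces r \<subseteq> UNIV \<times> topspace cone_topology"
    unfolding pieces_def by (rule Sigma_mono) (simp_all add: piece_subset del: topspace_cone_topology)
  then show ?thesis unfolding pieces_topology_def by (simp add: Int_absorb1 del: topspace_cone_topology)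
qed

lemma metrizable_pieces_topology: "metrizable_space (pieces_topology r)"
  unfolding pieces_topology_def
  by (simp add: metrizable_space_subtopology metrizable_space_prod_topology metrizable_cone_topology)

lemma continuous_map_pieces_fst: "continuous_map (pieces_topology r) (discrete_topology UNIV) fst"
  unfolding pieces_topology_def by (intro continuous_map_from_subtopology continuous_map_fst)

lemma continuous_map_pieces_snd: "continuous_map (pieces_topology r) cone_topology snd"
  unfolding pieces_topology_def by (intro continuous_map_from_subtopology continuous_map_snd)

lemma continuous_map_pieces_depth: "continuous_map (pieces_topology r) euclideanreal (\<lambda>w. cone_depth (snd w))"
  using continuous_map_compose[OF continuous_map_pieces_snd continuous_map_cone_depth] unfolding o_def .

lemma openin_pieces_block: "openin (pieces_topology r) {w \<in> pieces r. fst w \<in> K}"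
  using openin_continuous_map_preimage[OF continuous_map_pieces_fst, of K r] by simp

lemma closedin_pieces_block: "closedin (pieces_topology r) {w \<in> pieces r. fst w \<in> K}"
  using closedin_continuous_map_preimage[OF continuous_map_pieces_fst, of K r] by simp

lemma continuous_map_into_pieces:
  assumes "fst j \<in> Field r"
  shows "continuous_map (piece_topology r (fst j)) (pieces_topology r) (Pair j)"
  unfolding pieces_topology_def
proof (rule continuous_map_into_subtopology)
  show "continuous_map (piece_topology r (fst j)) (prod_topology (discrete_topology UNIV) cone_topology) (Pair j)"
    by (auto simp: continuous_map_pairwise o_def continuous_map_from_subtopology)
  show "Pair j \<in> topspace (piece_topology r (fst j)) \<rightarrow> pieces r"
    using assms unfolding topspace_piece by (auto simp: pieces_def mem_Times_iff)
qed

lemma block_homeomorphic_piece: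
  assumes "fst j \<in> Field r"
  shows "piece_topology r (fst j) homeomorphic_space subtopology (pieces_topology r) ({j} \<times> piece r (fst j))"
proof -
  have "pieces r \<inter> {j} \<times> piece r (fst j) = {j} \<times> piece r (fst j)"
    using assms by (auto simp: pieces_def mem_Times_iff)
  then have "subtopology (pieces_topology r) ({j} \<times> piece r (fst j)) =
      prod_topology (subtopology (discrete_topology UNIV) {j}) (piece_topology r (fst j))"
    unfolding pieces_topology_def subtopology_subtopology by (simp add: subtopology_Times)
  then show ?thesis
    using homeomorphic_space_prod_topology_sing2[of j "discrete_topology UNIV" "piece_topology r (fst j)"]
    by simp
qed

lemma connectedin_block:
  assumes "fst j \<in> Field r"
  shows "connectedin (pieces_topology r) ({j} \<times> piece r (fst j))"
proof -
  have "connectedin (piece_topology r (fst j)) (piece r (fst j))"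
    unfolding connectedin_absolute piece_def by (rule connected_cone_subspace)
  from connectedin_continuous_map_image[OF continuous_map_into_pieces[OF assms] this]
  show ?thesis by (auto simp: image_def elim!: back_subst[of "connectedin _"])
qed

lemma connectedin_pieces_subset_block:
  assumes S: "connectedin (pieces_topology r) S" and w: "w \<in> S"
  shows "fst w \<in> Field r \<times> UNIV" and "S \<subseteq> {fst w} \<times> piece r (fst (fst w))"
proof -
  have sub: "S \<subseteq> pieces r" using connectedin_subset_topspace[OF S] by simp
  then show "fst w \<in> Field r \<times> UNIV" using w by (auto simp: pieces_def)
  obtain j where "fst ` S \<subseteq> {j}"
    using connectedin_continuous_map_image[OF continuous_map_pieces_fst S]
    by (auto simp: connectedin_discrete_topology)
  then have "fst v = fst w" if "v \<in> S" for v using that w by blast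
  then show "S \<subseteq> {fst w} \<times> piece r (fst (fst w))"
    using sub by (fastforce simp: pieces_def)
qed

lemma connectedin_adjoin_point_Some:
  assumes "open_filter_base P \<U>"
  shows "connectedin (adjoin_point P \<U>) (Some ` S) \<longleftrightarrow> connectedin P S"
proof (cases "S \<subseteq> topspace P")
  case True
  have "homeomorphic_map P (subtopology (adjoin_point P \<U>) (Some ` topspace P)) Some"
    using embedding_map_Some[OF assms] unfolding embedding_map_def .
  then show ?thesis
    using homeomorphic_map_connectedness[OF _ True] True
    by (fastforce simp: connectedin_subtopology)
next
  case False
  then show ?thesis
    using connectedin_subset_topspace[of "adjoin_point P \<U>" "Some ` S"] connectedin_subset_topspace[of P S]
    unfolding topspace_adjoin_point[OF assms] by blast
qed

lemma connectedin_pieces_no_apex: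
  assumes S: "connectedin (pieces_topology r) S" and N: "\<And>w. w \<in> S \<Longrightarrow> snd w \<noteq> None"
    and vw: "v \<in> S" "w \<in> S"
  shows "v = w"
proof -
  have "snd ` S = Some ` (the ` snd ` S)"
    using N by (force simp: image_image)
  moreover have "connectedin cone_topology (snd ` S)"
    by (rule connectedin_continuous_map_image[OF continuous_map_pieces_snd S])
  ultimately have "connectedin cell_topology (the ` snd ` S)"
    unfolding cone_topology_def by (metis connectedin_adjoin_point_Some cone_base)
  then have "the (snd v) = the (snd w)"
    using vw by (intro cell_connected_subsingleton) auto
  then have "snd v = snd w" using N[OF vw(1)] N[OF vw(2)] by auto
  moreover have "fst v = fst w"
    using connectedin_pieces_subset_block(2)[OF S vw(2)] vw(1) by auto
  ultimately show ?thesis by (simp add: prod_eq_iff)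
qed

text \<open>An isolated cell would be a clopen singleton in a union of fibres, whereas nonempty
  clopen sets there have unbounded norm.\<close>

lemma pieces_not_isolated:
  assumes w: "(j, Some c) \<in> pieces r"
  shows "\<not> openin (pieces_topology r) {(j, Some c)}"
proof
  assume op: "openin (pieces_topology r) {(j, Some c)}"
  have j: "fst j \<in> Field r" and c: "c \<in> erdos \<times> (branch r (fst j) \<times> UNIV)"
    using w by (auto simp: pieces_def piece_def mem_Times_iff)
  let ?T = "branch r (fst j) \<times> UNIV :: (('a \<times> real) list \<times> real) set"
  let ?S = "subtopology cell_topology (erdos \<times> ?T)"
  have "continuous_map ?S cone_topology Some"
    unfolding cone_topology_def by (intro continuous_map_from_subtopology continuous_map_Some[OF cone_base])
  then have "continuous_map ?S (piece_topology r (fst j)) Some"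
    by (rule continuous_map_into_subtopology) (auto simp: piece_def)
  then have cont: "continuous_map ?S (pieces_topology r) (\<lambda>c. (j, Some c))"
    using continuous_map_compose[OF _ continuous_map_into_pieces[OF j]] unfolding o_def by blast
  have top: "topspace ?S = erdos \<times> ?T" by auto
  have "openin ?S {c' \<in> topspace ?S. (j, Some c') \<in> {(j, Some c)}}"
    by (rule openin_continuous_map_preimage[OF cont op])
  moreover have "{c' \<in> topspace ?S. (j, Some c') \<in> {(j, Some c)}} = {c}"
    unfolding top using c by auto
  ultimately have o: "openin ?S {c}" by simp
  have "t1_space ?S"
    using metrizable_cell_topology metrizable_space_subtopology metrizable_imp_t1_space by blast
  then have "closedin ?S {c}"
    unfolding t1_space_closedin_singleton using top c by blast
  then obtain x' where "(x', snd c) \<in> {c}" "snd (fst c) < snd x'"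
    using cell_clopen_unbounded[OF o, of "fst c" "snd c" "snd (fst c)"] by auto
  then show False by (metis fst_conv less_irrefl singletonD)
qed

text \<open>\<open>G1\<close> is the open ball of radius 2 in the sheet \<open>k\<close>, and
  \<open>G2\<close> consists of the apex and all cells off the closed ball. Only the sphere between
  them is missing; its height is 3, so a bound of 4 on the height excludes it.\<close>

lemma cone_gap:
  assumes k: "2 < k"
  shows "\<exists>G1 G2. openin cone_topology G1 \<and> openin cone_topology G2 \<and> G1 \<inter> G2 = {} \<and> None \<in> G2 \<and>
    (\<forall>c\<in>erdos \<times> UNIV. snd (fst c) = 0 \<and> snd (snd c) = k \<longrightarrow> Some c \<in> G1) \<and>
    (\<forall>c\<in>erdos \<times> UNIV. 4 < cell_height c \<longrightarrow> Some c \<in> G1 \<union> G2)"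
proof (intro exI conjI ballI impI)
  let ?A = "{c \<in> topspace cell_topology. snd (fst c) \<in> {..<2}} \<inter> {c \<in> topspace cell_topology. snd (snd c) \<in> {k}}"
  let ?B = "{c \<in> topspace cell_topology. snd (fst c) \<in> {2<..}} \<union> {c \<in> topspace cell_topology. snd (snd c) \<in> - {k}}"
  have A: "openin cell_topology ?A" and B: "openin cell_topology ?B"
    by (intro openin_Int openin_Un openin_cell_sheet openin_continuous_map_preimage[OF continuous_map_cell_norm]; simp)+
  show "openin cone_topology (Some ` ?A)" by (rule openin_cone_Some[OF A])
  \<comment> \<open>The height on the closed ball of radius 2 in the sheet \<open>k\<close> is at
    most \<open>1 + 2 * k\<close>.\<close>
  obtain n :: nat where n: "1 + 2 * k < real n" using reals_Archimedean2 by blast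
  show "openin cone_topology (insert None (Some ` ?B))"
    unfolding cone_topology_def
  proof (rule openin_adjoin_point_insert_None[OF cone_base B])
    show "{p \<in> topspace cell_topology. real n < cell_height p} \<in> level_base cell_topology cell_height"
      unfolding level_base_def by blast
    show "{p \<in> topspace cell_topology. real n < cell_height p} \<subseteq> ?B"
    proof
      fix p assume p: "p \<in> {p \<in> topspace cell_topology. real n < cell_height p}"
      show "p \<in> ?B"
      proof (cases "snd (snd p) = k")
        case True
        have "0 \<le> snd (fst p)" using p erdos_snd_nonneg[of "fst p"] by (auto simp: mem_Times_iff)
        then have "k * (2 - snd (fst p)) \<le> k * 2" using k by (intro mult_left_mono) auto
        moreover have "real n < 1 + max (snd (fst p)) (k * (2 - snd (fst p)))"
          using p True k by (simp add: cell_height_def)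
        ultimately have "2 < snd (fst p)" using n k by linarith
        then show ?thesis using p by simp
      qed (use p in simp)
    qed
  qed
  show "Some ` ?A \<inter> insert None (Some ` ?B) = {}" by auto
  show "Some c \<in> Some ` ?A" if "c \<in> erdos \<times> UNIV" "snd (fst c) = 0 \<and> snd (snd c) = k" for c
    using that by auto
  show "Some c \<in> Some ` ?A \<union> insert None (Some ` ?B)" if c: "c \<in> erdos \<times> UNIV" "4 < cell_height c" for c
  proof -
    have "snd (fst c) \<noteq> 2" using c(2) by (auto simp: cell_height_def)
    then have "c \<in> ?A \<union> ?B" using c(1) by force
    then show ?thesis by blast
  qed
qed simp

subsection \<open>The extension of the sum by a filter\<close>

text \<open>The first alternative reaches into every block and gives connectedness. The second
  admits whole blocks and stores the filter; its bound on the copy number forces the neighbourhoods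
  to shrink to nothing.\<close>

definition apex_nbhd :: "'k rel \<Rightarrow> ('s \<Rightarrow> 'k set) \<Rightarrow> nat \<Rightarrow> 's set \<Rightarrow> (('k \<times> nat) \<times> 'k cell option) set"
  where "apex_nbhd r J n S =
    {w \<in> pieces r. real n < cone_depth (snd w) \<or> n \<le> snd (fst w) \<and> (\<forall>s\<in>S. fst (fst w) \<in> J s)}"

definition apex_base :: "'k rel \<Rightarrow> ('s \<Rightarrow> 'k set) \<Rightarrow> 's set \<Rightarrow> (('k \<times> nat) \<times> 'k cell option) set set"
  where "apex_base r J A = {apex_nbhd r J n S |n S. finite S \<and> S \<subseteq> A}"

definition filter_space :: "'k rel \<Rightarrow> ('s \<Rightarrow> 'k set) \<Rightarrow> 's set \<Rightarrow> (('k \<times> nat) \<times> 'k cell option) option topology"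
  where "filter_space r J A = adjoin_point (pieces_topology r) (apex_base r J A)"

text \<open>The one-sided form of independence: within \<open>K\<close>, no finite intersection of
  members is contained in a further member. With \<open>S = {}\<close> it says that each member
  omits a point of \<open>K\<close>.\<close>

definition independent_family :: "'k set \<Rightarrow> ('s \<Rightarrow> 'k set) \<Rightarrow> 's set \<Rightarrow> bool"
  where "independent_family K J I \<longleftrightarrow>
    (\<forall>S s. finite S \<and> S \<subseteq> I \<and> s \<in> I - S \<longrightarrow> (\<exists>a\<in>K. (\<forall>t\<in>S. a \<in> J t) \<and> a \<notin> J s))"

lemma apex_nbhd_eq: "apex_nbhd r J n S =
    {w \<in> topspace (pieces_topology r). real n < cone_depth (snd w)} \<union>
    {w \<in> pieces r. fst w \<in> {j. n \<le> snd j \<and> (\<forall>s\<in>S. fst j \<in> J s)}}"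
  by (auto simp: apex_nbhd_def)

lemma openin_apex_nbhd: "openin (pieces_topology r) (apex_nbhd r J n S)"
  unfolding apex_nbhd_eq
  by (intro openin_Un openin_pieces_block openin_superlevel[OF continuous_map_pieces_depth])

lemma apex_nbhd_mono: "n \<le> m \<Longrightarrow> S \<subseteq> T \<Longrightarrow> apex_nbhd r J m T \<subseteq> apex_nbhd r J n S"
  by (force simp: apex_nbhd_def)

lemma apex_base: "open_filter_base (pieces_topology r) (apex_base r J A)"
  unfolding open_filter_base_def
proof (intro conjI ballI)
  show "apex_base r J A \<noteq> {}" by (auto simp: apex_base_def)
next
  fix V assume "V \<in> apex_base r J A"
  then show "openin (pieces_topology r) V" by (auto simp: apex_base_def openin_apex_nbhd)
next
  fix V W assume "V \<in> apex_base r J A" "W \<in> apex_base r J A"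
  then obtain n S m T where VW: "V = apex_nbhd r J n S" "W = apex_nbhd r J m T"
      "finite S" "S \<subseteq> A" "finite T" "T \<subseteq> A"
    by (auto simp: apex_base_def)
  have "apex_nbhd r J (max n m) (S \<union> T) \<in> apex_base r J A"
    unfolding apex_base_def using VW(3-6) by blast
  moreover have "apex_nbhd r J (max n m) (S \<union> T) \<subseteq> V \<inter> W"
    unfolding VW(1,2) by (intro Int_greatest apex_nbhd_mono) auto
  ultimately show "\<exists>T\<in>apex_base r J A. T \<subseteq> V \<inter> W" by blast
qed

lemma topspace_filter_space: "topspace (filter_space r J A) = insert None (Some ` pieces r)"
  unfolding filter_space_def topspace_adjoin_point[OF apex_base] by simp

text \<open>Unions of blocks are clopen, so taking the closure can only turn the strict bound on the
  depth into a weak one, and \<open>Suc n\<close> still exceeds \<open>n\<close>.\<close>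

lemma closure_of_apex_nbhd: "pieces_topology r closure_of apex_nbhd r J (Suc n) S \<subseteq> apex_nbhd r J n S"
proof -
  let ?F = "{w \<in> topspace (pieces_topology r). cone_depth (snd w) \<in> {real (Suc n)..}} \<union>
    {w \<in> pieces r. fst w \<in> {j. Suc n \<le> snd j \<and> (\<forall>s\<in>S. fst j \<in> J s)}}"
  have "closedin (pieces_topology r) ?F"
    by (intro closedin_Un closedin_pieces_block closedin_continuous_map_preimage[OF continuous_map_pieces_depth]) simp
  moreover have "apex_nbhd r J (Suc n) S \<subseteq> ?F" by (auto simp: apex_nbhd_eq)
  ultimately have "pieces_topology r closure_of apex_nbhd r J (Suc n) S \<subseteq> ?F"
    by (rule closure_of_minimal[rotated])
  also have "\<dots> \<subseteq> apex_nbhd r J n S" by (auto simp: apex_nbhd_def)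
  finally show ?thesis .
qed

lemma perfectly_normal_filter_space: "perfectly_normal_space (filter_space r J A)"
  unfolding filter_space_def
proof (rule perfectly_normal_adjoin_point[OF metrizable_pieces_topology apex_base, of _ _ _ "\<lambda>n. apex_nbhd r J n {}"])
  fix V assume "V \<in> apex_base r J A"
  then obtain n S where V: "V = apex_nbhd r J n S" "finite S" "S \<subseteq> A" by (auto simp: apex_base_def)
  then have "apex_nbhd r J (Suc n) S \<in> apex_base r J A" by (auto simp: apex_base_def)
  then show "\<exists>W\<in>apex_base r J A. pieces_topology r closure_of W \<subseteq> V"
    using closure_of_apex_nbhd V(1) by blast
next
  show "apex_nbhd r J n {} \<in> apex_base r J A" for n by (auto simp: apex_base_def)
  have "\<exists>n. w \<notin> apex_nbhd r J n {}" for w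
  proof -
    obtain n :: nat where n: "cone_depth (snd w) < real n" using reals_Archimedean2 by blast
    \<comment> \<open>\<open>n\<close> defeats the alternative on the depth, the successor of the
      copy number the other one.\<close>
    have "w \<notin> apex_nbhd r J (max n (Suc (snd (fst w)))) {}"
      using n by (auto simp: apex_nbhd_def)
    then show ?thesis by blast
  qed
  then show "(\<Inter>n. apex_nbhd r J n {}) = {}" by blast
qed

lemma Hausdorff_filter_space: "Hausdorff_space (filter_space r J A)"
  using perfectly_normal_filter_space unfolding perfectly_normal_space_def by blast

lemma almost_metrizable_filter_space: "almost_metrizable_space (filter_space r J A)"
  unfolding almost_metrizable_space_def
proof (intro conjI bexI[of _ None])
  show "metrizable_space (subtopology (filter_space r J A) (topspace (filter_space r J A) - {None}))"
    using homeomorphic_space_adjoin_point_minus[OF apex_base] metrizable_pieces_topology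
      homeomorphic_metrizable_space unfolding filter_space_def by blast
qed (auto simp: perfectly_normal_filter_space topspace_filter_space)

section \<open>Connectedness, paths and failure of local connectedness\<close>

definition test_cell :: "'k \<Rightarrow> real \<Rightarrow> 'k cell"
  where "test_cell a k = (((\<lambda>i. 0), 0), [(a, 0)], k)"

lemma test_cell_in_piece: "Some (test_cell a k) \<in> piece r a"
  using zero_in_erdos by (auto simp: piece_def branch_def test_cell_def)

lemma None_in_piece: "None \<in> piece r a"
  by (simp add: piece_def)

lemma cell_depth_test_cell: "0 \<le> k \<Longrightarrow> cell_depth (test_cell a (- k)) = 2 * k"
  by (simp add: cell_depth_def test_cell_def)

lemma cell_height_test_cell: "0 \<le> k \<Longrightarrow> cell_height (test_cell a k) = 1 + 2 * k"
  by (simp add: cell_height_def test_cell_def)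

text \<open>A nonempty clopen set contains a whole block, and every block has cells of arbitrarily
  large depth.\<close>

lemma connected_filter_space: "connected_space (filter_space r J A)"
  unfolding filter_space_def
proof (rule connected_adjoin_point[OF apex_base])
  fix C V assume C: "openin (pieces_topology r) C" "closedin (pieces_topology r) C" "C \<noteq> {}"
    and "V \<in> apex_base r J A"
  then obtain n S where V: "V = apex_nbhd r J n S" by (auto simp: apex_base_def)
  obtain j z where w: "(j, z) \<in> C" using C(3) by auto
  then have "(j, z) \<in> pieces r" using openin_subset[OF C(1)] by auto
  then have j: "fst j \<in> Field r" and z: "z \<in> piece r (fst j)" by (auto simp: pieces_def)
  have "{j} \<times> piece r (fst j) \<subseteq> C"
    using connectedin_clopen_cases[OF connectedin_block[OF j] C(2,1)] w z by (auto simp: disjnt_iff)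
  moreover have "(j, Some (test_cell (fst j) (- real (Suc n)))) \<in> {j} \<times> piece r (fst j)"
    using test_cell_in_piece by auto
  moreover have "real n < cell_depth (test_cell (fst j) (- real (Suc n)))"
    by (simp add: cell_depth_test_cell del: of_nat_Suc) simp
  then have "(j, Some (test_cell (fst j) (- real (Suc n)))) \<in> V"
    using j test_cell_in_piece[of "fst j"] unfolding V apex_nbhd_def pieces_def by (simp add: mem_Times_iff)
  ultimately show "C \<inter> V \<noteq> {}" by blast
qed

lemma connectedin_filter_space_block:
  assumes S: "connectedin (filter_space r J A) S" and N: "None \<notin> S"
  shows "\<exists>T. S = Some ` T \<and> connectedin (pieces_topology r) T"
proof -
  have "S = Some ` {w. Some w \<in> S}"
  proof (rule set_eqI)
    fix z show "z \<in> S \<longleftrightarrow> z \<in> Some ` {w. Some w \<in> S}"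
      using N by (cases z) auto
  qed
  then show ?thesis
    using S connectedin_adjoin_point_Some[OF apex_base] unfolding filter_space_def by metis
qed

text \<open>The closed set consists of the new point and all the cone apexes. Off it only cells
  remain, and their connected sets are points.\<close>

lemma totally_pathwise_disconnected_filter_space:
  "totally_pathwise_disconnected_space (filter_space r J A)"
proof (rule totally_pathwise_disconnected_spaceI[OF Hausdorff_filter_space])
  let ?X = "filter_space r J A"
  let ?O = "{w \<in> pieces r. snd w \<in> Some ` topspace cell_topology}"
  have "openin cone_topology (Some ` topspace cell_topology)"
    by (rule openin_cone_Some[OF openin_topspace])
  then have "openin (pieces_topology r) {w \<in> topspace (pieces_topology r). snd w \<in> Some ` topspace cell_topology}"
    by (rule openin_continuous_map_preimage[OF continuous_map_pieces_snd])
  then have O: "openin ?X (Some ` ?O)"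
    unfolding filter_space_def openin_adjoin_point_Some[OF apex_base] by simp
  let ?C = "topspace ?X - Some ` ?O"
  show "closedin ?X ?C" using O by blast
  have no_cell: "snd w = None" if "Some w \<in> ?C" for w
    using that unfolding topspace_filter_space
    by (cases "snd w") (auto simp: pieces_def piece_def)
  have single: "S = {Some w}" if S: "connectedin ?X S" "S \<subseteq> ?C" "Some w \<in> S" for S w
  proof -
    \<comment> \<open>\<open>w\<close> is the only point of \<open>?C\<close> in its open block, so
      a connected subset of \<open>?C\<close> cannot contain it together with another point.\<close>
    let ?G1 = "Some ` {v \<in> pieces r. fst v \<in> {fst w}}" and ?G2 = "topspace ?X - {Some w}"
    have "openin ?X ?G1"
      unfolding filter_space_def openin_adjoin_point_Some[OF apex_base] by (rule openin_pieces_block)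
    moreover have w: "Some w \<in> topspace ?X" using S by blast
    then have "openin ?X ?G2"
      using Hausdorff_imp_t1_space[OF Hausdorff_filter_space] unfolding t1_space_closedin_singleton by blast
    moreover have "?G1 \<inter> ?G2 \<inter> S = {}"
    proof -
      have "v = w" if "Some v \<in> S" "fst v = fst w" for v
      proof -
        have "snd v = None" using no_cell S(2) that(1) by blast
        moreover have "snd w = None" using no_cell S(2,3) by blast
        ultimately show ?thesis using that(2) by (simp add: prod_eq_iff)
      qed
      then show ?thesis by blast
    qed
    moreover have "S \<subseteq> ?G1 \<union> ?G2" using S w by (auto simp: topspace_filter_space)
    moreover have "?G1 \<inter> S \<noteq> {}" using S(3) w by (auto simp: topspace_filter_space)
    ultimately have "?G2 \<inter> S = {}" using S(1) unfolding connectedin by meson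
    then show ?thesis using S by blast
  qed
  show "x = y" if S: "connectedin ?X S" "S \<subseteq> ?C" and xy: "x \<in> S" "y \<in> S" for S x y
  proof (cases "S \<subseteq> {None}")
    case False
    then obtain w where "Some w \<in> S" by (metis not_None_eq singletonI subsetI)
    then show ?thesis using single[OF S] xy by blast
  qed (use xy in blast)
  show "x = y" if S: "connectedin ?X S" "S \<inter> ?C = {}" and xy: "x \<in> S" "y \<in> S" for S x y
  proof -
    have "None \<notin> S" using S(2) by (auto simp: topspace_filter_space)
    then obtain T where T: "S = Some ` T" "connectedin (pieces_topology r) T"
      using connectedin_filter_space_block[OF S(1)] by blast
    have "snd w \<noteq> None" if "w \<in> T" for w
    proof -
      have "Some w \<in> Some ` ?O"
        using S that T(1) connectedin_subset_topspace[OF S(1)] by blast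
      then show ?thesis by auto
    qed
    then show ?thesis
      using connectedin_pieces_no_apex[OF T(2)] xy T(1) by blast
  qed
qed

lemma locally_connected_atD:
  assumes "locally_connected_at x X" "openin X V" "x \<in> V"
  shows "\<exists>U. openin X U \<and> connectedin X U \<and> x \<in> U \<and> U \<subseteq> V"
  using assms unfolding locally_connected_at_def neighbourhood_base_at_def by blast

lemma openin_filter_space_Some:
  "openin (filter_space r J A) (Some ` V) \<longleftrightarrow> openin (pieces_topology r) V"
  unfolding filter_space_def by (rule openin_adjoin_point_Some[OF apex_base])

lemma openin_filter_space_insert_None:
  assumes "openin (pieces_topology r) W" "finite S" "S \<subseteq> A" "apex_nbhd r J n S \<subseteq> W"
  shows "openin (filter_space r J A) (insert None (Some ` W))"
  unfolding filter_space_def using assms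
  by (intro openin_adjoin_point_insert_None[OF apex_base]) (auto simp: apex_base_def)

lemma openin_filter_space_None:
  assumes "openin (filter_space r J A) U" "None \<in> U"
  obtains n S where "finite S" "S \<subseteq> A" "Some ` apex_nbhd r J n S \<subseteq> U"
  using openin_adjoin_point_None[OF apex_base assms[unfolded filter_space_def]] by (auto simp: apex_base_def)

lemma not_locally_connected_at_cell:
  assumes w: "(j, Some c) \<in> pieces r"
  shows "\<not> locally_connected_at (Some (j, Some c)) (filter_space r J A)"
proof
  let ?O = "{w \<in> topspace (pieces_topology r). snd w \<in> Some ` topspace cell_topology}"
  assume lc: "locally_connected_at (Some (j, Some c)) (filter_space r J A)"
  have "openin (pieces_topology r) ?O"
    by (intro openin_continuous_map_preimage[OF continuous_map_pieces_snd] openin_cone_Some openin_topspace)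
  then have "openin (filter_space r J A) (Some ` ?O)" by (simp only: openin_filter_space_Some)
  moreover have "Some (j, Some c) \<in> Some ` ?O" using w by (auto simp: pieces_def piece_def)
  ultimately obtain U where U: "openin (filter_space r J A) U" "connectedin (filter_space r J A) U"
      "Some (j, Some c) \<in> U" "U \<subseteq> Some ` ?O"
    using locally_connected_atD[OF lc] by blast
  then obtain T where T: "U = Some ` T" "connectedin (pieces_topology r) T"
    using connectedin_filter_space_block[OF U(2)] by blast
  have N: "snd v \<noteq> None" if "v \<in> T" for v
    using U(4) that T(1) by auto
  have "(j, Some c) \<in> T" using U(3) T(1) by blast
  then have "T = {(j, Some c)}"
    using connectedin_pieces_no_apex[OF T(2) N] by blast
  then have "openin (pieces_topology r) {(j, Some c)}"
    using U(1) T(1) by (simp only: openin_filter_space_Some)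
  then show False using pieces_not_isolated[OF w] by blast
qed

text \<open>A neighbourhood of the apex contains the centre of the ball in some far positive sheet.
  If it lies where the height exceeds 4, the gap around that ball disconnects it.\<close>

lemma not_locally_connected_at_cone_apex:
  fixes j :: "'k \<times> nat"
  assumes w: "(j, None) \<in> pieces r"
  shows "\<not> locally_connected_at (Some (j, None)) (filter_space r J A)"
proof
  assume lc: "locally_connected_at (Some (j, None)) (filter_space r J A)"
  let ?H = "{c \<in> topspace cell_topology. 4 < cell_height c}"
  let ?V = "{v \<in> topspace (pieces_topology r). snd v \<in> insert None (Some ` ?H)} \<inter> {v \<in> pieces r. fst v \<in> {j}}"
  have "openin cone_topology (insert None (Some ` ?H))"
    unfolding cone_topology_def
  proof (rule openin_adjoin_point_insert_None[OF cone_base])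
    show "openin cell_topology ?H" by (rule openin_superlevel[OF continuous_map_cell_height])
    show "{p \<in> topspace cell_topology. real 4 < cell_height p} \<in> level_base cell_topology cell_height"
      unfolding level_base_def by blast
  qed simp
  then have "openin (pieces_topology r) ?V"
    by (intro openin_Int openin_pieces_block openin_continuous_map_preimage[OF continuous_map_pieces_snd])
  then have "openin (filter_space r J A) (Some ` ?V)" by (simp only: openin_filter_space_Some)
  moreover have "Some (j, None) \<in> Some ` ?V" using w by auto
  ultimately obtain U where U: "openin (filter_space r J A) U" "connectedin (filter_space r J A) U"
      "Some (j, None) \<in> U" "U \<subseteq> Some ` ?V"
    using locally_connected_atD[OF lc] by blast
  then obtain T where T: "U = Some ` T" "connectedin (pieces_topology r) T"
    using connectedin_filter_space_block[OF U(2)] by blast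
  have T_sub: "T \<subseteq> ?V" 
    using U(4) unfolding T(1) by (simp only: inj_image_subset_iff[OF inj_Some])
  have NT: "(j, None) \<in> T"
    using U(3) unfolding T(1) by (simp only: inj_image_mem_iff[OF inj_Some])
  have opT: "openin (pieces_topology r) T"
    using U(1) unfolding T(1) openin_filter_space_Some .
  have j: "fst j \<in> Field r" using w by (auto simp: pieces_def)
  have "openin (piece_topology r (fst j)) {z \<in> topspace (piece_topology r (fst j)). (j, z) \<in> T}"
    by (rule openin_continuous_map_preimage[OF continuous_map_into_pieces[OF j] opT])
  then obtain W where W: "openin cone_topology W" "{z \<in> piece r (fst j). (j, z) \<in> T} = W \<inter> piece r (fst j)"
    unfolding openin_subtopology topspace_piece by blast
  have memW: "z \<in> W \<longleftrightarrow> (j, z) \<in> T" if "z \<in> piece r (fst j)" for z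
  proof -
    have "z \<in> {z \<in> piece r (fst j). (j, z) \<in> T} \<longleftrightarrow> z \<in> W \<inter> piece r (fst j)"
      by (simp only: W(2))
    then show ?thesis using that by simp
  qed
  have "None \<in> W" using NT memW[OF None_in_piece] by simp
  then obtain n where n: "\<And>p. p \<in> erdos \<times> UNIV \<Longrightarrow> real n < cell_height p \<Longrightarrow> Some p \<in> W"
    using openin_cone_None[OF W(1)] by blast
  \<comment> \<open>Large enough for \<open>cone_gap\<close>, and for the centre, of height
    \<open>1 + 2 * k\<close>, to lie in \<open>W\<close>.\<close>
  define k where "k = real n + 3"
  have k: "2 < k" by (simp add: k_def)
  have "test_cell (fst j) k \<in> erdos \<times> UNIV" using zero_in_erdos by (simp add: test_cell_def)
  moreover have "real n < cell_height (test_cell (fst j) k)"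
    using k by (simp add: cell_height_test_cell k_def)
  ultimately have "Some (test_cell (fst j) k) \<in> W" by (rule n)
  then have cT: "(j, Some (test_cell (fst j) k)) \<in> T"
    using memW[OF test_cell_in_piece] by simp
  obtain G1 G2 :: "'k cell option set" where G: "openin cone_topology G1" "openin cone_topology G2" "G1 \<inter> G2 = {}" "None \<in> G2"
    and G1: "\<And>c. c \<in> erdos \<times> UNIV \<Longrightarrow> snd (fst c) = 0 \<and> snd (snd c) = k \<Longrightarrow> Some c \<in> G1"
    and G12: "\<And>c. c \<in> erdos \<times> UNIV \<Longrightarrow> 4 < cell_height c \<Longrightarrow> Some c \<in> G1 \<union> G2"
    using cone_gap[OF k] by blast
  have conn: "connectedin cone_topology (snd ` T)"
    by (rule connectedin_continuous_map_image[OF continuous_map_pieces_snd T(2)])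
  have "snd ` T \<subseteq> G1 \<union> G2"
  proof
    fix z assume "z \<in> snd ` T"
    then obtain v where v: "v \<in> T" "z = snd v" by (elim imageE)
    have "snd v \<in> insert None (Some ` ?H)"
      using subsetD[OF T_sub v(1)] by (elim IntE CollectE conjE)
    then show "z \<in> G1 \<union> G2"
      unfolding v(2) by (elim insertE imageE) (use G(4) G12 in simp_all)
  qed
  moreover have "Some (test_cell (fst j) k) \<in> G1 \<inter> snd ` T"
  proof
    show "Some (test_cell (fst j) k) \<in> G1"
      by (rule G1) (use zero_in_erdos in \<open>simp_all add: test_cell_def\<close>)
    show "Some (test_cell (fst j) k) \<in> snd ` T" using imageI[OF cT, of snd] by simp
  qed
  moreover have "None \<in> G2 \<inter> snd ` T" using imageI[OF NT, of snd] G(4) by simp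
  ultimately show False
    using conn G(1-3) unfolding connectedin by blast
qed

text \<open>In the block \<open>(a, 0)\<close> with \<open>a \<notin> J s\<close>, the neighbourhood
  \<open>?V\<close> consists only of cells of positive depth. Among these each negative sheet is cut
  off from the rest, yet every neighbourhood of \<infinity> reaches into one of these
  sheets.\<close>

lemma not_locally_connected_at_apex:
  assumes s: "s \<in> A" and a: "a \<in> Field r" "a \<notin> J s"
  shows "\<not> locally_connected_at None (filter_space r J A)"
proof
  assume lc: "locally_connected_at None (filter_space r J A)"
  let ?X = "filter_space r J A" and ?j = "(a, 0::nat)" and ?V = "apex_nbhd r J 0 {s}"
  have "openin ?X (insert None (Some ` ?V))"
    using s by (intro openin_filter_space_insert_None[of _ _ "{s}" _ _ 0] openin_apex_nbhd) auto
  then obtain U where U: "openin ?X U" "connectedin ?X U" "None \<in> U" "U \<subseteq> insert None (Some ` ?V)"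
    using locally_connected_atD[OF lc] by blast
  obtain n S where S: "finite S" "S \<subseteq> A" "Some ` apex_nbhd r J n S \<subseteq> U"
    by (rule openin_filter_space_None[OF U(1,3)])
  define k where "k = real n + 1"
  have k0: "0 \<le> k" by (simp add: k_def)
  let ?w = "(?j, Some (test_cell a (- k)))"
  have "?w \<in> pieces r" using a test_cell_in_piece by (auto simp: pieces_def)
  moreover have "real n < cell_depth (test_cell a (- k))"
    using k0 by (simp add: cell_depth_test_cell) (simp add: k_def)
  ultimately have "?w \<in> apex_nbhd r J n S" by (simp add: apex_nbhd_def)
  then have wU: "Some ?w \<in> U" by (intro subsetD[OF S(3)] imageI)
  let ?B = "{v \<in> pieces r. fst v \<in> {?j}}"
  let ?O = "\<lambda>K. {v \<in> topspace (pieces_topology r). snd v \<in> Some ` {c \<in> topspace cell_topology. snd (snd c) \<in> K}}"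
  have O: "openin (pieces_topology r) (?O K)" for K
    by (intro openin_continuous_map_preimage[OF continuous_map_pieces_snd] openin_cone_Some openin_cell_sheet)
  let ?H = "?B \<inter> ?O {- k}"
  let ?G = "(?V \<inter> {v \<in> pieces r. fst v \<in> - {?j}}) \<union> (?V \<inter> ?O (- {- k}))"
  have H: "openin ?X (Some ` ?H)"
    unfolding openin_filter_space_Some by (intro openin_Int openin_pieces_block O)
  \<comment> \<open>The depth in the sheet \<open>- k\<close> is at most \<open>2 * k\<close>, so a
    neighbourhood of \<infinity> at level \<open>m\<close> misses \<open>?H\<close>.\<close>
  obtain m :: nat where m: "2 * k < real m" using reals_Archimedean2 by blast
  have "openin ?X (insert None (Some ` ?G))"
  proof (rule openin_filter_space_insert_None[of _ _ "{s}" _ _ m])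
    show "openin (pieces_topology r) ?G"
      by (intro openin_Int openin_Un openin_pieces_block O openin_apex_nbhd)
    show "apex_nbhd r J m {s} \<subseteq> ?G"
    proof
      fix v assume v: "v \<in> apex_nbhd r J m {s}"
      then have vV: "v \<in> ?V" using apex_nbhd_mono[of 0 m] by blast
      have vp: "v \<in> pieces r" using v by (simp add: apex_nbhd_def)
      show "v \<in> ?G"
      proof (cases "fst v = ?j")
        case True
        then have d: "real m < cone_depth (snd v)" using v a by (auto simp: apex_nbhd_def)
        then obtain c where c: "snd v = Some c" by (cases "snd v") auto
        have ct: "c \<in> topspace cell_topology" using vp c True by (auto simp: pieces_def piece_def)
        have "snd (snd c) \<noteq> - k"
        proof
          assume kk: "snd (snd c) = - k"
          have "0 \<le> snd (fst c)" using ct erdos_snd_nonneg by auto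
          then have "k * max 0 (2 - snd (fst c)) \<le> k * 2"
            by (intro mult_left_mono) (auto simp: k_def)
          then have "cell_depth c \<le> 2 * k" using kk k0 by (simp add: cell_depth_def mult.commute)
          then show False using d m c by simp
        qed
        then show ?thesis using vV vp c ct by auto
      qed (use vV vp in auto)
    qed
  qed (use s in auto)
  moreover have "U \<subseteq> Some ` ?H \<union> insert None (Some ` ?G)"
  proof
    fix z assume "z \<in> U"
    then consider "z = None" | v where "z = Some v" "v \<in> ?V" using U(4) by blast
    then show "z \<in> Some ` ?H \<union> insert None (Some ` ?G)"
    proof cases
      case (2 v)
      have vp: "v \<in> pieces r" using 2 by (simp add: apex_nbhd_def)
      show ?thesis
      proof (cases "fst v = ?j")
        case True
        \<comment> \<open>The apex of this block, which would join the sheets, has depth 0 and is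
          therefore absent.\<close>
        then have d: "0 < cone_depth (snd v)" using 2 a by (auto simp: apex_nbhd_def)
        then obtain c where c: "snd v = Some c" by (cases "snd v") auto
        have ct: "c \<in> topspace cell_topology" using vp c True by (auto simp: pieces_def piece_def)
        then have "v \<in> ?H \<union> ?G" using 2 vp c True by auto
        then show ?thesis using 2 by blast
      next
        case False
        then have "v \<in> ?G" using 2 vp by auto
        then show ?thesis using 2 by blast
      qed
    qed simp
  qed
  moreover have "Some ` ?H \<inter> insert None (Some ` ?G) \<inter> U = {}" by auto
  moreover have "Some ?w \<in> Some ` ?H \<inter> U"
    using wU \<open>?w \<in> pieces r\<close> zero_in_erdos by (auto simp: test_cell_def)
  ultimately show False
    using U(2,3) H unfolding connectedin by blast
qed

lemma nowhere_locally_connected_filter_space: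
  assumes "s \<in> A" "a \<in> Field r" "a \<notin> J s"
  shows "nowhere_locally_connected_space (filter_space r J A)"
  unfolding nowhere_locally_connected_space_def topspace_filter_space
proof
  fix z assume z: "z \<in> insert None (Some ` pieces r)"
  show "\<not> locally_connected_at z (filter_space r J A)"
  proof (cases z)
    case None
    then show ?thesis using not_locally_connected_at_apex assms by metis
  next
    case (Some w)
    then have "w \<in> pieces r" using z by auto
    then show ?thesis
      using not_locally_connected_at_cell not_locally_connected_at_cone_apex Some
      by (metis option.exhaust prod.collapse)
  qed
qed

subsection \<open>Homeomorphisms and weight\<close>

definition block :: "'k rel \<Rightarrow> 'k \<times> nat \<Rightarrow> (('k \<times> nat) \<times> 'k cell option) option set"
  where "block r j = Some ` ({j} \<times> piece r (fst j))"

lemma subtopology_adjoin_point_Some_homeomorphic: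
  assumes "open_filter_base P \<U>" "S \<subseteq> topspace P"
  shows "subtopology P S homeomorphic_space subtopology (adjoin_point P \<U>) (Some ` S)"
proof -
  have "homeomorphic_map P (subtopology (adjoin_point P \<U>) (Some ` topspace P)) Some"
    using embedding_map_Some[OF assms(1)] unfolding embedding_map_def .
  then have "homeomorphic_map (subtopology P S)
      (subtopology (subtopology (adjoin_point P \<U>) (Some ` topspace P)) (Some ` S)) Some"
    by (rule homeomorphic_map_subtopologies) (use assms topspace_adjoin_point[OF assms(1)] in auto)
  moreover have "Some ` topspace P \<inter> Some ` S = Some ` S" using assms(2) by blast
  ultimately show ?thesis
    unfolding subtopology_subtopology using homeomorphic_map_imp_homeomorphic_space by metis
qed

lemma block_subset: "j \<in> Field r \<times> UNIV \<Longrightarrow> {j} \<times> piece r (fst j) \<subseteq> pieces r"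
  by (auto simp: pieces_def)

lemma block_subset_topspace: "j \<in> Field r \<times> UNIV \<Longrightarrow> block r j \<subseteq> topspace (filter_space r J A)"
  unfolding block_def topspace_filter_space using block_subset by blast

lemma piece_homeomorphic_block:
  assumes j: "j \<in> Field r \<times> UNIV"
  shows "piece_topology r (fst j) homeomorphic_space subtopology (filter_space r J A) (block r j)"
proof -
  have "fst j \<in> Field r" using j by auto
  then have "piece_topology r (fst j) homeomorphic_space subtopology (pieces_topology r) ({j} \<times> piece r (fst j))"
    by (rule block_homeomorphic_piece)
  also have "\<dots> homeomorphic_space subtopology (filter_space r J A) (block r j)"
    unfolding filter_space_def block_def
    by (rule subtopology_adjoin_point_Some_homeomorphic[OF apex_base]) (simp add: block_subset[OF j])
  finally show ?thesis .
qed

lemma connectedin_block_filter_space: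
  assumes j: "j \<in> Field r \<times> UNIV"
  shows "connectedin (filter_space r J A) (block r j)"
  unfolding block_def filter_space_def connectedin_adjoin_point_Some[OF apex_base]
  by (rule connectedin_block) (use j in auto)

lemma block_nonempty: "Some (j, None) \<in> block r j"
  unfolding block_def by (intro imageI SigmaI) (simp_all add: None_in_piece)

lemma connectedin_subset_some_block:
  assumes S: "connectedin (filter_space r J A) S" "None \<notin> S" "S \<noteq> {}"
  shows "\<exists>j\<in>Field r \<times> UNIV. S \<subseteq> block r j"
proof -
  obtain T where T: "S = Some ` T" "connectedin (pieces_topology r) T"
    using connectedin_filter_space_block[OF S(1,2)] by blast
  then obtain w where w: "w \<in> T" using S(3) by blast
  have "S \<subseteq> block r (fst w)"
    unfolding T(1) block_def by (rule image_mono[OF connectedin_pieces_subset_block(2)[OF T(2) w]])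
  then show ?thesis by (rule bexI[OF _ connectedin_pieces_subset_block(1)[OF T(2) w]])
qed

text \<open>Connected sets avoiding \<infinity> lie in single blocks, so \<open>h\<close> maps a
  block into a block and \<open>g\<close> maps the latter back into the original one. Hence the
  image is a full block, and the rank invariant identifies its index.\<close>

lemma homeomorphic_map_block:
  assumes hom: "homeomorphic_maps (filter_space r J A) (filter_space r J B) h g" and N: "h None = None"
    and r: "Well_order r" and j: "j \<in> Field r \<times> UNIV"
  shows "\<exists>j'\<in>Field r \<times> UNIV. h ` block r j = block r j' \<and> fst j' = fst j"
proof -
  let ?X = "filter_space r J A" and ?Y = "filter_space r J B"
  have h: "homeomorphic_map ?X ?Y h" and g: "homeomorphic_map ?Y ?X g"
    and gh: "\<And>x. x \<in> topspace ?X \<Longrightarrow> g (h x) = x" and hg: "\<And>y. y \<in> topspace ?Y \<Longrightarrow> h (g y) = y"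
    using hom homeomorphic_maps_map by metis+
  have NX: "None \<in> topspace ?X" by (simp add: topspace_filter_space)
  have gN: "g None = None" using gh[OF NX] N by simp
  have into: "\<exists>j'\<in>Field r \<times> UNIV. h ` block r j \<subseteq> block r j'" if j: "j \<in> Field r \<times> UNIV" for j
  proof (rule connectedin_subset_some_block)
    show "connectedin ?Y (h ` block r j)"
      using homeomorphic_map_connectedness[OF h block_subset_topspace[OF j]] connectedin_block_filter_space[OF j] by blast
    show "None \<notin> h ` block r j"
    proof
      assume "None \<in> h ` block r j"
      then obtain x where x: "x \<in> block r j" "h x = None" by (metis imageE)
      have "g (h x) = x" by (rule gh[OF subsetD[OF block_subset_topspace[OF j] x(1)]])
      then have "x = None" using x(2) gN by simp
      then show False using x(1) by (auto simp: block_def)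
    qed
  qed (use block_nonempty in blast)
  have back_into: "\<exists>j'\<in>Field r \<times> UNIV. g ` block r j \<subseteq> block r j'" if j: "j \<in> Field r \<times> UNIV" for j
  proof (rule connectedin_subset_some_block)
    show "connectedin ?X (g ` block r j)"
      using homeomorphic_map_connectedness[OF g block_subset_topspace[OF j]] connectedin_block_filter_space[OF j] by blast
    show "None \<notin> g ` block r j"
    proof
      assume "None \<in> g ` block r j"
      then obtain x where x: "x \<in> block r j" "g x = None" by (metis imageE)
      have "h (g x) = x" by (rule hg[OF subsetD[OF block_subset_topspace[OF j] x(1)]])
      then have "x = None" using x(2) N by simp
      then show False using x(1) by (auto simp: block_def)
    qed
  qed (use block_nonempty in blast)
  obtain j' where j': "j' \<in> Field r \<times> UNIV" "h ` block r j \<subseteq> block r j'" using into[OF j] by blast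
  obtain i where i: "i \<in> Field r \<times> UNIV" "g ` block r j' \<subseteq> block r i" using back_into[OF j'(1)] by blast
  have "g (h (Some (j, None))) = Some (j, None)"
    by (rule gh[OF subsetD[OF block_subset_topspace[OF j] block_nonempty]])
  moreover have "g (h (Some (j, None))) \<in> block r i"
    by (rule subsetD[OF i(2) imageI[OF subsetD[OF j'(2) imageI[OF block_nonempty]]]])
  ultimately have "Some (j, None) \<in> block r i" by simp
  then have "i = j" by (auto simp: block_def)
  have "block r j' \<subseteq> h ` block r j"
  proof
    fix y assume y: "y \<in> block r j'"
    have "h (g y) = y" by (rule hg[OF subsetD[OF block_subset_topspace[OF j'(1)] y]])
    moreover have "g y \<in> block r j" using subsetD[OF i(2) imageI[OF y]] \<open>i = j\<close> by simp
    ultimately show "y \<in> h ` block r j" using imageI[of "g y" "block r j" h] by simp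
  qed
  then have eq: "h ` block r j = block r j'" using j'(2) by blast
  have "homeomorphic_map (subtopology ?X (block r j)) (subtopology ?Y (block r j')) h"
    by (rule homeomorphic_map_subtopologies[OF h])
      (use eq block_subset_topspace[OF j, of J A] block_subset_topspace[OF j'(1), of J B] in \<open>simp add: Int_absorb1\<close>)
  then have "subtopology ?X (block r j) homeomorphic_space subtopology ?Y (block r j')"
    by (rule homeomorphic_map_imp_homeomorphic_space)
  then have "piece_topology r (fst j) homeomorphic_space piece_topology r (fst j')"
    using piece_homeomorphic_block[OF j, of J A] piece_homeomorphic_block[OF j'(1), of J B]
      homeomorphic_space_sym homeomorphic_space_trans by meson
  then have "fst j = fst j'"
    by (rule piece_homeomorphic_imp_eq[OF r, rotated 2]) (use j j'(1) in auto)
  then show ?thesis using eq j'(1) by auto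
qed

text \<open>Each member of a local base contains a basic neighbourhood with only finitely many
  constraints. If it lies inside the neighbourhood given by \<open>s\<close>, independence forces
  \<open>s\<close> to be among these. So the infinite set \<open>A\<close> is covered by finite sets
  indexed by base members, of which there are then at least as many.\<close>

lemma card_of_apex_local_base:
  assumes ind: "independent_family (Field r) J I" and A: "A \<subseteq> I" "infinite A"
    and B: "\<And>U. openin (filter_space r J A) U \<Longrightarrow> None \<in> U \<Longrightarrow>
      \<exists>V\<in>\<B>. openin (filter_space r J A) V \<and> None \<in> V \<and> V \<subseteq> U"
  shows "|A| \<le>o |\<B>|"
proof -
  let ?X = "filter_space r J A"
  have "\<exists>V\<in>\<B>. openin ?X V \<and> None \<in> V \<and> V \<subseteq> insert None (Some ` apex_nbhd r J 0 {s})" if "s \<in> A" for s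
    using that by (intro B openin_filter_space_insert_None[of _ _ "{s}" _ _ 0] openin_apex_nbhd) auto
  then obtain V where V: "\<And>s. s \<in> A \<Longrightarrow> V s \<in> \<B> \<and> openin ?X (V s) \<and> None \<in> V s \<and>
      V s \<subseteq> insert None (Some ` apex_nbhd r J 0 {s})"
    by metis
  have "\<exists>S n. finite S \<and> S \<subseteq> A \<and> Some ` apex_nbhd r J n S \<subseteq> W" if "W \<in> V ` A" for W
    using that V openin_filter_space_None by (metis imageE)
  then obtain S where S: "\<And>W. W \<in> V ` A \<Longrightarrow> finite (S W) \<and> S W \<subseteq> A \<and> (\<exists>n. Some ` apex_nbhd r J n (S W) \<subseteq> W)"
    by metis
  have mem: "s \<in> S (V s)" if s: "s \<in> A" for s
  proof (rule ccontr)
    assume "s \<notin> S (V s)"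
    have SV: "finite (S (V s))" "S (V s) \<subseteq> A" "\<exists>n. Some ` apex_nbhd r J n (S (V s)) \<subseteq> V s"
      using S[OF imageI[OF s]] by simp_all
    have "S (V s) \<subseteq> I" "s \<in> I - S (V s)" using SV(2) A(1) s \<open>s \<notin> S (V s)\<close> by auto
    then obtain a where a: "a \<in> Field r" "\<forall>t\<in>S (V s). a \<in> J t" "a \<notin> J s"
      using ind SV(1) unfolding independent_family_def by meson
    obtain n where n: "Some ` apex_nbhd r J n (S (V s)) \<subseteq> V s" using SV(3) by blast
    \<comment> \<open>A cone apex has depth 0, so it belongs to a neighbourhood only through its
      index; this makes it a test for the filter.\<close>
    have "((a, n), None) \<in> apex_nbhd r J n (S (V s))"
      using a(1,2) None_in_piece by (auto simp: apex_nbhd_def pieces_def)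
    then have "Some ((a, n), None) \<in> insert None (Some ` apex_nbhd r J 0 {s})"
      using n V[OF s] by blast
    then have "((a, n), None :: 'a cell option) \<in> apex_nbhd r J 0 {s}" by auto
    then show False using a(3) by (simp add: apex_nbhd_def)
  qed
  have sub: "A \<subseteq> (\<Union>W\<in>V ` A. S W)" using mem by blast
  have inf: "infinite (V ` A)"
  proof
    assume "finite (V ` A)"
    then have "finite (\<Union>W\<in>V ` A. S W)" using S by blast
    then show False using sub A(2) finite_subset by blast
  qed
  have "|\<Union>W\<in>V ` A. S W| \<le>o |V ` A|"
  proof (rule card_of_UNION_ordLeq_infinite[OF inf])
    show "|V ` A| \<le>o |V ` A|" by (rule ordLeq_refl[OF card_of_Card_order])
    show "\<forall>W\<in>V ` A. |S W| \<le>o |V ` A|"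
    proof
      fix W assume "W \<in> V ` A"
      then have "finite (S W)" using S by blast
      then show "|S W| \<le>o |V ` A|"
        using inf by (meson card_of_Well_order finite_ordLess_infinite Field_card_of ordLess_imp_ordLeq card_of_ordLeq_finite ordLeq_total)
    qed
  qed
  then have "|A| \<le>o |V ` A|" using card_of_mono1[OF sub] ordLeq_transitive by blast
  moreover have "V ` A \<subseteq> \<B>" using V by blast
  ultimately show ?thesis using card_of_mono1 ordLeq_transitive by blast
qed

lemma apex_not_first_countable:
  assumes ind: "independent_family (Field r) J I" and A: "A \<subseteq> I" "uncountable A"
    and B: "countable \<B>" "\<And>U. openin (filter_space r J A) U \<Longrightarrow> None \<in> U \<Longrightarrow>
      \<exists>V\<in>\<B>. openin (filter_space r J A) V \<and> None \<in> V \<and> V \<subseteq> U"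
  shows False
proof -
  have "|A| \<le>o |\<B>|"
    using card_of_apex_local_base[OF ind A(1) _ B(2)] A(2) countable_finite by blast
  then obtain f where f: "inj_on f A" "f ` A \<subseteq> \<B>"
    unfolding card_of_ordLeq[symmetric] by blast
  have "countable (f ` A)" using f(2) B(1) by (rule countable_subset)
  then have "countable A" using f(1) by (rule countable_image_inj_on)
  then show False using A(2) by blast
qed

text \<open>Every other point lies in the open metrizable subspace and has a countable local base,
  which could be pulled back along \<open>h\<close> to \<infinity>.\<close>

lemma homeomorphic_map_fixes_apex:
  assumes ind: "independent_family (Field r) J I" and A: "A \<subseteq> I" "uncountable A"
    and h: "homeomorphic_map (filter_space r J A) (filter_space r J B) h"
  shows "h None = None"
proof (rule ccontr)
  let ?X = "filter_space r J A" and ?Y = "filter_space r J B"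
  assume "h None \<noteq> None"
  then obtain w where w: "h None = Some w" by blast
  have surj: "h ` topspace ?X = topspace ?Y" and inj: "inj_on h (topspace ?X)"
    using h homeomorphic_imp_surjective_map homeomorphic_imp_injective_map by blast+
  have NX: "None \<in> topspace ?X" by (simp add: topspace_filter_space)
  have "Some w \<in> topspace ?Y" using surj NX w by (metis imageI)
  then have "w \<in> topspace (pieces_topology r)" by (auto simp: topspace_filter_space)
  then obtain \<B> where B: "countable \<B>" "\<And>V. V \<in> \<B> \<Longrightarrow> openin (pieces_topology r) V"
    "\<And>U. openin (pieces_topology r) U \<Longrightarrow> w \<in> U \<Longrightarrow> \<exists>V\<in>\<B>. w \<in> V \<and> V \<subseteq> U"
    using metrizable_imp_first_countable[OF metrizable_pieces_topology] unfolding first_countable_def by metis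
  let ?pre = "\<lambda>V. {x \<in> topspace ?X. h x \<in> Some ` V}"
  have "\<exists>V\<in>?pre ` \<B>. openin ?X V \<and> None \<in> V \<and> V \<subseteq> U" if U: "openin ?X U" "None \<in> U" for U
  proof -
    have UX: "U \<subseteq> topspace ?X" using U(1) by (rule openin_subset)
    have "openin ?Y (h ` U)" using homeomorphic_map_openness_eq[OF h] U(1) by blast
    then have "openin (pieces_topology r) {v. Some v \<in> h ` U}"
      unfolding filter_space_def by (rule openin_adjoin_point_vimage[OF apex_base])
    moreover have "w \<in> {v. Some v \<in> h ` U}" using w U(2) by (metis imageI mem_Collect_eq)
    ultimately obtain V where V: "V \<in> \<B>" "w \<in> V" "V \<subseteq> {v. Some v \<in> h ` U}" using B(3) by meson
    have "openin ?Y (Some ` V)" using B(2)[OF V(1)] by (simp only: openin_filter_space_Some)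
    then have "openin ?X (?pre V)"
      by (rule openin_continuous_map_preimage[OF homeomorphic_imp_continuous_map[OF h]])
    moreover have "None \<in> ?pre V" using NX w V(2) by auto
    moreover have "?pre V \<subseteq> U"
    proof
      fix x assume x: "x \<in> ?pre V"
      then obtain v where "h x = Some v" "v \<in> V" by blast
      then have "h x \<in> h ` U" using subsetD[OF V(3)] by simp
      then obtain u where u: "u \<in> U" "h x = h u" by (elim imageE)
      have "x = u" using inj_onD[OF inj u(2)] x subsetD[OF UX u(1)] by simp
      then show "x \<in> U" using u(1) by simp
    qed
    ultimately show ?thesis using V(1) by blast
  qed
  then show False
    using apex_not_first_countable[OF ind A, of "?pre ` \<B>"] B(1) by blast
qed

text \<open>The image of the neighbourhood given by \<open>s\<close> contains all blocks of high
  copy number with index in a finite intersection of sets from \<open>B\<close>. Independence yields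
  such an index outside \<open>J s\<close>; the block over it is carried back to one with the same
  index, which cannot lie in the original neighbourhood.\<close>

lemma filter_space_not_homeomorphic:
  assumes ind: "independent_family (Field r) J I" and r: "Well_order r"
    and A: "A \<subseteq> I" "uncountable A" and B: "B \<subseteq> I" and s: "s \<in> A" "s \<notin> B"
  shows "\<not> filter_space r J A homeomorphic_space filter_space r J B"
proof
  let ?X = "filter_space r J A" and ?Y = "filter_space r J B"
  assume "?X homeomorphic_space ?Y"
  then obtain h g where hom: "homeomorphic_maps ?X ?Y h g" unfolding homeomorphic_space_def by blast
  then have h: "homeomorphic_map ?X ?Y h" and gh: "\<And>x. x \<in> topspace ?X \<Longrightarrow> g (h x) = x"
    using homeomorphic_maps_map by metis+
  have hN: "h None = None" by (rule homeomorphic_map_fixes_apex[OF ind A h])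
  have gN: "g None = None" using gh[of None] hN by (simp add: topspace_filter_space)
  let ?O = "insert None (Some ` apex_nbhd r J 0 {s})"
  have O: "openin ?X ?O"
    using s(1) by (intro openin_filter_space_insert_None[of _ _ "{s}" _ _ 0] openin_apex_nbhd) auto
  have "openin ?Y (h ` ?O)" using homeomorphic_map_openness_eq[OF h] O by blast
  moreover have "None \<in> h ` ?O" using hN by (metis imageI insertI1)
  ultimately obtain n S where S: "finite S" "S \<subseteq> B" "Some ` apex_nbhd r J n S \<subseteq> h ` ?O"
    by (rule openin_filter_space_None)
  have "S \<subseteq> I" "s \<in> I - S" using S(2) B A(1) s by auto
  then obtain a where a: "a \<in> Field r" "\<forall>t\<in>S. a \<in> J t" "a \<notin> J s"
    using ind S(1) unfolding independent_family_def by meson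
  let ?j = "(a, n)"
  have j: "?j \<in> Field r \<times> UNIV" using a(1) by simp
  have homg: "homeomorphic_maps ?Y ?X g h" using hom homeomorphic_maps_sym by blast
  obtain j' where j': "j' \<in> Field r \<times> UNIV" "g ` block r ?j = block r j'" "fst j' = a"
    using homeomorphic_map_block[OF homg gN r j] by auto
  have "{?j} \<times> piece r a \<subseteq> apex_nbhd r J n S"
    using a(1,2) by (auto simp: apex_nbhd_def pieces_def)
  then have "block r ?j \<subseteq> h ` ?O" using S(3) unfolding block_def by auto
  moreover have "?O \<subseteq> topspace ?X" by (rule openin_subset[OF O])
  ultimately have "g ` block r ?j \<subseteq> ?O" using gh by (smt (verit) image_iff image_subset_iff subset_iff)
  then have "Some (j', None) \<in> ?O" using j'(2) block_nonempty by blast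
  then have "(j', None :: 'a cell option) \<in> apex_nbhd r J 0 {s}" by auto
  then show False using a(3) j'(3) by (simp add: apex_nbhd_def)
qed

lemma base_of_iff:
  "base_of B X \<longleftrightarrow> (\<forall>V\<in>B. openin X V) \<and> (\<forall>U x. openin X U \<and> x \<in> U \<longrightarrow> (\<exists>V\<in>B. x \<in> V \<and> V \<subseteq> U))"
  unfolding base_of_def openin_topology_base_unique by blast

lemma weight_filter_space_ge:
  assumes "independent_family (Field r) J I" "A \<subseteq> I" "infinite A" "base_of B (filter_space r J A)"
  shows "|A| \<le>o |B|"
  using card_of_apex_local_base[OF assms(1-3), of B] assms(4) unfolding base_of_iff by blast

subsection \<open>Cardinalities\<close>

lemma base_of_homeomorphic_image:
  assumes h: "homeomorphic_map X Y h" and B: "base_of B X"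
  shows "base_of ((`) h ` B) Y"
  unfolding base_of_iff
proof (intro conjI allI impI ballI)
  fix V assume "V \<in> (`) h ` B"
  then show "openin Y V"
    using B homeomorphic_map_openness_eq[OF h] unfolding base_of_iff by blast
next
  fix U y assume U: "openin Y U \<and> y \<in> U"
  let ?U = "{x \<in> topspace X. h x \<in> U}"
  have op: "openin X ?U"
    using openin_continuous_map_preimage[OF homeomorphic_imp_continuous_map[OF h]] U by blast
  have "y \<in> h ` topspace X"
    using U openin_subset homeomorphic_imp_surjective_map[OF h] by blast
  then obtain x where x: "x \<in> topspace X" "y = h x" by blast
  then have "x \<in> ?U" using U by blast
  then obtain V where V: "V \<in> B" "x \<in> V" "V \<subseteq> ?U" using op B unfolding base_of_iff by meson
  then show "\<exists>V\<in>(`) h ` B. y \<in> V \<and> V \<subseteq> U" using x(2) by blast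
qed

lemma has_weightI:
  assumes B: "base_of B X" "|B| \<le>o r" and le: "\<And>B. base_of B X \<Longrightarrow> r \<le>o |B|"
  shows "has_weight X r"
proof -
  have "|B| =o r" using B(2) le[OF B(1)] by (simp add: ordIso_iff_ordLeq)
  then show ?thesis unfolding has_weight_def using B(1) le by blast
qed

lemma has_weight_homeomorphic:
  assumes h: "homeomorphic_map X Y h" and w: "has_weight Y r"
  shows "has_weight X r"
proof -
  obtain g where hg: "homeomorphic_maps X Y h g" using h homeomorphic_map_maps by blast
  then have g: "homeomorphic_map Y X g" using homeomorphic_maps_map by blast
  obtain B where B: "base_of B Y" "|B| =o r" using w unfolding has_weight_def by blast
  show ?thesis
  proof (rule has_weightI)
    show "base_of ((`) g ` B) X" by (rule base_of_homeomorphic_image[OF g B(1)])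
    show "|(`) g ` B| \<le>o r" using card_of_image B(2) ordLeq_ordIso_trans by blast
    fix C assume "base_of C X"
    then have "r \<le>o |(`) h ` C|"
      using w base_of_homeomorphic_image[OF h] unfolding has_weight_def by blast
    then show "r \<le>o |C|" using card_of_image ordLeq_transitive by blast
  qed
qed

lemma totally_pathwise_disconnected_homeomorphic:
  assumes h: "homeomorphic_map X Y h" and Y: "totally_pathwise_disconnected_space Y"
  shows "totally_pathwise_disconnected_space X"
  unfolding totally_pathwise_disconnected_space_def
proof (intro allI impI)
  fix g assume g: "pathin X g"
  then have "pathin Y (h \<circ> g)"
    using homeomorphic_imp_continuous_map[OF h] pathin_compose by blast
  then obtain c where c: "\<And>t. t \<in> {0..1} \<Longrightarrow> h (g t) = c"
    using Y unfolding totally_pathwise_disconnected_space_def by fastforce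
  have top: "g t \<in> topspace X" if "t \<in> {0..1}" for t
    using g that by (auto simp: pathin_def continuous_map_def)
  have "g t = g 0" if "t \<in> {0..1}" for t
    using inj_onD[OF homeomorphic_imp_injective_map[OF h], of "g t" "g 0"] c[OF that] c[of 0] top that
    by simp
  then show "\<exists>c. \<forall>t\<in>{0..1}. g t = c" by blast
qed

lemma nowhere_locally_connected_homeomorphic:
  assumes h: "homeomorphic_map X Y h" and Y: "nowhere_locally_connected_space Y"
  shows "nowhere_locally_connected_space X"
  unfolding nowhere_locally_connected_space_def
proof (intro ballI notI)
  fix x assume x: "x \<in> topspace X" and lc: "locally_connected_at x X"
  have "locally_connected_at (h x) Y"
    unfolding locally_connected_at_def neighbourhood_base_at_def
  proof (intro allI impI)
    fix W assume W: "openin Y W \<and> h x \<in> W"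
    let ?W = "{x \<in> topspace X. h x \<in> W}"
    have "openin X ?W"
      using openin_continuous_map_preimage[OF homeomorphic_imp_continuous_map[OF h]] W by blast
    then obtain U where U: "openin X U" "connectedin X U" "x \<in> U" "U \<subseteq> ?W"
      using locally_connected_atD[OF lc] x W by blast
    have "openin Y (h ` U)" using homeomorphic_map_openness_eq[OF h] U(1) by blast
    moreover have "connectedin Y (h ` U)"
      using homeomorphic_map_connectedness[OF h openin_subset[OF U(1)]] U(2) by blast
    ultimately show "\<exists>U V. openin Y U \<and> (openin Y V \<and> connectedin Y V) \<and> h x \<in> U \<and> U \<subseteq> V \<and> V \<subseteq> W"
      using U(3,4) by (intro exI[of _ "h ` U"]) blast
  qed
  moreover have "h x \<in> topspace Y"
    using x homeomorphic_imp_surjective_map[OF h] by blast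
  ultimately show False using Y unfolding nowhere_locally_connected_space_def by blast
qed

lemma almost_metrizable_homeomorphic:
  assumes h: "homeomorphic_map X Y h" and Y: "almost_metrizable_space Y"
  shows "almost_metrizable_space X"
proof -
  have XY: "X homeomorphic_space Y" using h by (rule homeomorphic_map_imp_homeomorphic_space)
  have surj: "h ` topspace X = topspace Y" and inj: "inj_on h (topspace X)"
    using h homeomorphic_imp_surjective_map homeomorphic_imp_injective_map by blast+
  have cont: "continuous_map X Y h" by (rule homeomorphic_imp_continuous_map[OF h])
  have pn: "perfectly_normal_space Y" using Y unfolding almost_metrizable_space_def by blast
  have "gdelta_in X C" if C: "closedin X C" for C
  proof -
    have CX: "C \<subseteq> topspace X" using C by (rule closedin_subset)
    have "closedin Y (h ` C)" using homeomorphic_map_closedness_eq[OF h] C by blast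
    then have "gdelta_in Y (h ` C)" using pn unfolding perfectly_normal_space_def by blast
    then obtain D :: "nat \<Rightarrow> 'b set" where D: "\<And>n. openin Y (D n)" "\<Inter> (range D) = h ` C"
      unfolding gdelta_in_descending by meson
    have "C = {x \<in> topspace X. h x \<in> h ` C}"
      using CX inj by (auto dest: inj_onD)
    also have "\<dots> = \<Inter> (range (\<lambda>n. {x \<in> topspace X. h x \<in> D n}))"
      unfolding D(2)[symmetric] by auto
    finally have "C = \<Inter> (range (\<lambda>n. {x \<in> topspace X. h x \<in> D n}))" .
    moreover have "gdelta_in X (\<Inter> (range (\<lambda>n. {x \<in> topspace X. h x \<in> D n})))"
      by (rule gdelta_in_Inter)
        (auto intro: open_imp_gdelta_in openin_continuous_map_preimage[OF cont D(1)])
    ultimately show ?thesis by simp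
  qed
  then have "perfectly_normal_space X"
    using pn homeomorphic_normal_space[OF XY] homeomorphic_Hausdorff_space[OF XY]
    unfolding perfectly_normal_space_def by blast
  moreover obtain y where y: "y \<in> topspace Y" "metrizable_space (subtopology Y (topspace Y - {y}))"
    using Y unfolding almost_metrizable_space_def by blast
  have "y \<in> h ` topspace X" using y(1) surj by simp
  then obtain x where x: "x \<in> topspace X" "h x = y" by blast
  have "h ` (topspace X - {x}) = topspace Y - {y}"
    using surj x inj_on_image_set_diff[OF inj, of "topspace X" "{x}"] by auto
  then have "homeomorphic_map (subtopology X (topspace X - {x})) (subtopology Y (topspace Y - {y})) h"
    by (intro homeomorphic_map_subtopologies[OF h]) (simp add: Int_absorb1)
  then have "metrizable_space (subtopology X (topspace X - {x}))"
    using homeomorphic_metrizable_space homeomorphic_map_imp_homeomorphic_space y(2) by blast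
  ultimately show ?thesis unfolding almost_metrizable_space_def using x(1) by blast
qed

section \<open>Cardinal bounds and the independent family\<close>

lemma card_of_nat_sets: "|UNIV :: nat set set| =o continuum"
proof -
  have "|Pow (UNIV :: nat set)| =o |Func (UNIV :: nat set) (UNIV :: bool set)|"
    by (rule card_of_Pow_Func)
  then show ?thesis by (simp add: cexp_def ctwo_def Field_natLeq Field_card_of)
qed

lemma card_of_le_continuum:
  assumes "inj_on (f :: 'a \<Rightarrow> 'b::countable set) A"
  shows "|A| \<le>o continuum"
proof -
  have "inj_on (\<lambda>x. to_nat ` f x) A"
    using assms by (auto simp: inj_on_def inj_image_eq_iff[OF inj_to_nat])
  then have "|A| \<le>o |UNIV :: nat set set|"
    unfolding card_of_ordLeq[symmetric] by blast
  then show ?thesis using card_of_nat_sets ordLeq_ordIso_trans by blast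
qed

lemma rat_cut_inj: "{q::rat. of_rat q < (x::real)} = {q. of_rat q < y} \<Longrightarrow> x = y"
proof (rule ccontr)
  assume eq: "{q::rat. of_rat q < x} = {q. of_rat q < y}" and "x \<noteq> y"
  then consider "x < y" | "y < x" by linarith
  then show False
  proof cases
    case 1
    then obtain q :: rat where "x < of_rat q" "of_rat q < y" using of_rat_dense by blast
    then show False using eq by (metis less_asym mem_Collect_eq)
  next
    case 2
    then obtain q :: rat where "y < of_rat q" "of_rat q < x" using of_rat_dense by blast
    then show False using eq by (metis less_asym mem_Collect_eq)
  qed
qed

lemma card_of_real_le_continuum: "|A :: real set| \<le>o continuum"
  by (rule card_of_le_continuum[of "\<lambda>x. {q::rat. of_rat q < x}"]) (auto intro: inj_onI rat_cut_inj)

lemma card_of_erdos_le_continuum: "|erdos| \<le>o continuum"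
proof (rule card_of_le_continuum)
  \<comment> \<open>Countably many Dedekind cuts in one set: tag \<open>None\<close> for the sum,
    \<open>Some i\<close> for coordinate \<open>i\<close>.\<close>
  let ?f = "\<lambda>p :: (nat \<Rightarrow> real) \<times> real. {(n, q::rat). of_rat q < (case n of None \<Rightarrow> snd p | Some i \<Rightarrow> fst p i)}"
  show "inj_on ?f erdos"
  proof (rule inj_onI)
    fix p p' assume eq: "?f p = ?f p'"
    have eq': "of_rat q < (case n of None \<Rightarrow> snd p | Some i \<Rightarrow> fst p i) \<longleftrightarrow>
        of_rat q < (case n of None \<Rightarrow> snd p' | Some i \<Rightarrow> fst p' i)" for n and q :: rat
      using eq by (simp add: set_eq_iff)
    have "snd p = snd p'" using eq'[of _ None] by (intro rat_cut_inj) simp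
    moreover have "fst p i = fst p' i" for i using eq'[of _ "Some i"] by (intro rat_cut_inj) simp
    then have "fst p = fst p'" by (rule ext)
    ultimately show "p = p'" by (rule prod_eqI[rotated])
  qed
qed

context
  fixes r :: "'k rel"
  assumes r: "Cinfinite r"
begin

lemma card_of_Times_bound: "|A| \<le>o r \<Longrightarrow> |B| \<le>o r \<Longrightarrow> |A \<times> B| \<le>o r"
  using card_of_Times_ordLeq_infinite_Field r unfolding cinfinite_def by blast

lemma countable_bound: "countable A \<Longrightarrow> |A| \<le>o r"
proof -
  assume "countable A"
  then have "|A| \<le>o |UNIV :: nat set|"
    unfolding card_of_ordLeq[symmetric] countable_def by blast
  moreover have "|UNIV :: nat set| \<le>o r"
    using natLeq_ordLeq_cinfinite[OF r] card_of_nat ordIso_ordLeq_trans by blast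
  ultimately show ?thesis by (rule ordLeq_transitive)
qed

lemma image_bound: "|A| \<le>o r \<Longrightarrow> |f ` A| \<le>o r"
  using card_of_image ordLeq_transitive by blast

lemma subset_bound: "A \<subseteq> B \<Longrightarrow> |B| \<le>o r \<Longrightarrow> |A| \<le>o r"
  using card_of_mono1 ordLeq_transitive by blast

lemma lists_bound:
  assumes B: "|B| \<le>o r"
  shows "|lists B| \<le>o r"
proof -
  have len: "|{xs \<in> lists B. length xs = n}| \<le>o r" for n
  proof (induction n)
    case 0
    have "countable {xs \<in> lists B. length xs = 0}" by (rule countable_subset[of _ "{[]}"]) auto
    then show ?case by (rule countable_bound)
  next
    case (Suc n)
    have "{xs \<in> lists B. length xs = Suc n} \<subseteq> (\<lambda>(x, xs). x # xs) ` (B \<times> {xs \<in> lists B. length xs = n})"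
    proof
      fix xs assume "xs \<in> {xs \<in> lists B. length xs = Suc n}"
      then show "xs \<in> (\<lambda>(x, xs). x # xs) ` (B \<times> {xs \<in> lists B. length xs = n})"
        by (cases xs) auto
    qed
    then show ?case by (rule subset_bound[OF _ image_bound[OF card_of_Times_bound[OF B Suc]]])
  qed
  have "lists B = (\<Union>n. {xs \<in> lists B. length xs = n})" by auto
  moreover have "|\<Union>n. {xs \<in> lists B. length xs = n}| \<le>o r"
    using len by (intro UNION_Cinfinite_bound countable_bound r) auto
  ultimately show ?thesis by simp
qed

lemma Fpow_bound:
  assumes B: "|B| \<le>o r"
  shows "|Fpow B| \<le>o r"
proof (rule subset_bound[OF _ image_bound[OF lists_bound[OF B]]])
  show "Fpow B \<subseteq> set ` lists B"
  proof
    fix S assume "S \<in> Fpow B"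
    then have "finite S" "S \<subseteq> B" by (auto simp: Fpow_def)
    then obtain xs where "set xs = S" using finite_list by blast
    then show "S \<in> set ` lists B" using \<open>S \<subseteq> B\<close> by (auto simp: lists_eq_set)
  qed
qed

text \<open>The construction of Fichtenholz, Kantorovich and Hausdorff.\<close>

lemma independent_family_exists:
  assumes I: "|I| \<le>o ctwo ^c r"
  shows "\<exists>J. independent_family (Field r) J I"
proof -
  let ?K = "Field r" and ?D = "Fpow (Field r) \<times> Fpow (Fpow (Field r))"
  have K: "|?K| =o r" using r card_of_Field_ordIso by blast
  have "|Pow ?K| =o ctwo ^c r"
    unfolding cexp_def ctwo_def Field_card_of by (rule card_of_Pow_Func)
  then have "|I| \<le>o |Pow ?K|" using I ordIso_symmetric ordLeq_ordIso_trans by blast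
  then obtain e where e: "inj_on e I" "e ` I \<subseteq> Pow ?K"
    unfolding card_of_ordLeq[symmetric] by blast
  have "|?K| \<le>o r" using K ordIso_iff_ordLeq by blast
  then have "|?D| \<le>o r" by (intro card_of_Times_bound Fpow_bound)
  then have "|?D| \<le>o |?K|" using K ordIso_symmetric ordLeq_ordIso_trans by blast
  then obtain p where p: "inj_on p ?D" "p ` ?D \<subseteq> ?K"
    unfolding card_of_ordLeq[symmetric] by blast
  \<comment> \<open>The index \<open>i\<close> stands for the subset \<open>e i\<close> of the
    field. \<open>J i\<close> holds the codes of the pairs whose finite list \<open>T\<close> of
    patterns includes the trace of \<open>e i\<close> on the finite set \<open>s\<close>.\<close>
  define J where "J i = p ` {(s, T) \<in> ?D. e i \<inter> s \<in> T}" for i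
  have "independent_family ?K J I"
    unfolding independent_family_def
  proof (intro allI impI)
    fix S i assume S: "finite S \<and> S \<subseteq> I \<and> i \<in> I - S"
    have "\<exists>x. x \<in> ?K \<and> (x \<in> e t \<longleftrightarrow> x \<notin> e i)" if "t \<in> S" for t
    proof -
      have ti: "t \<in> I" "i \<in> I" "t \<noteq> i" using S that by auto
      then have "e t \<noteq> e i" using e(1) by (metis inj_onD)
      moreover have "e t \<subseteq> ?K" "e i \<subseteq> ?K" using e(2) ti by auto
      ultimately show ?thesis by blast
    qed
    then obtain x where x: "\<And>t. t \<in> S \<Longrightarrow> x t \<in> ?K \<and> (x t \<in> e t \<longleftrightarrow> x t \<notin> e i)" by metis
    \<comment> \<open>On these finitely many witnesses the trace of \<open>e i\<close> differs from
      that of each \<open>e t\<close>. Letting \<open>T\<close> consist of the latter traces accepts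
      every \<open>t\<close> in \<open>S\<close> and rejects \<open>i\<close>.\<close>
    define s where "s = x ` S"
    define T where "T = (\<lambda>t. e t \<inter> s) ` S"
    have s: "s \<in> Fpow ?K" using x S by (auto simp: s_def Fpow_def)
    moreover have "T \<in> Fpow (Fpow ?K)"
      using s S by (auto simp: T_def Fpow_def)
    ultimately have D: "(s, T) \<in> ?D" by blast
    have iT: "e i \<inter> s \<notin> T"
    proof
      assume "e i \<inter> s \<in> T"
      then obtain t where t: "t \<in> S" "e i \<inter> s = e t \<inter> s" by (auto simp: T_def)
      have "x t \<in> s" using t(1) by (simp add: s_def)
      then show False using x[OF t(1)] t(2) by blast
    qed
    have "p (s, T) \<in> J t" if "t \<in> S" for t
      unfolding J_def using D that by (intro imageI) (auto simp: T_def)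
    moreover have "p (s, T) \<notin> J i"
    proof
      assume "p (s, T) \<in> J i"
      then obtain d where d: "d \<in> {(s, T) \<in> ?D. e i \<inter> s \<in> T}" "p (s, T) = p d" unfolding J_def by blast
      have "d \<in> ?D" using d(1) by blast
      then have "(s, T) = d" using inj_onD[OF p(1) d(2) D] by blast
      then show False using d(1) iT by blast
    qed
    moreover have "p (s, T) \<in> ?K" using p(2) D by blast
    ultimately show "\<exists>a\<in>?K. (\<forall>t\<in>S. a \<in> J t) \<and> a \<notin> J i" by blast
  qed
  then show ?thesis by blast
qed

lemma metrizable_space_base_bound:
  assumes X: "metrizable_space X" and c: "|topspace X| \<le>o r"
  shows "\<exists>B. base_of B X \<and> |B| \<le>o r"
proof -
  obtain M d where M: "Metric_space M d" and X: "X = Metric_space.mtopology M d"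
    using X unfolding metrizable_space_def by blast
  interpret Metric_space M d by (rule M)
  let ?B = "(\<lambda>(x, n::nat). mball x (1 / real (Suc n))) ` (M \<times> UNIV)"
  have "base_of ?B X"
    unfolding base_of_iff
  proof (intro conjI allI impI ballI)
    fix V assume "V \<in> ?B"
    then show "openin X V" using X by auto
  next
    fix U x assume U: "openin X U \<and> x \<in> U"
    then obtain e where e: "e > 0" "mball x e \<subseteq> U" and xM: "x \<in> M"
      unfolding X openin_mtopology by blast
    obtain n :: nat where n: "1 / real (Suc n) < e" using e(1) nat_approx_posE by metis
    have "mball x (1 / real (Suc n)) \<in> ?B" using xM by (intro image_eqI[of _ _ "(x, n)"]) auto
    moreover have "x \<in> mball x (1 / real (Suc n))" using xM by simp
    moreover have "mball x (1 / real (Suc n)) \<subseteq> U" using n e(2) by (force simp: subset_iff)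
    ultimately show "\<exists>V\<in>?B. x \<in> V \<and> V \<subseteq> U"
      by (intro bexI[of _ "mball x (1 / real (Suc n))"] conjI)
  qed
  moreover have "|?B| \<le>o r"
    using c X by (intro image_bound card_of_Times_bound[OF _ countable_bound]) simp_all
  ultimately show ?thesis by blast
qed

end

lemma branch_subset_lists:
  assumes "Well_order r" "a \<in> Field r"
  shows "branch r a \<subseteq> lists (Field r \<times> UNIV)"
  using branch_rank(3)[OF assms] by (auto simp: lists_eq_set)

lemma card_of_pieces:
  assumes r: "Cinfinite r" and c: "continuum \<le>o r"
  shows "|pieces r| =o r"
proof -
  have wo: "Well_order r" using r by (simp add: card_order_on_def)
  have K: "|Field r| =o r" using r card_of_Field_ordIso by blast
  then have K': "|Field r| \<le>o r" using ordIso_iff_ordLeq by blast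
  have re: "|UNIV :: real set| \<le>o r" using card_of_real_le_continuum c ordLeq_transitive by blast
  have er: "|erdos| \<le>o r" using card_of_erdos_le_continuum c ordLeq_transitive by blast
  let ?C = "insert None (Some ` (erdos \<times> (lists (Field r \<times> (UNIV :: real set)) \<times> (UNIV :: real set))))"
  have "|Some ` (erdos \<times> (lists (Field r \<times> (UNIV :: real set)) \<times> (UNIV :: real set)))| \<le>o r"
    by (intro image_bound[OF r] card_of_Times_bound[OF r] lists_bound[OF r] er re K')
  then have "|{None} \<union> Some ` (erdos \<times> (lists (Field r \<times> (UNIV :: real set)) \<times> (UNIV :: real set)))| \<le>o r"
    by (rule Un_Cinfinite_bound[OF countable_bound[OF r] _ r, rotated]) simp
  then have "|?C| \<le>o r" by simp
  moreover have "|Field r \<times> (UNIV :: nat set)| \<le>o r"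
    by (rule card_of_Times_bound[OF r K' countable_bound[OF r]]) simp
  ultimately have "|(Field r \<times> (UNIV :: nat set)) \<times> ?C| \<le>o r"
    by (rule card_of_Times_bound[OF r, rotated])
  moreover have "pieces r \<subseteq> (Field r \<times> UNIV) \<times> ?C"
    using branch_subset_lists[OF wo] by (fastforce simp: pieces_def piece_def)
  ultimately have le: "|pieces r| \<le>o r" by (rule subset_bound[OF r, rotated])
  \<comment> \<open>The apexes of the copies numbered 0 already give the lower bound.\<close>
  have "inj_on (\<lambda>a. ((a, 0::nat), None)) (Field r)" by (auto simp: inj_on_def)
  moreover have "(\<lambda>a. ((a, 0::nat), None)) ` Field r \<subseteq> pieces r"
    using None_in_piece by (auto simp: pieces_def)
  ultimately have "|Field r| \<le>o |pieces r|" unfolding card_of_ordLeq[symmetric] by blast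
  then have "r \<le>o |pieces r|" using K ordIso_symmetric ordIso_ordLeq_trans by blast
  then show ?thesis using le ordIso_iff_ordLeq by blast
qed

lemma card_of_filter_space:
  assumes r: "Cinfinite r" and c: "continuum \<le>o r"
  shows "|topspace (filter_space r J A)| =o r"
proof -
  note p = card_of_pieces[OF r c]
  then have "|pieces r| \<le>o r" using ordIso_iff_ordLeq by blast
  then have "|{None} \<union> Some ` pieces r| \<le>o r"
    by (intro Un_Cinfinite_bound[OF countable_bound[OF r] image_bound[OF r] r]) simp_all
  moreover have "|pieces r| \<le>o |{None} \<union> Some ` pieces r|"
    unfolding card_of_ordLeq[symmetric] by (intro exI[of _ Some]) auto
  then have "r \<le>o |{None} \<union> Some ` pieces r|"
    using p ordIso_symmetric ordIso_ordLeq_trans by blast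
  ultimately show ?thesis unfolding topspace_filter_space by (simp add: ordIso_iff_ordLeq)
qed

text \<open>Balls of the metrizable part and the neighbourhoods of \<infinity>, indexed by a number
  and a finite subset of \<open>A\<close>, form a base of size at most \<open>m\<close>. The lower
  bound comes from the character of \<infinity>.\<close>

lemma has_weight_filter_space:
  fixes m :: "'m rel"
  assumes r: "Cinfinite r" and c: "continuum \<le>o r" and m: "Cinfinite m" and le: "r \<le>o m"
    and ind: "independent_family (Field r) J I" and A: "A \<subseteq> I" "|A| =o m"
  shows "has_weight (filter_space r J A) m"
proof -
  let ?X = "filter_space r J A"
  have "|pieces r| \<le>o m" using card_of_pieces[OF r c] le ordIso_ordLeq_trans by blast
  then obtain B where B: "base_of B (pieces_topology r)" "|B| \<le>o m"
    using metrizable_space_base_bound[OF m metrizable_pieces_topology] by auto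
  let ?N = "(\<lambda>(n, S). insert None (Some ` apex_nbhd r J n S)) ` (UNIV \<times> Fpow A)"
  have base: "base_of ((`) Some ` B \<union> ?N) ?X"
    unfolding base_of_iff
  proof (intro conjI allI impI ballI)
    fix V assume "V \<in> (`) Some ` B \<union> ?N"
    then consider W where "V = Some ` W" "W \<in> B"
      | n S where "V = insert None (Some ` apex_nbhd r J n S)" "finite S" "S \<subseteq> A"
      by (auto simp: Fpow_def)
    then show "openin ?X V"
    proof cases
      case 1
      then show ?thesis using B(1) by (simp add: openin_filter_space_Some base_of_iff)
    next
      case 2
      then show ?thesis
        using openin_filter_space_insert_None[OF openin_apex_nbhd _ _ order_refl] by simp
    qed
  next
    fix U x assume U: "openin ?X U \<and> x \<in> U"
    show "\<exists>V\<in>(`) Some ` B \<union> ?N. x \<in> V \<and> V \<subseteq> U"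
    proof (cases x)
      case None
      then have UN: "openin ?X U" "None \<in> U" using U by simp_all
      then obtain n S where S: "finite S" "S \<subseteq> A" "Some ` apex_nbhd r J n S \<subseteq> U"
        by (rule openin_filter_space_None)
      have "insert None (Some ` apex_nbhd r J n S) \<in> ?N"
        by (rule image_eqI[of _ _ "(n, S)"]) (use S in \<open>simp_all add: Fpow_def\<close>)
      then show ?thesis
        by (intro bexI[OF _ UnI2]) (use S(3) None UN(2) in simp_all)
    next
      case (Some w)
      have "openin (pieces_topology r) {v. Some v \<in> U}"
        using conjunct1[OF U] unfolding filter_space_def by (rule openin_adjoin_point_vimage[OF apex_base])
      moreover have "w \<in> {v. Some v \<in> U}" using U Some by simp
      ultimately obtain V where "V \<in> B" "w \<in> V" "V \<subseteq> {v. Some v \<in> U}"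
        using B(1) unfolding base_of_iff by meson
      then show ?thesis using Some by (intro bexI[of _ "Some ` V"]) auto
    qed
  qed
  have "|A| \<le>o m" using A(2) ordIso_iff_ordLeq by blast
  then have "|?N| \<le>o m"
    by (intro image_bound[OF m] card_of_Times_bound[OF m countable_bound[OF m] Fpow_bound[OF m]]) simp_all
  then have "|(`) Some ` B \<union> ?N| \<le>o m"
    by (rule Un_Cinfinite_bound[OF image_bound[OF m B(2)] _ m])
  then show ?thesis
  proof (rule has_weightI[OF base])
    fix C assume C: "base_of C ?X"
    have "infinite A"
      using Cinfinite_cong[OF ordIso_symmetric[OF A(2)] m] by (simp add: cinfinite_def Field_card_of)
    then have "|A| \<le>o |C|" by (rule weight_filter_space_ge[OF ind A(1) _ C])
    then show "m \<le>o |C|" using A(2) ordIso_symmetric ordIso_ordLeq_trans by blast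
  qed
qed

lemma uncountable_of_continuum_le:
  assumes "continuum \<le>o |A|"
  shows "uncountable A"
proof
  assume "countable A"
  then have "|A| \<le>o |UNIV :: nat set|"
    unfolding card_of_ordLeq[symmetric] countable_def by blast
  then have "continuum \<le>o |UNIV :: nat set|" using assms ordLeq_transitive by blast
  then have "|Pow (UNIV :: nat set)| \<le>o |UNIV :: nat set|"
    using card_of_nat_sets ordIso_ordLeq_trans by simp blast
  then show False using card_of_Pow not_ordLess_ordLeq by blast
qed

text \<open>The spaces are built on a larger type, but have exactly the size of the field of
  \<kappa>. Each is therefore copied to that field along a bijection, and the properties are carried
  over by the homeomorphism.\<close>

theorem theorem4:
  fixes \<kappa> :: "'k rel" and \<mu> :: "'l rel"
  assumes "Cinfinite \<kappa>" and "Cinfinite \<mu>"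
    and "continuum \<le>o \<kappa>" and "\<kappa> \<le>o \<mu>" and "\<mu> \<le>o ctwo ^c \<kappa>"
  shows "\<exists>F :: 'k topology set.
    |F| =o ctwo ^c \<mu> \<and>
    pairwise (\<lambda>X Y. \<not> X homeomorphic_space Y) F \<and>
    (\<forall>X\<in>F.
      connected_space X \<and>
      totally_pathwise_disconnected_space X \<and>
      nowhere_locally_connected_space X \<and>
      almost_metrizable_space X \<and>
      |topspace X| =o \<kappa> \<and>
      has_weight X \<mu>)"
proof -
  let ?M = "Field \<mu>" and ?I = "Field \<mu> \<times> (UNIV :: bool set)"
  note k = assms(1) and m = assms(2)
  have wo: "Well_order \<kappa>" using k by (simp add: card_order_on_def)
  have M: "|?M| =o \<mu>" using m card_of_Field_ordIso by blast
  then have "|?M| \<le>o \<mu>" using ordIso_iff_ordLeq by blast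
  then have "|?I| \<le>o \<mu>" by (rule card_of_Times_bound[OF m _ countable_bound[OF m]]) simp
  then have "|?I| \<le>o ctwo ^c \<kappa>" using assms(5) ordLeq_transitive by blast
  then obtain J where J: "independent_family (Field \<kappa>) J ?I"
    using independent_family_exists[OF k] by blast
  \<comment> \<open>One member is selected from each pair \<open>(i, True)\<close>,
    \<open>(i, False)\<close>. All selections have size \<mu> and different ones are incomparable,
    so some member of \<open>A P\<close> is always missing from \<open>A Q\<close>.\<close>
  define A where "A P = (\<lambda>i. (i, i \<in> P)) ` ?M" for P
  have AI: "A P \<subseteq> ?I" for P by (auto simp: A_def)
  have A_card: "|A P| =o \<mu>" for P
  proof -
    have "bij_betw (\<lambda>i. (i, i \<in> P)) ?M (A P)" by (auto simp: A_def bij_betw_def inj_on_def)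
    then have "|?M| =o |A P|" by (rule card_of_ordIsoI)
    then show ?thesis using M ordIso_symmetric ordIso_transitive by blast
  qed
  have A_unc: "uncountable (A P)" for P
  proof (rule uncountable_of_continuum_le)
    show "continuum \<le>o |A P|"
      using A_card[of P] assms(3,4) ordLeq_transitive ordLeq_ordIso_trans ordIso_symmetric by metis
  qed
  define X where "X P = filter_space \<kappa> J (A P)" for P
  have X_card: "|topspace (X P)| =o \<kappa>" for P
    unfolding X_def by (rule card_of_filter_space[OF k assms(3)])
  have "\<exists>f. bij_betw f (Field \<kappa>) (topspace (X P))" for P
  proof -
    have "|Field \<kappa>| =o |topspace (X P)|"
      using X_card[of P] k card_of_Field_ordIso ordIso_symmetric ordIso_transitive by blast
    then show ?thesis unfolding card_of_ordIso[symmetric] .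
  qed
  then obtain f where f: "\<And>P. bij_betw (f P) (Field \<kappa>) (topspace (X P))" by metis
  define Y where "Y P = pullback_topology (Field \<kappa>) (f P) (X P)" for P
  have h: "homeomorphic_map (Y P) (X P) (f P)" for P
    unfolding Y_def by (rule homeomorphic_map_pullback[OF f])
  have not_hom: "\<not> Y P homeomorphic_space Y Q" if PQ: "P \<subseteq> ?M" "Q \<subseteq> ?M" "P \<noteq> Q" for P Q
  proof
    assume "Y P homeomorphic_space Y Q"
    then have "X P homeomorphic_space X Q"
      using h homeomorphic_map_imp_homeomorphic_space homeomorphic_space_sym homeomorphic_space_trans by meson
    moreover obtain i where "i \<in> ?M" "i \<in> P \<longleftrightarrow> i \<notin> Q" using PQ by blast
    then have "(i, i \<in> P) \<in> A P" "(i, i \<in> P) \<notin> A Q" by (auto simp: A_def)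
    ultimately show False
      using filter_space_not_homeomorphic[OF J wo AI A_unc AI] unfolding X_def by blast
  qed
  have inj: "inj_on Y (Pow ?M)"
  proof (rule inj_onI, rule ccontr)
    fix P Q assume "P \<in> Pow ?M" "Q \<in> Pow ?M" "Y P = Y Q" "P \<noteq> Q"
    then show False using not_hom[of P Q] homeomorphic_space_refl[of "Y P"] by simp
  qed
  have props: "connected_space (Y P) \<and> totally_pathwise_disconnected_space (Y P) \<and>
      nowhere_locally_connected_space (Y P) \<and> almost_metrizable_space (Y P) \<and>
      |topspace (Y P)| =o \<kappa> \<and> has_weight (Y P) \<mu>" for P
  proof (intro conjI)
    show "connected_space (Y P)"
      using homeomorphic_connected_space[OF homeomorphic_map_imp_homeomorphic_space[OF h]] connected_filter_space
      unfolding X_def by blast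
    show "totally_pathwise_disconnected_space (Y P)"
      by (rule totally_pathwise_disconnected_homeomorphic[OF h])
        (simp add: X_def totally_pathwise_disconnected_filter_space)
    show "almost_metrizable_space (Y P)"
      by (rule almost_metrizable_homeomorphic[OF h]) (simp add: X_def almost_metrizable_filter_space)
    show "has_weight (Y P) \<mu>"
      by (rule has_weight_homeomorphic[OF h])
        (simp add: X_def has_weight_filter_space[OF k assms(3) m assms(4) J AI A_card])
    have "A P \<noteq> {}" using A_unc[of P] by (metis countable_empty)
    then obtain s where s: "s \<in> A P" by blast
    \<comment> \<open>Independence with no constraints: \<open>J s\<close> omits some index.\<close>
    then obtain a where a: "a \<in> Field \<kappa>" "a \<notin> J s"
      using J AI[of P] unfolding independent_family_def
      by (metis Diff_empty empty_subsetI finite.emptyI subsetD)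
    have "nowhere_locally_connected_space (X P)"
      unfolding X_def using s a by (rule nowhere_locally_connected_filter_space)
    then show "nowhere_locally_connected_space (Y P)"
      by (rule nowhere_locally_connected_homeomorphic[OF h])
    have "bij_betw (f P) (topspace (Y P)) (topspace (X P))"
      using homeomorphic_imp_surjective_map[OF h] homeomorphic_imp_injective_map[OF h]
      by (simp add: bij_betw_def)
    then show "|topspace (Y P)| =o \<kappa>"
      using card_of_ordIsoI X_card ordIso_transitive by blast
  qed
  have "|Pow ?M| =o |Y ` Pow ?M|"
    by (rule card_of_ordIsoI[of Y]) (simp add: bij_betw_def inj)
  moreover have "|Pow ?M| =o ctwo ^c \<mu>"
    unfolding cexp_def ctwo_def Field_card_of by (rule card_of_Pow_Func)
  ultimately have "|Y ` Pow ?M| =o ctwo ^c \<mu>"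
    using ordIso_symmetric ordIso_transitive by blast
  moreover have "pairwise (\<lambda>X Y. \<not> X homeomorphic_space Y) (Y ` Pow ?M)"
    unfolding pairwise_def using not_hom by blast
  ultimately show ?thesis using props by (intro exI[of _ "Y ` Pow ?M"]) blast
qed

end
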